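(* There is an absolute constant $C>0$ such that the following holds. Let $\gamma\in(0,1)$, $\xi\in(0,1/n]$, $\delta\in(0,1)$, and let $\widehat\pi$ be an optimal policy of the discounted MDP $(\widehat P,\widetilde r,\gamma)$. Then with probability at least $1-\delta$, $$\|V^{\widehat\pi}_\gamma-V^\star_\gamma\|_\infty\le\frac{1}{1-\gamma}\sqrt{\frac{C\log^3\!\big(\frac{SAn}{(1-\gamma)\delta\xi}\big)}{n}\Big(\|V^\star_\gamma\|_{\mathrm{sp}}+\|V^{\widehat\pi}_\gamma\|_{\mathrm{sp}}+1\Big)} .$$
   Context: $\mathcal S$ finite with $S$ states, $\mathcal A$ finite with $A$ actions; transition kernel $P$; known reward $r:\mathcal S\times\mathcal A\to[0,1]$. Policies stationary Markov; $P_\pi,r_\pi$ induced matrix/reward. Empirical kernel $\widehat P$: $n$ i.i.d. samples from each $P(\cdot|s,a)$, independent across pairs, $\widehat P(s'|s,a)$ = fraction equal to $s'$. Perturbed reward $\widetilde r=r+\Delta$, $\Delta(s,a)$ i.i.d. Uniform$[0,\xi]$ independent of the samples. $V^\pi_\gamma=(I-\gamma P_\pi)^{-1}r_\pi$ and $V^\star_\gamma=\max_\pi V^\pi_\gamma$ are computed in the true model $(P,r)$; an optimal policy of $(\widehat P,\widetilde r,\gamma)$ maximizes $(I-\gamma\widehat P_\pi)^{-1}\widetilde r_\pi$ elementwise. $\|x\|_{\mathrm{sp}}=\max x-\min x$. *)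

theory Defs
  imports "HOL-Probability.Probability"
begin

text \<open>States are the naturals below S, actions the naturals below A.
  A (stationary Markov, possibly randomized) policy assigns to each state a
  distribution over actions; a kernel is given pointwise as a function K s a s'.\<close>

definition is_policy :: "nat \<Rightarrow> nat \<Rightarrow> (nat \<Rightarrow> nat \<Rightarrow> real) \<Rightarrow> bool" where
  "is_policy S A \<pi> \<longleftrightarrow> (\<forall>s<S. (\<forall>a<A. 0 \<le> \<pi> s a) \<and> (\<Sum>a<A. \<pi> s a) = 1)"

definition P_pol :: "nat \<Rightarrow> (nat \<Rightarrow> nat \<Rightarrow> nat \<Rightarrow> real) \<Rightarrow> (nat \<Rightarrow> nat \<Rightarrow> real) \<Rightarrow> nat \<Rightarrow> nat \<Rightarrow> real" where
  "P_pol A K \<pi> s s' = (\<Sum>a<A. \<pi> s a * K s a s')"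

definition r_pol :: "nat \<Rightarrow> (nat \<Rightarrow> nat \<Rightarrow> real) \<Rightarrow> (nat \<Rightarrow> nat \<Rightarrow> real) \<Rightarrow> nat \<Rightarrow> real" where
  "r_pol A r \<pi> s = (\<Sum>a<A. \<pi> s a * r s a)"

text \<open>V^pi = (I - gamma P_pi)^{-1} r_pi, i.e. the unique vector on {..<S}
  (extended by 0 outside) solving (I - gamma P_pi) V = r_pi.\<close>
definition Vpol :: "nat \<Rightarrow> nat \<Rightarrow> (nat \<Rightarrow> nat \<Rightarrow> nat \<Rightarrow> real) \<Rightarrow> (nat \<Rightarrow> nat \<Rightarrow> real) \<Rightarrow> real
      \<Rightarrow> (nat \<Rightarrow> nat \<Rightarrow> real) \<Rightarrow> nat \<Rightarrow> real" where
  "Vpol S A K r \<gamma> \<pi> = (THE V. (\<forall>s. S \<le> s \<longrightarrow> V s = 0) \<and>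
      (\<forall>s<S. V s - \<gamma> * (\<Sum>s'<S. P_pol A K \<pi> s s' * V s') = r_pol A r \<pi> s))"

definition Vstar :: "nat \<Rightarrow> nat \<Rightarrow> (nat \<Rightarrow> nat \<Rightarrow> nat \<Rightarrow> real) \<Rightarrow> (nat \<Rightarrow> nat \<Rightarrow> real) \<Rightarrow> real \<Rightarrow> nat \<Rightarrow> real" where
  "Vstar S A K r \<gamma> s = (SUP \<pi>\<in>{\<pi>. is_policy S A \<pi>}. Vpol S A K r \<gamma> \<pi> s)"

definition is_optimal_policy :: "nat \<Rightarrow> nat \<Rightarrow> (nat \<Rightarrow> nat \<Rightarrow> nat \<Rightarrow> real) \<Rightarrow> (nat \<Rightarrow> nat \<Rightarrow> real) \<Rightarrow> real
      \<Rightarrow> (nat \<Rightarrow> nat \<Rightarrow> real) \<Rightarrow> bool" where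
  "is_optimal_policy S A K r \<gamma> \<pi> \<longleftrightarrow> is_policy S A \<pi> \<and>
     (\<forall>\<pi>'. is_policy S A \<pi>' \<longrightarrow> (\<forall>s<S. Vpol S A K r \<gamma> \<pi>' s \<le> Vpol S A K r \<gamma> \<pi> s))"

definition sup_norm :: "nat \<Rightarrow> (nat \<Rightarrow> real) \<Rightarrow> real" where
  "sup_norm S x = Max ((\<lambda>s. \<bar>x s\<bar>) ` {..<S})"

definition span :: "nat \<Rightarrow> (nat \<Rightarrow> real) \<Rightarrow> real" where
  "span S x = Max (x ` {..<S}) - Min (x ` {..<S})"

definition sample_space :: "nat \<Rightarrow> nat \<Rightarrow> nat \<Rightarrow> (nat \<Rightarrow> nat \<Rightarrow> nat pmf) \<Rightarrow> real
      \<Rightarrow> ((nat \<times> nat \<times> nat \<Rightarrow> nat) \<times> (nat \<times> nat \<Rightarrow> real)) measure" where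
  "sample_space S A n P \<xi> =
     (PiM {(s,a,i). s < S \<and> a < A \<and> i < n} (\<lambda>(s,a,i). measure_pmf (P s a)))
     \<Otimes>\<^sub>M (PiM ({..<S} \<times> {..<A}) (\<lambda>_. uniform_measure lborel {0..\<xi>}))"

definition P_hat :: "nat \<Rightarrow> (nat \<times> nat \<times> nat \<Rightarrow> nat) \<Rightarrow> nat \<Rightarrow> nat \<Rightarrow> nat \<Rightarrow> real" where
  "P_hat n X s a s' = real (card {i. i < n \<and> X (s,a,i) = s'}) / real n"

definition r_tilde :: "(nat \<Rightarrow> nat \<Rightarrow> real) \<Rightarrow> (nat \<times> nat \<Rightarrow> real) \<Rightarrow> nat \<Rightarrow> nat \<Rightarrow> real" where
  "r_tilde r D s a = r s a + D (s,a)"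

end

theory Submission
  imports Defs
begin

text \<open>Write the true value \<open>V\<close> of a policy as a solution of the empirical Bellman equation with an
  error \<open>e\<close>. An empirical Bernstein bound controls \<open>\<bar>e\<bar>\<close> by a multiple \<open>\<lambda>\<close> of the empirical one-step
  variance of \<open>V\<close> plus \<open>L / (\<lambda> n)\<close>, and the discounted sum of these variances telescopes against the
  Lyapunov function \<open>\<lambda> (V - min V)\<^sup>2\<close>, whose size is governed by the span of \<open>V\<close>; optimizing over \<open>\<lambda>\<close>
  gives the square root rate. For the empirically optimal policy, which depends on the samples, fix
  a pair \<open>(s,a)\<close>, erase its row and pay a number \<open>q\<close> there instead. With \<open>q\<close> close to the empirical
  one-step value at \<open>(s,a)\<close> the optimal policy is unchanged, because the random perturbation of the
  rewards separates any two actions in a state with high probability. So the policy is one of those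
  obtained from a finite grid of numbers \<open>q\<close>, and these are independent of the row at \<open>(s,a)\<close>.\<close>

section \<open>Optimal values for sub-stochastic kernels\<close>

text \<open>A union bound over deterministic policies would cost a factor exponential in
  \<open>S\<close>. Summed over policies these events weigh at most one, so a policy-dependent test
  function costs no more than a fixed one. The union runs only over pairs and grid points, whose
  number enters through a logarithm. The Bernstein step has to produce the empirical variance of the
  true value: error and Lyapunov function then live under the same empirical kernel, and no span of
  an empirical value appears. Products of mean-one factors \<open>1 + u\<close> achieve this, since
  Markov's inequality bounds the product and \<open>ln (1 + u) \<ge> u - 2 * u\<^sup>2\<close>
  brings in the observed squares. The multiplier \<lambda> must be small against the span; if the
  balancing \<lambda> is not, the claimed bound exceeds the trivial one. The perturbation only
  separates actions: sampling errors are measured with the unperturbed reward, at an extra cost of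
  \<open>\<xi> / (1 - \<gamma>)\<close>.\<close>

lemma max_principle:
  fixes d :: "nat \<Rightarrow> real"
  assumes g: "0 \<le> \<gamma>" "\<gamma> < 1" and B: "0 \<le> B"
    and step: "\<And>s. s < S \<Longrightarrow> d s \<le> B \<or> (\<exists>w. (\<forall>s'<S. 0 \<le> w s') \<and> (\<Sum>s'<S. w s') \<le> 1
          \<and> d s \<le> \<gamma> * (\<Sum>s'<S. w s' * d s') + (1 - \<gamma>) * B)"
    and s: "s < S"
  shows "d s \<le> B"
proof -
  \<comment> \<open>Evaluated at a maximizer. Weights of sum below one are harmless because
    \<open>B\<close> is nonnegative. Weights may vary with the state, which spares any choice of
    kernel, and the alternative \<open>d s \<le> B\<close> serves states whose bound is known
    outright, such as those attaining a frozen value.\<close>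
  define m where "m = Max (d ` {..<S})"
  have dm: "d s' \<le> m" if "s' < S" for s' using that unfolding m_def by auto
  have "m \<in> d ` {..<S}" unfolding m_def using s by (intro Max_in) auto
  then obtain t where t: "t < S" "m = d t" by auto
  have "m \<le> B"
  proof (rule ccontr)
    assume c: "\<not> m \<le> B"
    then obtain w where w: "\<forall>s'<S. 0 \<le> w s'" "(\<Sum>s'<S. w s') \<le> 1"
        "d t \<le> \<gamma> * (\<Sum>s'<S. w s' * d s') + (1 - \<gamma>) * B"
      using step[OF t(1)] t(2) by auto
    have "(\<Sum>s'<S. w s' * d s') \<le> (\<Sum>s'<S. w s' * m)"
      using w(1) dm by (intro sum_mono mult_left_mono) auto
    also have "\<dots> = (\<Sum>s'<S. w s') * m" by (simp add: sum_distrib_right)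
    also have "\<dots> \<le> 1 * m" using w(2) c B by (intro mult_right_mono) auto
    finally have "\<gamma> * (\<Sum>s'<S. w s' * d s') \<le> \<gamma> * m" using g by (intro mult_left_mono) auto
    then have "(1 - \<gamma>) * m \<le> (1 - \<gamma>) * B" using w(3) t(2) by (simp add: algebra_simps)
    then show False using c g by auto
  qed
  then show ?thesis using dm[OF s] by simp
qed

text \<open>Mass may be missing: erasing a row leaves zeros, and an empirical row loses the samples
  outside \<open>{..<S}\<close>, which occur with probability zero but cannot be excluded
  pointwise.\<close>

definition substoch :: "nat \<Rightarrow> nat \<Rightarrow> (nat \<Rightarrow> nat \<Rightarrow> nat \<Rightarrow> real) \<Rightarrow> bool" where
  "substoch S A K \<longleftrightarrow> (\<forall>s<S. \<forall>a<A. (\<forall>s'<S. 0 \<le> K s a s') \<and> (\<Sum>s'<S. K s a s') \<le> 1)"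

definition qval :: "nat \<Rightarrow> (nat \<Rightarrow> nat \<Rightarrow> nat \<Rightarrow> real) \<Rightarrow> (nat \<Rightarrow> nat \<Rightarrow> real) \<Rightarrow> real
    \<Rightarrow> (nat \<Rightarrow> real) \<Rightarrow> nat \<Rightarrow> nat \<Rightarrow> real" where
  "qval S K c \<gamma> V s a = c s a + \<gamma> * (\<Sum>s'<S. K s a s' * V s')"

primrec viter :: "nat \<Rightarrow> nat \<Rightarrow> (nat \<Rightarrow> nat \<Rightarrow> nat \<Rightarrow> real) \<Rightarrow> (nat \<Rightarrow> nat \<Rightarrow> real) \<Rightarrow> real
    \<Rightarrow> nat \<Rightarrow> nat \<Rightarrow> real" where
  "viter S A K c \<gamma> 0 = (\<lambda>s. 0)"
| "viter S A K c \<gamma> (Suc k) = (\<lambda>s. Max ((\<lambda>a. qval S K c \<gamma> (viter S A K c \<gamma> k) s a) ` {..<A}))"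

text \<open>The limit of value iteration rather than a supremum over policies: a limit of finite
  maxima is measurable in kernel and reward, and the Bellman equation is obtained by passing to the
  limit.\<close>

definition Vopt :: "nat \<Rightarrow> nat \<Rightarrow> (nat \<Rightarrow> nat \<Rightarrow> nat \<Rightarrow> real) \<Rightarrow> (nat \<Rightarrow> nat \<Rightarrow> real) \<Rightarrow> real
    \<Rightarrow> nat \<Rightarrow> real" where
  "Vopt S A K c \<gamma> s = lim (\<lambda>k. viter S A K c \<gamma> k s)"

lemma Max_image_diff_le:
  fixes f g :: "'a \<Rightarrow> real"
  assumes "finite A" "A \<noteq> {}" "\<And>a. a \<in> A \<Longrightarrow> \<bar>f a - g a\<bar> \<le> b"
  shows "\<bar>Max (f ` A) - Max (g ` A)\<bar> \<le> b"
proof -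
  have *: "Max (f ` A) - Max (g ` A) \<le> b" if "\<And>a. a \<in> A \<Longrightarrow> f a - g a \<le> b" for f g :: "'a \<Rightarrow> real"
  proof -
    have "Max (f ` A) \<in> f ` A" using assms by (intro Max_in) auto
    then obtain a where a: "a \<in> A" "Max (f ` A) = f a" by auto
    have "g a \<le> Max (g ` A)" using a assms by auto
    then show ?thesis using that[OF a(1)] a by simp
  qed
  show ?thesis using *[of f g] *[of g f] assms(3) by (fastforce simp: abs_le_iff)
qed

lemma qval_diff_le:
  assumes "substoch S A K" "0 \<le> \<gamma>" "s < S" "a < A" "0 \<le> b"
    and "\<And>s'. s' < S \<Longrightarrow> \<bar>V s' - V' s'\<bar> \<le> b"
  shows "\<bar>qval S K c \<gamma> V s a - qval S K c \<gamma> V' s a\<bar> \<le> \<gamma> * b"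
proof -
  have k: "\<And>s'. s' < S \<Longrightarrow> 0 \<le> K s a s'" "(\<Sum>s'<S. K s a s') \<le> 1"
    using assms unfolding substoch_def by auto
  have "\<bar>\<Sum>s'<S. K s a s' * (V s' - V' s')\<bar> \<le> (\<Sum>s'<S. \<bar>K s a s' * (V s' - V' s')\<bar>)"
    by (rule sum_abs)
  also have "\<dots> \<le> (\<Sum>s'<S. K s a s' * b)"
    using k assms(6) by (intro sum_mono) (auto simp: abs_mult intro!: mult_left_mono)
  also have "\<dots> = (\<Sum>s'<S. K s a s') * b" by (simp add: sum_distrib_right)
  also have "\<dots> \<le> 1 * b" using k assms by (intro mult_right_mono) auto
  finally have *: "\<gamma> * \<bar>\<Sum>s'<S. K s a s' * (V s' - V' s')\<bar> \<le> \<gamma> * b"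
    using assms by (intro mult_left_mono) auto
  have "qval S K c \<gamma> V s a - qval S K c \<gamma> V' s a = \<gamma> * (\<Sum>s'<S. K s a s' * (V s' - V' s'))"
    by (simp add: qval_def algebra_simps sum_subtractf)
  then show ?thesis using * assms by (simp add: abs_mult)
qed

lemma viter_convergent:
  assumes K: "substoch S A K" and A: "0 < A" and g: "0 \<le> \<gamma>" "\<gamma> < 1" and s: "s < S"
  shows "convergent (\<lambda>k. viter S A K c \<gamma> k s)"
proof -
  let ?v = "viter S A K c \<gamma>"
  \<comment> \<open>The iteration starts at zero, so \<open>b\<close> is the largest first
    increment; each further step contracts increments by \<open>\<gamma>\<close>.\<close>
  define b where "b = Max ((\<lambda>s. \<bar>?v 1 s\<bar>) ` {..<S})"
  have b1: "\<bar>?v 1 t\<bar> \<le> b" if "t < S" for t unfolding b_def using that by auto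
  have b0: "0 \<le> b" using b1[OF s] by linarith
  have diff: "t < S \<Longrightarrow> \<bar>?v (Suc k) t - ?v k t\<bar> \<le> \<gamma> ^ k * b" for k t
  proof (induction k arbitrary: t)
    case 0
    then show ?case using b1[of t] by simp
  next
    case (Suc k)
    have "\<bar>?v (Suc (Suc k)) t - ?v (Suc k) t\<bar> \<le> \<gamma> * (\<gamma> ^ k * b)"
      using Suc A b0 g unfolding viter.simps(2)
      by (intro Max_image_diff_le qval_diff_le[OF K]) auto
    then show ?case by simp
  qed
  have "summable (\<lambda>k. \<gamma> ^ k * b)" using g by (intro summable_mult2 summable_geometric) auto
  then have "summable (\<lambda>k. ?v (Suc k) s - ?v k s)"
    by (rule summable_comparison_test'[where N = 0]) (use diff[OF s] in \<open>simp del: viter.simps\<close>)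
  then have "convergent (\<lambda>n. \<Sum>k<n. ?v (Suc k) s - ?v k s)"
    unfolding summable_iff_convergent .
  moreover have "(\<Sum>k<n. ?v (Suc k) s - ?v k s) = ?v n s" for n
    using sum_lessThan_telescope[of "\<lambda>k. ?v k s" n] by (simp del: viter.simps(2))
  ultimately show ?thesis by simp
qed

lemma Vopt_limit:
  assumes "substoch S A K" "0 < A" "0 \<le> \<gamma>" "\<gamma> < 1" "s < S"
  shows "(\<lambda>k. viter S A K c \<gamma> k s) \<longlonglongrightarrow> Vopt S A K c \<gamma> s"
  using viter_convergent[OF assms] unfolding Vopt_def by (simp add: convergent_LIMSEQ_iff)

lemma qval_limit:
  assumes "substoch S A K" "0 < A" "0 \<le> \<gamma>" "\<gamma> < 1"
  shows "(\<lambda>k. qval S K c \<gamma> (viter S A K c \<gamma> k) s a) \<longlonglongrightarrow> qval S K c \<gamma> (Vopt S A K c \<gamma>) s a"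
  unfolding qval_def using Vopt_limit[OF assms] by (intro tendsto_intros) auto

lemma Vopt_ge:
  assumes K: "substoch S A K" "0 < A" "0 \<le> \<gamma>" "\<gamma> < 1" and s: "s < S" and a: "a < A"
  shows "qval S K c \<gamma> (Vopt S A K c \<gamma>) s a \<le> Vopt S A K c \<gamma> s"
  using a by (intro LIMSEQ_le[OF qval_limit[OF K] LIMSEQ_Suc[OF Vopt_limit[OF K s]]]) auto

text \<open>The maximum over finitely many actions survives the limit: if every action stayed
  strictly below \<open>Vopt\<close>, the midpoint between \<open>Vopt\<close> and their maximum
  would eventually bound the iterates at \<open>s\<close>.\<close>

lemma Vopt_attained:
  assumes K: "substoch S A K" "0 < A" "0 \<le> \<gamma>" "\<gamma> < 1" and s: "s < S"
  shows "\<exists>a<A. Vopt S A K c \<gamma> s = qval S K c \<gamma> (Vopt S A K c \<gamma>) s a"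
proof (rule ccontr)
  let ?V = "Vopt S A K c \<gamma>" let ?v = "viter S A K c \<gamma>"
  assume c: "\<not> ?thesis"
  have lt: "qval S K c \<gamma> ?V s a < ?V s" if "a < A" for a
    using Vopt_ge[OF K s that] c that by (auto simp: less_le)
  define m where "m = Max ((\<lambda>a. qval S K c \<gamma> ?V s a) ` {..<A})"
  have m: "m < ?V s" unfolding m_def using lt K(2) by (subst Max_less_iff) auto
  have qm: "qval S K c \<gamma> ?V s a < (m + ?V s) / 2" if "a < A" for a
  proof -
    have "qval S K c \<gamma> ?V s a \<le> m" unfolding m_def using that by auto
    then show ?thesis using m by (simp add: field_simps)
  qed
  have "\<forall>\<^sub>F k in sequentially. \<forall>a\<in>{..<A}. qval S K c \<gamma> (?v k) s a < (m + ?V s) / 2"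
    using qm by (intro eventually_ball_finite ballI order_tendstoD(2)[OF qval_limit[OF K]]) auto
  then have "\<forall>\<^sub>F k in sequentially. ?v (Suc k) s \<le> (m + ?V s) / 2"
  proof eventually_elim
    case (elim k)
    then show ?case unfolding viter.simps(2)
      using K(2) by (subst Max_le_iff) (auto intro: less_imp_le)
  qed
  then have "?V s \<le> (m + ?V s) / 2"
    by (intro tendsto_upperbound[OF LIMSEQ_Suc[OF Vopt_limit[OF K s]]]) auto
  then show False using m by (simp add: field_simps)
qed

lemma qval_diff:
  "qval S K c \<gamma> V s a - qval S K c' \<gamma> V' s a
     = (c s a - c' s a) + \<gamma> * (\<Sum>s'<S. K s a s' * (V s' - V' s'))"
  by (simp add: qval_def algebra_simps sum_subtractf)

text \<open>Two comparisons by the maximum principle: each difference is evaluated at an action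
  attaining its first term, where the subtracted value is at least its own one-step value.\<close>

lemma Vopt_unique:
  assumes K: "substoch S A K" "0 < A" "0 \<le> \<gamma>" "\<gamma> < 1"
    and ge: "\<And>s a. s < S \<Longrightarrow> a < A \<Longrightarrow> qval S K c \<gamma> V s a \<le> V s"
    and at: "\<And>s. s < S \<Longrightarrow> \<exists>a<A. V s \<le> qval S K c \<gamma> V s a"
    and s: "s < S"
  shows "V s = Vopt S A K c \<gamma> s"
proof -
  let ?V = "Vopt S A K c \<gamma>"
  have "V s - ?V s \<le> 0"
  proof (rule max_principle[of \<gamma> 0 S "\<lambda>s. V s - ?V s"])
    fix t assume t: "t < S"
    obtain a where a: "a < A" "V t \<le> qval S K c \<gamma> V t a" using at[OF t] by auto
    have "V t - ?V t \<le> \<gamma> * (\<Sum>s'<S. K t a s' * (V s' - ?V s'))"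
      using a Vopt_ge[OF K t a(1), of c] qval_diff[of S K c \<gamma> V t a c ?V] by simp
    then show "V t - ?V t \<le> 0 \<or> (\<exists>w. (\<forall>s'<S. 0 \<le> w s') \<and> (\<Sum>s'<S. w s') \<le> 1
          \<and> V t - ?V t \<le> \<gamma> * (\<Sum>s'<S. w s' * (V s' - ?V s')) + (1 - \<gamma>) * 0)"
      using K(1) t a unfolding substoch_def by (intro disjI2 exI[of _ "K t a"]) auto
  qed (use K s in auto)
  moreover have "?V s - V s \<le> 0"
  proof (rule max_principle[of \<gamma> 0 S "\<lambda>s. ?V s - V s"])
    fix t assume t: "t < S"
    obtain a where a: "a < A" "?V t = qval S K c \<gamma> ?V t a" using Vopt_attained[OF K t] by auto
    have "?V t - V t \<le> \<gamma> * (\<Sum>s'<S. K t a s' * (?V s' - V s'))"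
      using a ge[OF t a(1)] qval_diff[of S K c \<gamma> ?V t a c V] by simp
    then show "?V t - V t \<le> 0 \<or> (\<exists>w. (\<forall>s'<S. 0 \<le> w s') \<and> (\<Sum>s'<S. w s') \<le> 1
          \<and> ?V t - V t \<le> \<gamma> * (\<Sum>s'<S. w s' * (?V s' - V s')) + (1 - \<gamma>) * 0)"
      using K(1) t a unfolding substoch_def by (intro disjI2 exI[of _ "K t a"]) auto
  qed (use K s in auto)
  ultimately show ?thesis by simp
qed

section \<open>Policy evaluation and deterministic optimal policies\<close>

lemma P_pol_sum:
  "r_pol A r \<pi> s + \<gamma> * (\<Sum>s'<S. P_pol A K \<pi> s s' * V s') = (\<Sum>a<A. \<pi> s a * qval S K r \<gamma> V s a)"
proof -
  have "(\<Sum>s'<S. P_pol A K \<pi> s s' * V s') = (\<Sum>a<A. \<Sum>s'<S. \<pi> s a * (K s a s' * V s'))"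
    unfolding P_pol_def sum_distrib_right by (subst sum.swap) (simp add: mult.assoc)
  then show ?thesis
    by (simp add: r_pol_def qval_def distrib_left sum.distrib sum_distrib_left mult.left_commute)
qed

lemma P_pol_substoch:
  assumes K: "substoch S A K" and p: "is_policy S A \<pi>" and s: "s < S"
  shows "s' < S \<Longrightarrow> 0 \<le> P_pol A K \<pi> s s'" "(\<Sum>s'<S. P_pol A K \<pi> s s') \<le> 1"
proof -
  have p: "\<And>a. a < A \<Longrightarrow> 0 \<le> \<pi> s a" "(\<Sum>a<A. \<pi> s a) = 1" using p s unfolding is_policy_def by auto
  show "0 \<le> P_pol A K \<pi> s s'" if "s' < S"
    using p K s that unfolding P_pol_def substoch_def by (intro sum_nonneg) auto
  have "(\<Sum>s'<S. P_pol A K \<pi> s s') = (\<Sum>a<A. \<pi> s a * (\<Sum>s'<S. K s a s'))"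
    unfolding P_pol_def by (subst sum.swap) (simp add: sum_distrib_left)
  also have "\<dots> \<le> (\<Sum>a<A. \<pi> s a * 1)"
    using p K s unfolding substoch_def by (intro sum_mono mult_left_mono) auto
  finally show "(\<Sum>s'<S. P_pol A K \<pi> s s') \<le> 1" using p by simp
qed

text \<open>Averaging over actions turns a policy into a model with a single action, whose optimal
  value is the value of the policy. The Bellman lemmas thus give the existence and uniqueness on
  which the \<open>THE\<close> in \<open>Vpol\<close> rests.\<close>

lemma Vpol_aux:
  assumes K: "substoch S A K" and p: "is_policy S A \<pi>" and g: "0 \<le> \<gamma>" "\<gamma> < 1"
  shows "\<exists>!V. (\<forall>s. S \<le> s \<longrightarrow> V s = 0) \<and>
      (\<forall>s<S. V s - \<gamma> * (\<Sum>s'<S. P_pol A K \<pi> s s' * V s') = r_pol A r \<pi> s)"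
proof -
  define K' where "K' = (\<lambda>s (a::nat) s'. P_pol A K \<pi> s s')"
  define c where "c = (\<lambda>s (a::nat). r_pol A r \<pi> s)"
  let ?V = "Vopt S 1 K' c \<gamma>"
  have K': "substoch S 1 K'"
    unfolding substoch_def K'_def using P_pol_substoch[OF K p] by auto
  have q: "qval S K' c \<gamma> V s a = r_pol A r \<pi> s + \<gamma> * (\<Sum>s'<S. P_pol A K \<pi> s s' * V s')" for V s a
    by (simp add: qval_def K'_def c_def)
  show ?thesis
  proof (rule ex1I[of _ "\<lambda>s. if s < S then ?V s else 0"])
    have "?V s = r_pol A r \<pi> s + \<gamma> * (\<Sum>s'<S. P_pol A K \<pi> s s' * ?V s')" if "s < S" for s
      using Vopt_attained[OF K' _ g that, of c] q by auto
    then show "(\<forall>s. S \<le> s \<longrightarrow> (if s < S then ?V s else 0) = 0) \<and>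
      (\<forall>s<S. (if s < S then ?V s else 0) - \<gamma> * (\<Sum>s'<S. P_pol A K \<pi> s s' * (if s' < S then ?V s' else 0)) = r_pol A r \<pi> s)"
      by simp
  next
    fix V assume V: "(\<forall>s. S \<le> s \<longrightarrow> V s = 0) \<and>
      (\<forall>s<S. V s - \<gamma> * (\<Sum>s'<S. P_pol A K \<pi> s s' * V s') = r_pol A r \<pi> s)"
    have "V s = ?V s" if "s < S" for s
      using V by (intro Vopt_unique[OF K' _ g _ _ that]) (auto simp: q algebra_simps)
    then show "V = (\<lambda>s. if s < S then ?V s else 0)" using V by fastforce
  qed
qed

lemma Vpol_solves:
  assumes K: "substoch S A K" and p: "is_policy S A \<pi>" and g: "0 \<le> \<gamma>" "\<gamma> < 1" and s: "s < S"
  shows "Vpol S A K r \<gamma> \<pi> s = r_pol A r \<pi> s + \<gamma> * (\<Sum>s'<S. P_pol A K \<pi> s s' * Vpol S A K r \<gamma> \<pi> s')"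
  using theI'[OF Vpol_aux[OF K p g, of r], folded Vpol_def] s by (auto simp: algebra_simps)

lemma Vpol_cong:
  assumes "\<And>s a. s < S \<Longrightarrow> a < A \<Longrightarrow> \<pi> s a = \<pi>' s a"
  shows "Vpol S A K r \<gamma> \<pi> = Vpol S A K r \<gamma> \<pi>'"
proof -
  have "s < S \<Longrightarrow> P_pol A K \<pi> s s' = P_pol A K \<pi>' s s'" "s < S \<Longrightarrow> r_pol A r \<pi> s = r_pol A r \<pi>' s" for s s'
    using assms by (auto simp: P_pol_def r_pol_def intro!: sum.cong)
  then show ?thesis unfolding Vpol_def by (intro arg_cong[where f=The] ext) simp
qed

lemma Vpol_le_Vopt:
  assumes K: "substoch S A K" "0 < A" "0 \<le> \<gamma>" "\<gamma> < 1" and p: "is_policy S A \<pi>" and s: "s < S"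
  shows "Vpol S A K r \<gamma> \<pi> s \<le> Vopt S A K r \<gamma> s"
proof -
  let ?V = "Vpol S A K r \<gamma> \<pi>" let ?W = "Vopt S A K r \<gamma>"
  have "?V s - ?W s \<le> 0"
  proof (rule max_principle[of \<gamma> 0 S "\<lambda>s. ?V s - ?W s"])
    fix t assume t: "t < S"
    have p': "\<And>a. a < A \<Longrightarrow> 0 \<le> \<pi> t a" "(\<Sum>a<A. \<pi> t a) = 1"
      using p t unfolding is_policy_def by auto
    have "(\<Sum>a<A. \<pi> t a * qval S K r \<gamma> ?W t a) \<le> (\<Sum>a<A. \<pi> t a * ?W t)"
      using p' Vopt_ge[OF K t] by (intro sum_mono mult_left_mono) auto
    also have "\<dots> = ?W t" using p' by (simp flip: sum_distrib_right)
    finally have "r_pol A r \<pi> t + \<gamma> * (\<Sum>s'<S. P_pol A K \<pi> t s' * ?W s') \<le> ?W t"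
      unfolding P_pol_sum .
    then have "?V t - ?W t \<le> \<gamma> * (\<Sum>s'<S. P_pol A K \<pi> t s' * (?V s' - ?W s'))"
      using Vpol_solves[OF K(1) p K(3,4) t, of r] by (simp add: algebra_simps sum_subtractf)
    then show "?V t - ?W t \<le> 0 \<or> (\<exists>w. (\<forall>s'<S. 0 \<le> w s') \<and> (\<Sum>s'<S. w s') \<le> 1
          \<and> ?V t - ?W t \<le> \<gamma> * (\<Sum>s'<S. w s' * (?V s' - ?W s')) + (1 - \<gamma>) * 0)"
      using P_pol_substoch[OF K(1) p t] by (intro disjI2 exI[of _ "P_pol A K \<pi> t"]) auto
  qed (use K s in auto)
  then show ?thesis by simp
qed

definition det_pol :: "(nat \<Rightarrow> nat) \<Rightarrow> nat \<Rightarrow> nat \<Rightarrow> real" where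
  "det_pol d s a = (if a = d s then 1 else 0)"

lemma is_policy_det_pol: "(\<And>s. s < S \<Longrightarrow> d s < A) \<Longrightarrow> is_policy S A (det_pol d)"
  unfolding is_policy_def det_pol_def by auto

lemma det_pol_sum: "d s < A \<Longrightarrow> (\<Sum>a<A. det_pol d s a * f a) = f (d s)"
proof -
  assume "d s < A"
  have "(\<Sum>a<A. det_pol d s a * f a) = (\<Sum>a<A. if a = d s then f a else 0)"
    by (intro sum.cong) (auto simp: det_pol_def)
  then show ?thesis using \<open>d s < A\<close> by simp
qed

lemma Vpol_det_pol:
  assumes K: "substoch S A K" and d: "\<And>s. s < S \<Longrightarrow> d s < A" and g: "0 \<le> \<gamma>" "\<gamma> < 1" and s: "s < S"
  shows "Vpol S A K r \<gamma> (det_pol d) s = qval S K r \<gamma> (Vpol S A K r \<gamma> (det_pol d)) s (d s)"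
  using Vpol_solves[OF K is_policy_det_pol[where d=d, OF d] g s, where r=r] det_pol_sum[where d=d, OF d[OF s]]
  unfolding P_pol_sum by simp

lemma Vpol_greedy:
  assumes K: "substoch S A K" "0 < A" "0 \<le> \<gamma>" "\<gamma> < 1"
    and d: "\<And>s. s < S \<Longrightarrow> d s < A"
    and opt: "\<And>s. s < S \<Longrightarrow> Vopt S A K r \<gamma> s = qval S K r \<gamma> (Vopt S A K r \<gamma>) s (d s)"
    and s: "s < S"
  shows "Vpol S A K r \<gamma> (det_pol d) s = Vopt S A K r \<gamma> s"
proof -
  let ?V = "Vpol S A K r \<gamma> (det_pol d)" let ?W = "Vopt S A K r \<gamma>"
  have "?W s - ?V s \<le> 0"
  proof (rule max_principle[of \<gamma> 0 S "\<lambda>s. ?W s - ?V s"])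
    fix t assume t: "t < S"
    have "?W t - ?V t \<le> \<gamma> * (\<Sum>s'<S. K t (d t) s' * (?W s' - ?V s'))"
      using opt[OF t] Vpol_det_pol[where d=d and r=r, OF K(1) d K(3,4) t]
        qval_diff[of S K r \<gamma> ?W t "d t" r ?V] by simp
    then show "?W t - ?V t \<le> 0 \<or> (\<exists>w. (\<forall>s'<S. 0 \<le> w s') \<and> (\<Sum>s'<S. w s') \<le> 1
          \<and> ?W t - ?V t \<le> \<gamma> * (\<Sum>s'<S. w s' * (?W s' - ?V s')) + (1 - \<gamma>) * 0)"
      using K(1) t d unfolding substoch_def by (intro disjI2 exI[of _ "K t (d t)"]) auto
  qed (use K s in auto)
  then show ?thesis using Vpol_le_Vopt[OF K is_policy_det_pol[where d=d, OF d] s, where r=r] by simp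
qed

lemma optimal_det_pol_exists:
  assumes K: "substoch S A K" "0 < A" "0 \<le> \<gamma>" "\<gamma> < 1"
  obtains d where "\<And>s. s < S \<Longrightarrow> d s < A"
    "\<And>s. s < S \<Longrightarrow> Vpol S A K r \<gamma> (det_pol d) s = Vopt S A K r \<gamma> s"
proof -
  have "\<forall>s. \<exists>a. s < S \<longrightarrow> a < A \<and> Vopt S A K r \<gamma> s = qval S K r \<gamma> (Vopt S A K r \<gamma>) s a"
    using Vopt_attained[OF K] by blast
  from choice[OF this] obtain d where d: "\<And>s. s < S \<Longrightarrow>
      d s < A \<and> Vopt S A K r \<gamma> s = qval S K r \<gamma> (Vopt S A K r \<gamma>) s (d s)" by blast
  then show thesis using Vpol_greedy[where d=d and r=r, OF K] by (intro that[of d]) auto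
qed

text \<open>One deterministic greedy policy attains the supremum over randomized policies at every
  state simultaneously.\<close>

lemma Vstar_eq_Vopt:
  assumes K: "substoch S A K" "0 < A" "0 \<le> \<gamma>" "\<gamma> < 1" and s: "s < S"
  shows "Vstar S A K r \<gamma> s = Vopt S A K r \<gamma> s"
proof -
  obtain d where d: "\<And>s. s < S \<Longrightarrow> d s < A"
      "\<And>s. s < S \<Longrightarrow> Vpol S A K r \<gamma> (det_pol d) s = Vopt S A K r \<gamma> s"
    using optimal_det_pol_exists[OF K] by metis
  have p: "is_policy S A (det_pol d)" using d by (intro is_policy_det_pol) auto
  show ?thesis unfolding Vstar_def
  proof (rule antisym)
    show "(SUP \<pi>\<in>{\<pi>. is_policy S A \<pi>}. Vpol S A K r \<gamma> \<pi> s) \<le> Vopt S A K r \<gamma> s"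
      using p Vpol_le_Vopt[OF K _ s] by (intro cSUP_least) auto
    have "bdd_above ((\<lambda>\<pi>. Vpol S A K r \<gamma> \<pi> s) ` {\<pi>. is_policy S A \<pi>})"
      using Vpol_le_Vopt[OF K _ s] by (intro bdd_aboveI2) auto
    then have "Vpol S A K r \<gamma> (det_pol d) s \<le> (SUP \<pi>\<in>{\<pi>. is_policy S A \<pi>}. Vpol S A K r \<gamma> \<pi> s)"
      using p by (intro cSUP_upper) auto
    then show "Vopt S A K r \<gamma> s \<le> (SUP \<pi>\<in>{\<pi>. is_policy S A \<pi>}. Vpol S A K r \<gamma> \<pi> s)"
      using d(2)[OF s] by simp
  qed
qed

lemma Vpol_optimal_policy:
  assumes K: "substoch S A K" "0 < A" "0 \<le> \<gamma>" "\<gamma> < 1" and s: "s < S"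
    and opt: "is_optimal_policy S A K r \<gamma> \<pi>"
  shows "Vpol S A K r \<gamma> \<pi> s = Vopt S A K r \<gamma> s"
proof -
  obtain d where d: "\<And>s. s < S \<Longrightarrow> d s < A"
      "\<And>s. s < S \<Longrightarrow> Vpol S A K r \<gamma> (det_pol d) s = Vopt S A K r \<gamma> s"
    using optimal_det_pol_exists[OF K] by metis
  have "is_policy S A (det_pol d)" using d by (intro is_policy_det_pol) auto
  then have "Vpol S A K r \<gamma> (det_pol d) s \<le> Vpol S A K r \<gamma> \<pi> s"
    using opt s unfolding is_optimal_policy_def by auto
  then show ?thesis
    using d(2)[OF s] Vpol_le_Vopt[OF K _ s, of \<pi> r] opt unfolding is_optimal_policy_def by simp
qed

text \<open>The slacks between the optimal value and the one-step values are nonnegative and average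
  to zero under \<open>\<pi>\<close>, so \<open>\<pi>\<close> puts no mass where the slack is
  strict. This is how randomized optimal policies are reduced to a deterministic one.\<close>

lemma optimal_policy_unique:
  assumes K: "substoch S A K" "0 < A" "0 \<le> \<gamma>" "\<gamma> < 1"
    and opt: "is_optimal_policy S A K r \<gamma> \<pi>"
    and d: "\<And>s. s < S \<Longrightarrow> d s < A"
    and strict: "\<And>s a. s < S \<Longrightarrow> a < A \<Longrightarrow> a \<noteq> d s \<Longrightarrow>
      qval S K r \<gamma> (Vopt S A K r \<gamma>) s a < Vopt S A K r \<gamma> s"
    and s: "s < S" and a: "a < A"
  shows "\<pi> s a = det_pol d s a"
proof -
  let ?W = "Vopt S A K r \<gamma>"
  have p: "is_policy S A \<pi>" using opt unfolding is_optimal_policy_def by auto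
  then have p': "\<And>a. a < A \<Longrightarrow> 0 \<le> \<pi> s a" "(\<Sum>a<A. \<pi> s a) = 1"
    using s unfolding is_policy_def by auto
  have "?W s = r_pol A r \<pi> s + \<gamma> * (\<Sum>s'<S. P_pol A K \<pi> s s' * ?W s')"
    using Vpol_solves[OF K(1) p K(3,4) s, of r] Vpol_optimal_policy[OF K _ opt] s by simp
  then have "?W s = (\<Sum>a<A. \<pi> s a * qval S K r \<gamma> ?W s a)" unfolding P_pol_sum .
  moreover have "?W s = (\<Sum>a<A. \<pi> s a * ?W s)" using p' by (simp flip: sum_distrib_right)
  ultimately have "(\<Sum>a<A. \<pi> s a * (?W s - qval S K r \<gamma> ?W s a)) = 0"
    by (simp add: right_diff_distrib sum_subtractf)
  then have z: "\<forall>a\<in>{..<A}. \<pi> s a * (?W s - qval S K r \<gamma> ?W s a) = 0"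
    using p' Vopt_ge[OF K s, of _ r] by (subst (asm) sum_nonneg_eq_0_iff) auto
  have z': "\<pi> s b = 0" if "b < A" "b \<noteq> d s" for b
    using z strict[OF s that] that by auto
  have "(\<Sum>b<A. \<pi> s b) = (\<Sum>b<A. if b = d s then \<pi> s b else 0)"
    using z' by (intro sum.cong) auto
  then have "\<pi> s (d s) = 1" using p' d[OF s] by simp
  then show ?thesis using z'[OF a] by (auto simp: det_pol_def)
qed

section \<open>Deterministic error bounds\<close>

text \<open>The quantity compared is \<open>\<bar>V - U\<bar> + W\<close>, with \<open>W\<close> the
  Lyapunov function, nonnegative and dropped at the end. Since \<open>l * H \<le> 1 / 64\<close>,
  the side term \<open>16 * (l * H) * \<bar>e\<bar>\<close> is at most
  \<open>\<bar>e\<bar> / 4\<close>, whence the factor \<open>5 / 4\<close>; the weight 8 in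
  \<open>W\<close> covers the variance weight 4 of \<open>e\<close> even after that is multiplied by
  \<open>5 / 4\<close>.\<close>

lemma value_error_bound:
  fixes V U :: "nat \<Rightarrow> real"
  assumes g: "0 \<le> \<gamma>" "\<gamma> < 1"
    and k0: "\<And>s s'. s < S \<Longrightarrow> s' < S \<Longrightarrow> 0 \<le> k s s'"
    and k1: "\<And>s. s < S \<Longrightarrow> (\<Sum>s'<S. k s s') = 1"
    and V: "\<And>s. s < S \<Longrightarrow> V s = c s + \<gamma> * (\<Sum>s'<S. k s s' * V s') - e s"
    and U: "\<And>s. s < S \<Longrightarrow> U s = c s + \<gamma> * (\<Sum>s'<S. k s s' * U s')"
    and c: "\<And>s. s < S \<Longrightarrow> 0 \<le> c s \<and> c s \<le> 1"
    and lo: "0 \<le> (1 - \<gamma>) * lo" "(1 - \<gamma>) * lo \<le> 1"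
    and H: "\<And>s. s < S \<Longrightarrow> lo \<le> V s \<and> V s \<le> lo + H"
    and l: "0 \<le> l" "l * H \<le> 1 / 64" and b: "0 \<le> b"
    and e: "\<And>s. s < S \<Longrightarrow> \<bar>e s\<bar> \<le> 4 * l * \<gamma>\<^sup>2 *
      ((\<Sum>s'<S. k s s' * (V s' - lo)\<^sup>2) - (\<Sum>s'<S. k s s' * (V s' - lo))\<^sup>2) + b"
    and s: "s < S"
  shows "\<bar>V s - U s\<bar> \<le> (5 / 4 * b + 16 * l * H) / (1 - \<gamma>)"
proof -
  define h where "h s = V s - lo" for s
  define W where "W s = 8 * l * (h s)\<^sup>2" for s
  define B where "B = (5 / 4 * b + 16 * l * H) / (1 - \<gamma>)"
  have h: "0 \<le> h t" "h t \<le> H" if "t < S" for t using H[OF that] by (auto simp: h_def)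
  have H0: "0 \<le> H" using h[OF s] by simp
  have B0: "0 \<le> B" unfolding B_def using b l H0 g by auto
  have Bg: "(1 - \<gamma>) * B = 5 / 4 * b + 16 * l * H" using g by (simp add: B_def)
  \<comment> \<open>\<open>\<gamma> k W - W\<close> dominates \<open>8 l \<gamma>\<^sup>2\<close> times the variance, up to a term of order \<open>l H (1 + \<bar>e\<bar>)\<close>.\<close>
  have "\<bar>V s - U s\<bar> + W s \<le> B"
  proof (rule max_principle[of \<gamma> B S "\<lambda>s. \<bar>V s - U s\<bar> + W s"])
    fix t assume t: "t < S"
    define y where "y = (\<Sum>s'<S. k t s' * h s')"
    define v where "v = (\<Sum>s'<S. k t s' * (h s')\<^sup>2) - y\<^sup>2"
    have e': "\<bar>e t\<bar> \<le> 4 * l * \<gamma>\<^sup>2 * v + b" using e[OF t] by (simp add: v_def y_def h_def)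
    have "(\<Sum>s'<S. k t s' * (h s' - y)\<^sup>2) = (\<Sum>s'<S. k t s' * (h s')\<^sup>2 - 2 * y * (k t s' * h s') + y\<^sup>2 * k t s')"
      by (intro sum.cong) (auto simp: power2_eq_square algebra_simps)
    also have "\<dots> = v"
      by (simp add: sum.distrib sum_subtractf k1[OF t] v_def flip: sum_distrib_left y_def)
         (simp add: power2_eq_square)
    finally have v0: "0 \<le> v" using k0[OF t] by (metis (no_types, lifting) lessThan_iff mult_nonneg_nonneg sum_nonneg zero_le_power2)
    have kV: "(\<Sum>s'<S. k t s' * V s') = y + lo"
    proof -
      have "(\<Sum>s'<S. k t s' * V s') = (\<Sum>s'<S. k t s' * h s' + lo * k t s')"
        by (intro sum.cong) (auto simp: h_def algebra_simps)
      then show ?thesis by (simp add: sum.distrib k1[OF t] y_def flip: sum_distrib_left)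
    qed
    \<comment> \<open>Subtracting \<open>lo\<close> from the values replaces the reward by
      \<open>c'\<close>, which stays in \<open>[-1, 1]\<close> because
      \<open>(1 - \<gamma>) * lo\<close> lies in \<open>[0, 1]\<close>. Hence the loss is governed
      by the span and not by the horizon \<open>1 / (1 - \<gamma>)\<close>.\<close>
    define c' where "c' = c t - (1 - \<gamma>) * lo"
    have c': "\<bar>c'\<bar> \<le> 1" using c[OF t] lo by (auto simp: c'_def)
    have ht: "\<gamma> * y = h t - c' + e t" using V[OF t] kV by (simp add: h_def c'_def algebra_simps)
    have "h t * c' \<le> h t * 1" "h t * (- e t) \<le> h t * \<bar>e t\<bar>" "h t * \<bar>e t\<bar> \<le> H * \<bar>e t\<bar>"
      using h[OF t] c' by (intro mult_left_mono mult_right_mono; simp)+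
    then have "h t * c' \<le> H" "- (h t * e t) \<le> H * \<bar>e t\<bar>" using h(2)[OF t] by simp_all
    \<comment> \<open>Completing the square with \<open>\<gamma> * y = h t - c' + e t\<close>; the
      square is then discarded.\<close>
    moreover have "(\<gamma> * y)\<^sup>2 - (h t)\<^sup>2 - 2 * (h t * e t - h t * c') = (e t - c')\<^sup>2"
      unfolding ht by (simp add: power2_eq_square algebra_simps)
    then have "2 * (h t * e t - h t * c') \<le> (\<gamma> * y)\<^sup>2 - (h t)\<^sup>2"
      by (metis zero_le_power2 diff_ge_0_iff_ge)
    moreover have "- 2 * (H + H * \<bar>e t\<bar>) \<le> 2 * (h t * e t - h t * c')"
      using calculation(1,2) by argo
    ultimately have "(\<gamma> * y)\<^sup>2 - (h t)\<^sup>2 \<ge> - 2 * (H + H * \<bar>e t\<bar>)" by simp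
    then have y2: "(\<gamma> * y)\<^sup>2 - (h t)\<^sup>2 \<ge> - 2 * H * (1 + \<bar>e t\<bar>)" by (simp add: algebra_simps)
    \<comment> \<open>This inequality acts twice: it passes from \<open>\<gamma> * y\<^sup>2\<close>
      to \<open>(\<gamma> * y)\<^sup>2\<close>, and it keeps \<open>\<gamma>\<^sup>2\<close> times
      the variance, the weight in which \<open>e\<close> is bounded.\<close>
    have g2: "\<gamma>\<^sup>2 \<le> \<gamma>" using g by (simp add: power2_eq_square mult_left_le)
    have "(\<gamma> * y)\<^sup>2 \<le> \<gamma> * y\<^sup>2" using g2 by (simp add: power_mult_distrib mult_right_mono)
    then have "\<gamma> * (v + y\<^sup>2) - (h t)\<^sup>2 \<ge> \<gamma>\<^sup>2 * v - 2 * H * (1 + \<bar>e t\<bar>)"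
      using y2 mult_right_mono[OF g2 v0] by (simp add: algebra_simps)
    then have "8 * l * (\<gamma> * (v + y\<^sup>2) - (h t)\<^sup>2) \<ge> 8 * l * (\<gamma>\<^sup>2 * v - 2 * H * (1 + \<bar>e t\<bar>))"
      using l by (intro mult_left_mono) auto
    moreover have "\<gamma> * (\<Sum>s'<S. k t s' * W s') = 8 * l * (\<gamma> * (v + y\<^sup>2))"
      by (simp add: v_def W_def sum_distrib_left mult_ac)
    ultimately have Wt: "\<gamma> * (\<Sum>s'<S. k t s' * W s') - W t \<ge> 8 * (l * \<gamma>\<^sup>2 * v) - 16 * (l * H) - 16 * (l * H) * \<bar>e t\<bar>"
      by (simp add: W_def algebra_simps)
    have "(l * H) * \<bar>e t\<bar> \<le> 1 / 64 * \<bar>e t\<bar>" using l by (intro mult_right_mono) auto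
    moreover have "0 \<le> l * \<gamma>\<^sup>2 * v" using l v0 by simp
    ultimately have 1: "\<bar>e t\<bar> \<le> \<gamma> * (\<Sum>s'<S. k t s' * W s') - W t + (1 - \<gamma>) * B"
      using Wt e' Bg b by (simp add: algebra_simps)
    have "V t - U t = \<gamma> * (\<Sum>s'<S. k t s' * (V s' - U s')) - e t"
      using V[OF t] U[OF t] by (simp add: algebra_simps sum_subtractf)
    moreover have "\<bar>\<Sum>s'<S. k t s' * (V s' - U s')\<bar> \<le> (\<Sum>s'<S. k t s' * \<bar>V s' - U s'\<bar>)"
      using k0[OF t] by (intro sum_abs[THEN order_trans] sum_mono) (auto simp: abs_mult)
    then have "\<bar>\<gamma> * (\<Sum>s'<S. k t s' * (V s' - U s'))\<bar> \<le> \<gamma> * (\<Sum>s'<S. k t s' * \<bar>V s' - U s'\<bar>)"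
      using g by (simp add: abs_mult mult_left_mono)
    ultimately have "\<bar>V t - U t\<bar> + W t \<le> \<gamma> * (\<Sum>s'<S. k t s' * (\<bar>V s' - U s'\<bar> + W s')) + (1 - \<gamma>) * B"
      using 1 by (simp add: algebra_simps sum.distrib abs_if split: if_splits)
    then show "\<bar>V t - U t\<bar> + W t \<le> B \<or> (\<exists>w. (\<forall>s'<S. 0 \<le> w s') \<and> (\<Sum>s'<S. w s') \<le> 1
          \<and> \<bar>V t - U t\<bar> + W t \<le> \<gamma> * (\<Sum>s'<S. w s' * (\<bar>V s' - U s'\<bar> + W s')) + (1 - \<gamma>) * B)"
      using k0[OF t] k1[OF t] by (intro disjI2 exI[of _ "k t"]) auto
  qed (use g B0 s in auto)
  moreover have "0 \<le> W s" using l by (simp add: W_def)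
  ultimately show ?thesis by (simp add: B_def)
qed

section \<open>A deterministic form of the empirical Bernstein inequality\<close>

lemma ln_one_plus_ge:
  fixes u :: real
  assumes "\<bar>u\<bar> \<le> 1 / 2"
  shows "u - 2 * u\<^sup>2 \<le> ln (1 + u)"
  using abs_ln_one_plus_x_minus_x_bound[OF assms] by simp

text \<open>By taking logarithms: the quadratic loss in \<open>ln (1 + u)\<close> puts the observed
  squares on the right, so the variance that results is the empirical one.\<close>

lemma sum_le_of_prod_le:
  fixes u :: "nat \<Rightarrow> real"
  assumes u: "\<And>i. i < n \<Longrightarrow> \<bar>u i\<bar> \<le> 1 / 2" and p: "(\<Prod>i<n. 1 + u i) \<le> exp L"
  shows "(\<Sum>i<n. u i) \<le> L + 2 * (\<Sum>i<n. (u i)\<^sup>2)"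
proof -
  have pos: "0 < 1 + u i" if "i < n" for i using u[OF that] by (auto simp: abs_le_iff)
  have "(\<Sum>i<n. u i) - 2 * (\<Sum>i<n. (u i)\<^sup>2) = (\<Sum>i<n. u i - 2 * (u i)\<^sup>2)"
    by (simp add: sum_subtractf sum_distrib_left)
  also have "\<dots> \<le> (\<Sum>i<n. ln (1 + u i))" using u by (intro sum_mono ln_one_plus_ge) auto
  also have "\<dots> = ln (\<Prod>i<n. 1 + u i)" using pos by (subst ln_prod) (auto simp: less_imp_neq[symmetric])
  also have "\<dots> \<le> ln (exp L)" using p pos by (subst ln_le_cancel_iff) (auto intro!: prod_pos)
  finally show ?thesis by simp
qed

text \<open>Chance enters only through the two product bounds, one for each sign of the error. The
  mean square about \<open>m\<close> splits into the empirical variance and the squared error of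
  \<open>avg\<close>, and the latter is reabsorbed on the left.\<close>

lemma empirical_bernstein:
  fixes h :: "nat \<Rightarrow> real"
  assumes n: "0 < n" and l: "0 < l" "l * H \<le> 1 / 64" and g: "0 \<le> \<gamma>" "\<gamma> \<le> 1"
    and h: "\<And>i. i < n \<Longrightarrow> 0 \<le> h i \<and> h i \<le> H" and m: "0 \<le> m" "m \<le> H"
    and up: "(\<Prod>i<n. 1 + l * \<gamma> * (h i - m)) \<le> exp L"
    and dn: "(\<Prod>i<n. 1 - l * \<gamma> * (h i - m)) \<le> exp L"
  defines "avg \<equiv> (\<Sum>i<n. h i) / n"
  shows "\<bar>\<gamma> * (avg - m)\<bar> \<le> 4 * l * \<gamma>\<^sup>2 * ((\<Sum>i<n. (h i)\<^sup>2) / n - avg\<^sup>2) + 2 * L / (l * n)"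
proof -
  define u where "u i = l * \<gamma> * (h i - m)" for i
  define e where "e = \<gamma> * (avg - m)"
  have lg: "0 \<le> l * \<gamma>" "l * \<gamma> \<le> l" using l g mult_left_mono[of \<gamma> 1 l] by simp_all
  have bnd: "\<bar>l * \<gamma> * x\<bar> \<le> 1 / 64" if "\<bar>x\<bar> \<le> H" for x
  proof -
    have "\<bar>l * \<gamma> * x\<bar> = (l * \<gamma>) * \<bar>x\<bar>" using lg by (simp only: abs_mult[of "l * \<gamma>"] abs_of_nonneg)
    also have "\<dots> \<le> l * H" using lg that by (intro mult_mono) auto
    finally show ?thesis using l by simp
  qed
  have u: "\<bar>u i\<bar> \<le> 1 / 2" if "i < n" for i
    using bnd[of "h i - m"] h[OF that] m by (auto simp: u_def abs_le_iff)
  have su: "(\<Sum>i<n. u i) = n * (l * e)"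
    using n by (simp add: u_def e_def avg_def sum_subtractf field_simps flip: sum_distrib_left)
  have sh: "(\<Sum>i<n. h i) = n * avg" using n by (simp add: avg_def)
  have "(\<Sum>i<n. (u i)\<^sup>2) = (l * \<gamma>)\<^sup>2 * (\<Sum>i<n. (h i)\<^sup>2 - 2 * m * h i + m\<^sup>2)"
    unfolding sum_distrib_left by (intro sum.cong) (auto simp: u_def power2_eq_square algebra_simps)
  also have "(\<Sum>i<n. (h i)\<^sup>2 - 2 * m * h i + m\<^sup>2) = n * ((\<Sum>i<n. (h i)\<^sup>2) / n - avg\<^sup>2 + (avg - m)\<^sup>2)"
    using n by (simp add: sum.distrib sum_subtractf sum_distrib_left[symmetric] sh)
      (simp add: power2_eq_square algebra_simps)
  finally have su2: "(\<Sum>i<n. (u i)\<^sup>2) = n * (l * (l * (\<gamma>\<^sup>2 * ((\<Sum>i<n. (h i)\<^sup>2) / n - avg\<^sup>2) + e\<^sup>2)))"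
    by (simp add: e_def power2_eq_square algebra_simps)
  have "(\<Sum>i<n. u i) \<le> L + 2 * (\<Sum>i<n. (u i)\<^sup>2)"
    using u up by (intro sum_le_of_prod_le) (auto simp: u_def)
  moreover have "(\<Sum>i<n. - u i) \<le> L + 2 * (\<Sum>i<n. (- u i)\<^sup>2)"
    using u dn by (intro sum_le_of_prod_le) (auto simp: u_def)
  ultimately have "\<bar>\<Sum>i<n. u i\<bar> \<le> L + 2 * (\<Sum>i<n. (u i)\<^sup>2)" by (simp add: sum_negf)
  then have "n * (l * \<bar>e\<bar>) \<le> L + 2 * (n * (l * (l * (\<gamma>\<^sup>2 * ((\<Sum>i<n. (h i)\<^sup>2) / n - avg\<^sup>2) + e\<^sup>2))))"
    unfolding su2 unfolding su using l by (simp add: abs_mult)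
  then have "\<bar>e\<bar> \<le> (L + 2 * (n * (l * (l * (\<gamma>\<^sup>2 * ((\<Sum>i<n. (h i)\<^sup>2) / n - avg\<^sup>2) + e\<^sup>2))))) / (n * l)"
    using n l by (simp add: field_simps)
  also have "\<dots> = L / (l * n) + 2 * (l * (\<gamma>\<^sup>2 * ((\<Sum>i<n. (h i)\<^sup>2) / n - avg\<^sup>2))) + 2 * (l * e\<^sup>2)"
    using n l by (simp add: field_simps)
  finally have 1: "\<bar>e\<bar> \<le> L / (l * n) + 2 * (l * (\<gamma>\<^sup>2 * ((\<Sum>i<n. (h i)\<^sup>2) / n - avg\<^sup>2))) + 2 * (l * e\<^sup>2)" .
  have "0 \<le> avg" "avg \<le> H"
  proof -
    show "0 \<le> avg" unfolding avg_def using h by (intro divide_nonneg_nonneg sum_nonneg) auto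
    have "(\<Sum>i<n. h i) \<le> (\<Sum>i<n. H)" using h by (intro sum_mono) auto
    then show "avg \<le> H" unfolding avg_def using n by (simp add: field_simps)
  qed
  then have "\<bar>l * e\<bar> \<le> 1 / 64" using bnd[of "avg - m"] m by (simp add: e_def abs_le_iff algebra_simps)
  then have "\<bar>l * e\<bar> * \<bar>e\<bar> \<le> 1 / 64 * \<bar>e\<bar>" by (intro mult_right_mono) auto
  moreover have "l * e\<^sup>2 = \<bar>l * e\<bar> * \<bar>e\<bar>" using l by (simp add: abs_mult power2_eq_square)
  \<comment> \<open>As \<open>l * e\<close> is small, the quadratic term costs at most half of the
    error; moving it to the left doubles the constants 2 and 1 to 4 and 2.\<close>
  ultimately have "2 * (l * e\<^sup>2) \<le> \<bar>e\<bar> / 2" by simp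
  then have "\<bar>e\<bar> \<le> 4 * (l * (\<gamma>\<^sup>2 * ((\<Sum>i<n. (h i)\<^sup>2) / n - avg\<^sup>2))) + 2 * (L / (l * n))" using 1 by argo
  then show ?thesis by (simp add: e_def mult.assoc)
qed

lemma P_hat_sum:
  assumes "0 < n" "\<And>i. i < n \<Longrightarrow> X (s, a, i) < S"
  shows "(\<Sum>s'<S. P_hat n X s a s' * f s') = (\<Sum>i<n. f (X (s, a, i))) / n"
proof -
  have "(\<Sum>i<n. f (X (s, a, i))) = (\<Sum>s'<S. \<Sum>i | i \<in> {..<n} \<and> X (s, a, i) = s'. f (X (s, a, i)))"
    using assms by (intro sum.group[symmetric]) auto
  also have "\<dots> = (\<Sum>s'<S. card {i. i < n \<and> X (s, a, i) = s'} * f s')"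
    by (intro sum.cong) auto
  finally show ?thesis by (simp add: P_hat_def sum_divide_distrib)
qed

text \<open>Samples outside the state space merely lose mass, so this holds for every outcome
  \<open>X\<close>, and the gap estimate can be made for each fixed sample.\<close>

lemma substoch_P_hat:
  assumes n: "0 < n"
  shows "substoch S A (P_hat n X)"
  unfolding substoch_def
proof (intro allI impI conjI)
  fix s a
  show "0 \<le> P_hat n X s a s'" for s' by (simp add: P_hat_def)
  have "(\<Sum>s'<S. card {i. i < n \<and> X (s, a, i) = s'}) = card (\<Union>s'<S. {i. i < n \<and> X (s, a, i) = s'})"
    by (subst card_UN_disjoint) auto
  also have "\<dots> \<le> card {..<n}" by (intro card_mono) auto
  finally have "(\<Sum>s'<S. real (card {i. i < n \<and> X (s, a, i) = s'})) \<le> n"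
    by (simp flip: of_nat_sum)
  then show "(\<Sum>s'<S. P_hat n X s a s') \<le> 1"
    using n by (simp add: P_hat_def field_simps flip: sum_divide_distrib)
qed

lemma fixpoint_range:
  fixes W :: "nat \<Rightarrow> real"
  assumes g: "0 \<le> \<gamma>" "\<gamma> < 1"
    and k: "\<And>s s'. s < S \<Longrightarrow> s' < S \<Longrightarrow> 0 \<le> k s s'" "\<And>s. s < S \<Longrightarrow> (\<Sum>s'<S. k s s') \<le> 1"
    and W: "\<And>s. s < S \<Longrightarrow> W s = c s + \<gamma> * (\<Sum>s'<S. k s s' * W s')"
    and c: "\<And>s. s < S \<Longrightarrow> 0 \<le> c s \<and> c s \<le> 1" and t: "t < S"
  shows "0 \<le> W t \<and> W t \<le> 1 / (1 - \<gamma>)"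
proof
  show "W t \<le> 1 / (1 - \<gamma>)"
  proof (rule max_principle[where d=W, OF g _ _ t])
    fix t assume t: "t < S"
    have "W t \<le> \<gamma> * (\<Sum>s'<S. k t s' * W s') + (1 - \<gamma>) * (1 / (1 - \<gamma>))"
      using W[OF t] c[OF t] g by simp
    then show "W t \<le> 1 / (1 - \<gamma>) \<or> (\<exists>w. (\<forall>s'<S. 0 \<le> w s') \<and> (\<Sum>s'<S. w s') \<le> 1
      \<and> W t \<le> \<gamma> * (\<Sum>s'<S. w s' * W s') + (1 - \<gamma>) * (1 / (1 - \<gamma>)))"
      using k[OF t] by (intro disjI2 exI[of _ "k t"]) auto
  qed (use g in auto)
  have "- W t \<le> 0"
  proof (rule max_principle[where d="\<lambda>t. - W t", OF g _ _ t])
    fix t assume t: "t < S"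
    have "- W t \<le> \<gamma> * (\<Sum>s'<S. k t s' * (- W s')) + (1 - \<gamma>) * 0"
      using W[OF t] c[OF t] g by (simp add: sum_negf)
    then show "- W t \<le> 0 \<or> (\<exists>w. (\<forall>s'<S. 0 \<le> w s') \<and> (\<Sum>s'<S. w s') \<le> 1
      \<and> - W t \<le> \<gamma> * (\<Sum>s'<S. w s' * (- W s')) + (1 - \<gamma>) * 0)"
      using k[OF t] by (intro disjI2 exI[of _ "k t"]) auto
  qed auto
  then show "0 \<le> W t" by simp
qed

text \<open>This \<open>l\<close> balances the two error terms: \<open>L / (l * n)\<close> and
  \<open>l * (H + 1)\<close> both equal \<open>\<rho>\<close>. The \<open>+ 1\<close> keeps the
  balance meaningful when the span vanishes.\<close>

lemma value_error_sqrt_bound: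
  fixes V U h :: "nat \<Rightarrow> real" and L :: real
  assumes n: "0 < n" and g: "0 \<le> \<gamma>" "\<gamma> < 1" and L: "0 < L"
    and X: "\<And>s i. s < S \<Longrightarrow> i < n \<Longrightarrow> X (s, d s, i) < S"
    and p0: "\<And>s s'. s < S \<Longrightarrow> s' < S \<Longrightarrow> 0 \<le> p s s'"
    and p1: "\<And>s. s < S \<Longrightarrow> (\<Sum>s'<S. p s s') = 1"
    and V: "\<And>s. s < S \<Longrightarrow> V s = c s + \<gamma> * (\<Sum>s'<S. p s s' * V s')"
    and U: "\<And>s. s < S \<Longrightarrow> U s = c s + \<gamma> * (\<Sum>s'<S. P_hat n X s (d s) s' * U s')"
    and c: "\<And>s. s < S \<Longrightarrow> 0 \<le> c s \<and> c s \<le> 1"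
    and lo: "0 \<le> (1 - \<gamma>) * lo" "(1 - \<gamma>) * lo \<le> 1"
    and H: "\<And>s. s < S \<Longrightarrow> lo \<le> V s \<and> V s \<le> lo + H"
    and h: "\<And>s. s < S \<Longrightarrow> h s = V s - lo"
    and l: "l = sqrt (L / (n * (H + 1)))"
    and conc: "\<And>s. s < S \<Longrightarrow> l * H \<le> 1 / 64 \<Longrightarrow>
        (\<Prod>i<n. 1 + l * \<gamma> * (h (X (s, d s, i)) - (\<Sum>s'<S. p s s' * h s'))) \<le> exp L \<and>
        (\<Prod>i<n. 1 - l * \<gamma> * (h (X (s, d s, i)) - (\<Sum>s'<S. p s s' * h s'))) \<le> exp L"
    and s: "s < S"
  shows "\<bar>V s - U s\<bar> \<le> 64 * sqrt (L * (H + 1) / n) / (1 - \<gamma>)"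
proof -
  define \<rho> where "\<rho> = sqrt (L * (H + 1) / n)"
  have H0: "0 \<le> H" using H[OF s] by simp
  have l0: "0 < l" unfolding l using n L H0 by simp
  have k: "H + 1 \<noteq> 0" using H0 by simp
  have Ll: "L / (l * n) = \<rho>"
  proof -
    have "l * \<rho> = sqrt ((L / (n * (H + 1))) * (L * (H + 1) / n))"
      unfolding l \<rho>_def by (rule real_sqrt_mult[symmetric])
    also have "(L / (n * (H + 1))) * (L * (H + 1) / n) = (L / n)\<^sup>2"
      using n k by (simp add: power2_eq_square)
    also have "sqrt \<dots> = L / n" using L n by simp
    finally show ?thesis using l0 n by (simp add: field_simps)
  qed
  have lH: "l * (H + 1) = \<rho>"
  proof -
    have "H + 1 = sqrt ((H + 1)\<^sup>2)" using H0 by simp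
    then have "l * (H + 1) = sqrt ((L / (n * (H + 1))) * (H + 1)\<^sup>2)"
      unfolding l by (metis real_sqrt_mult)
    also have "(L / (n * (H + 1))) * (H + 1)\<^sup>2 = L * (H + 1) / n"
      using n k by (simp add: power2_eq_square)
    finally show ?thesis by (simp add: \<rho>_def)
  qed
  have \<rho>0: "0 \<le> \<rho>" unfolding \<rho>_def using L H0 by simp
  have kh: "(\<Sum>s'<S. P_hat n X t (d t) s') = 1" if "t < S" for t
    using P_hat_sum[where f="\<lambda>_. 1" and X=X and s=t and a="d t" and S=S and n=n, OF n X[OF that]] n by simp
  show ?thesis
  \<comment> \<open>A small \<open>\<rho>\<close> forces \<open>l * H \<le> 1 / 64\<close>.
    Otherwise \<open>64 * \<rho>\<close> exceeds one, and the claim is weaker than both values lying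
    in \<open>[0, 1 / (1 - \<gamma>)]\<close>.\<close>
  proof (cases "\<rho> \<le> 1 / 64")
    case True
    have lH': "l * H \<le> \<rho>" using lH l0 by (simp add: algebra_simps)
    \<comment> \<open>The sampling error of one row, which is the defect of \<open>V\<close> in the
      empirical equation.\<close>
    define e where "e t = \<gamma> * ((\<Sum>s'<S. P_hat n X t (d t) s' * V s') - (\<Sum>s'<S. p t s' * V s'))" for t
    have "\<bar>V s - U s\<bar> \<le> (5 / 4 * (2 * L / (l * n)) + 16 * l * H) / (1 - \<gamma>)"
    proof (rule value_error_bound[where k="\<lambda>s. P_hat n X s (d s)" and c=c and lo=lo and e=e and S=S])
      show "V t = c t + \<gamma> * (\<Sum>s'<S. P_hat n X t (d t) s' * V s') - e t" if "t < S" for t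
        using V[OF that] by (simp add: e_def algebra_simps)
      show "l * H \<le> 1 / 64" using lH' True by simp
      fix t assume t: "t < S"
      define m where "m = (\<Sum>s'<S. p t s' * h s')"
      define x where "x i = h (X (t, d t, i))" for i
      have hb: "0 \<le> h t'" "h t' \<le> H" if "t' < S" for t' using H[OF that] h[OF that] by auto
      have m: "0 \<le> m" "m \<le> H"
      proof -
        show "0 \<le> m" unfolding m_def using p0[OF t] hb by (intro sum_nonneg) auto
        have "m \<le> (\<Sum>s'<S. p t s' * H)" unfolding m_def using p0[OF t] hb by (intro sum_mono mult_left_mono) auto
        then show "m \<le> H" using p1[OF t] by (simp flip: sum_distrib_right)
      qed
      have Xt: "\<And>i. i < n \<Longrightarrow> X (t, d t, i) < S" using X[OF t] .
      have "\<bar>\<gamma> * ((\<Sum>i<n. x i) / n - m)\<bar> \<le> 4 * l * \<gamma>\<^sup>2 * ((\<Sum>i<n. (x i)\<^sup>2) / n - ((\<Sum>i<n. x i) / n)\<^sup>2) + 2 * L / (l * n)"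
        using conc[OF t] lH' True n l0 g m hb Xt
        by (intro empirical_bernstein[where H=H]) (auto simp: x_def m_def)
      also have "(\<Sum>i<n. x i) / n = (\<Sum>s'<S. P_hat n X t (d t) s' * (V s' - lo))"
        using h Xt by (subst P_hat_sum[OF n]) (auto simp: x_def)
      also have "(\<Sum>i<n. (x i)\<^sup>2) / n = (\<Sum>s'<S. P_hat n X t (d t) s' * (V s' - lo)\<^sup>2)"
        using h Xt by (subst P_hat_sum[OF n]) (auto simp: x_def)
      also have "(\<Sum>s'<S. P_hat n X t (d t) s' * (V s' - lo)) - m
          = (\<Sum>s'<S. P_hat n X t (d t) s' * V s') - (\<Sum>s'<S. p t s' * V s')"
      proof -
        have "m = (\<Sum>s'<S. p t s' * (V s' - lo))" unfolding m_def using h by (intro sum.cong) auto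
        then show ?thesis
          by (simp add: right_diff_distrib sum_subtractf kh[OF t] p1[OF t] flip: sum_distrib_right)
      qed
      finally show "\<bar>e t\<bar> \<le> 4 * l * \<gamma>\<^sup>2 *
        ((\<Sum>s'<S. P_hat n X t (d t) s' * (V s' - lo)\<^sup>2) - (\<Sum>s'<S. P_hat n X t (d t) s' * (V s' - lo))\<^sup>2)
        + 2 * L / (l * n)" by (simp add: e_def)
    qed (use g kh U c lo H l0 L s in \<open>auto simp: P_hat_def\<close>)
    also have "\<dots> = (5 / 2 * \<rho> + 16 * (l * H)) / (1 - \<gamma>)" by (simp flip: Ll)
    \<comment> \<open>\<open>5 / 2 + 16\<close> is below 64, the constant imposed by the trivial
      case.\<close>
    also have "\<dots> \<le> (64 * \<rho>) / (1 - \<gamma>)"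
      using lH' g \<rho>0 by (intro divide_right_mono) simp_all
    finally show ?thesis by (simp add: \<rho>_def)
  next
    case False
    have "0 \<le> V s \<and> V s \<le> 1 / (1 - \<gamma>)" using p1 by (intro fixpoint_range[OF g p0 _ V c s]) auto
    moreover have "0 \<le> U s \<and> U s \<le> 1 / (1 - \<gamma>)"
      using kh by (intro fixpoint_range[where k="\<lambda>s. P_hat n X s (d s)", OF g _ _ U c s]) (auto simp: P_hat_def)
    ultimately have "\<bar>V s - U s\<bar> \<le> 1 / (1 - \<gamma>)" by (auto simp: abs_le_iff)
    also have "\<dots> \<le> (64 * \<rho>) / (1 - \<gamma>)" using False g by (intro divide_right_mono) auto
    finally show ?thesis by (simp add: \<rho>_def)
  qed
qed

lemma Vopt_range:
  assumes K: "substoch S A K" "0 < A" "0 \<le> \<gamma>" "\<gamma> < 1"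
    and c: "\<And>s a. s < S \<Longrightarrow> a < A \<Longrightarrow> 0 \<le> c s a \<and> c s a \<le> b" and s: "s < S"
  shows "0 \<le> Vopt S A K c \<gamma> s" "Vopt S A K c \<gamma> s \<le> b / (1 - \<gamma>)"
proof -
  let ?V = "Vopt S A K c \<gamma>"
  have b: "0 \<le> b" using c[OF s K(2)] by simp
  show "?V s \<le> b / (1 - \<gamma>)"
  proof (rule max_principle[where d="?V", OF K(3,4) _ _ s])
    fix t assume t: "t < S"
    obtain a where a: "a < A" "?V t = qval S K c \<gamma> ?V t a" using Vopt_attained[OF K t] by auto
    have "?V t \<le> \<gamma> * (\<Sum>s'<S. K t a s' * ?V s') + (1 - \<gamma>) * (b / (1 - \<gamma>))"
      unfolding a(2) using c[OF t a(1)] K(4) by (simp add: qval_def)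
    then show "?V t \<le> b / (1 - \<gamma>) \<or> (\<exists>w. (\<forall>s'<S. 0 \<le> w s') \<and> (\<Sum>s'<S. w s') \<le> 1
        \<and> ?V t \<le> \<gamma> * (\<Sum>s'<S. w s' * ?V s') + (1 - \<gamma>) * (b / (1 - \<gamma>)))"
      using K(1) t a(1) unfolding substoch_def by (intro disjI2 exI[of _ "K t a"]) auto
  qed (use b K in auto)
  have "- ?V s \<le> 0"
  proof (rule max_principle[where d="\<lambda>t. - ?V t", OF K(3,4) _ _ s])
    fix t assume t: "t < S"
    have "- ?V t \<le> \<gamma> * (\<Sum>s'<S. K t 0 s' * (- ?V s')) + (1 - \<gamma>) * 0"
      using Vopt_ge[OF K t K(2), of c] c[OF t K(2)] by (simp add: qval_def sum_negf)
    then show "- ?V t \<le> 0 \<or> (\<exists>w. (\<forall>s'<S. 0 \<le> w s') \<and> (\<Sum>s'<S. w s') \<le> 1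
        \<and> - ?V t \<le> \<gamma> * (\<Sum>s'<S. w s' * (- ?V s')) + (1 - \<gamma>) * 0)"
      using K(1,2) t unfolding substoch_def by (intro disjI2 exI[of _ "K t 0"]) auto
  qed auto
  then show "0 \<le> ?V s" by simp
qed

section \<open>Leaving one state-action pair out\<close>

text \<open>Freezing the one-step value at \<open>(s,a)\<close> at the number \<open>q\<close> removes the dependence on the
  samples and on the perturbation drawn at \<open>(s,a)\<close>.\<close>

definition frozen_kernel :: "nat \<Rightarrow> nat \<Rightarrow> nat \<Rightarrow> nat \<Rightarrow> (nat \<Rightarrow> nat \<Rightarrow> nat \<Rightarrow> real) \<Rightarrow> nat \<Rightarrow> nat \<Rightarrow> nat \<Rightarrow> real" where
  "frozen_kernel S A s a K t b s' = (if t < S \<and> b < A \<and> (t, b) \<noteq> (s, a) then K t b s' else 0)"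

definition frozen_reward :: "nat \<Rightarrow> nat \<Rightarrow> real \<Rightarrow> (nat \<Rightarrow> nat \<Rightarrow> real) \<Rightarrow> nat \<Rightarrow> nat \<Rightarrow> real" where
  "frozen_reward s a q c t b = (if (t, b) = (s, a) then q else c t b)"

abbreviation frozen_Vopt where
  "frozen_Vopt S A s a q K c \<gamma> \<equiv> Vopt S A (frozen_kernel S A s a K) (frozen_reward s a q c) \<gamma>"

abbreviation frozen_qval where
  "frozen_qval S A s a q K c \<gamma> \<equiv>
    qval S (frozen_kernel S A s a K) (frozen_reward s a q c) \<gamma> (frozen_Vopt S A s a q K c \<gamma>)"

lemma substoch_frozen_kernel: "substoch S A K \<Longrightarrow> substoch S A (frozen_kernel S A s a K)"
  unfolding substoch_def
proof (intro allI impI conjI)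
  fix t b assume K: "\<forall>s<S. \<forall>a<A. (\<forall>s'<S. 0 \<le> K s a s') \<and> sum (K s a) {..<S} \<le> 1" and t: "t < S" "b < A"
  show "0 \<le> frozen_kernel S A s a K t b s'" if "s' < S" for s'
    using K t that by (simp add: frozen_kernel_def)
  have "(\<Sum>s'<S. frozen_kernel S A s a K t b s') \<le> (\<Sum>s'<S. K t b s')"
    using K t by (intro sum_mono) (simp add: frozen_kernel_def)
  then show "(\<Sum>s'<S. frozen_kernel S A s a K t b s') \<le> 1" using K t by fastforce
qed

lemma qval_frozen:
  assumes "t < S" "b < A"
  shows "qval S (frozen_kernel S A s a K) (frozen_reward s a q c) \<gamma> V t b =
    (if (t, b) = (s, a) then q else qval S K c \<gamma> V t b)"
  using assms by (auto simp: qval_def frozen_kernel_def frozen_reward_def)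

text \<open>Paying exactly the current one-step value changes no one-step value, so the old value
  function still solves the Bellman equation and uniqueness applies.\<close>

lemma frozen_Vopt_eq:
  assumes K: "substoch S A K" "0 < A" "0 \<le> \<gamma>" "\<gamma> < 1" and t: "t < S"
    and q: "q = qval S K c \<gamma> (Vopt S A K c \<gamma>) s a"
  shows "frozen_Vopt S A s a q K c \<gamma> t = Vopt S A K c \<gamma> t"
proof -
  let ?V = "Vopt S A K c \<gamma>"
  have eq: "qval S (frozen_kernel S A s a K) (frozen_reward s a q c) \<gamma> ?V t b = qval S K c \<gamma> ?V t b"
    if "t < S" "b < A" for t b
    using that q by (simp add: qval_frozen)
  show ?thesis
  proof (rule Vopt_unique[symmetric, OF substoch_frozen_kernel[OF K(1)] K(2-4) _ _ t])
    show "\<exists>b<A. ?V t \<le> qval S (frozen_kernel S A s a K) (frozen_reward s a q c) \<gamma> ?V t b" if "t < S" for t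
      using Vopt_attained[OF K that, of c] eq[OF that] by (metis order_refl)
  qed (use eq Vopt_ge[OF K] in auto)
qed

lemma frozen_Vopt_lipschitz:
  assumes K: "substoch S A K" "0 < A" "0 \<le> \<gamma>" "\<gamma> < 1" and t: "t < S"
  shows "frozen_Vopt S A s a q K c \<gamma> t - frozen_Vopt S A s a q' K c \<gamma> t \<le> \<bar>q - q'\<bar>"
proof -
  let ?K = "frozen_kernel S A s a K"
  let ?V = "frozen_Vopt S A s a q K c \<gamma>" and ?W = "frozen_Vopt S A s a q' K c \<gamma>"
  note K' = substoch_frozen_kernel[OF K(1), of s a] K(2-4)
  show ?thesis
  proof (rule max_principle[where d="\<lambda>t. ?V t - ?W t", OF K(3,4) _ _ t])
    fix t assume t: "t < S"
    obtain b where b: "b < A" "?V t = frozen_qval S A s a q K c \<gamma> t b"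
      using Vopt_attained[OF K' t] by metis
    have W: "frozen_qval S A s a q' K c \<gamma> t b \<le> ?W t" using Vopt_ge[OF K' t b(1)] .
    show "?V t - ?W t \<le> \<bar>q - q'\<bar> \<or> (\<exists>w. (\<forall>s'<S. 0 \<le> w s') \<and> (\<Sum>s'<S. w s') \<le> 1
        \<and> ?V t - ?W t \<le> \<gamma> * (\<Sum>s'<S. w s' * (?V s' - ?W s')) + (1 - \<gamma>) * \<bar>q - q'\<bar>)"
    proof (cases "(t, b) = (s, a)")
      case True
      then show ?thesis using b W t by (intro disjI1) (simp add: qval_frozen)
    next
      case False
      then have "?V t - ?W t \<le> qval S K c \<gamma> ?V t b - qval S K c \<gamma> ?W t b"
        using b(2) W unfolding qval_frozen[OF t b(1)] by (simp only: if_False)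
      also have "\<dots> \<le> \<gamma> * (\<Sum>s'<S. K t b s' * (?V s' - ?W s')) + (1 - \<gamma>) * \<bar>q - q'\<bar>"
        using K(4) by (simp add: qval_diff)
      finally show ?thesis
        using K(1) t b(1) unfolding substoch_def by (intro disjI2 exI[of _ "K t b"]) auto
    qed
  qed auto
qed

lemma frozen_qval_near:
  assumes K: "substoch S A K" "0 < A" "0 \<le> \<gamma>" "\<gamma> < 1" and t: "t < S" "b < A"
    and q: "\<bar>q - qval S K c \<gamma> (Vopt S A K c \<gamma>) s a\<bar> \<le> \<epsilon>"
  shows "\<bar>frozen_qval S A s a q K c \<gamma> t b - qval S K c \<gamma> (Vopt S A K c \<gamma>) t b\<bar> \<le> \<epsilon>"
proof (cases "(t, b) = (s, a)")
  case True
  then show ?thesis using q t by (simp add: qval_frozen)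
next
  case False
  define q0 where "q0 = qval S K c \<gamma> (Vopt S A K c \<gamma>) s a"
  have "\<bar>frozen_Vopt S A s a q K c \<gamma> t' - Vopt S A K c \<gamma> t'\<bar> \<le> \<epsilon>" if "t' < S" for t'
    using frozen_Vopt_lipschitz[OF K that, of s a q c q0] frozen_Vopt_lipschitz[OF K that, of s a q0 c q]
      q[folded q0_def] unfolding frozen_Vopt_eq[OF K that q0_def] by argo
  moreover have e: "0 \<le> \<epsilon>" using q by linarith
  ultimately have "\<bar>qval S K c \<gamma> (frozen_Vopt S A s a q K c \<gamma>) t b - qval S K c \<gamma> (Vopt S A K c \<gamma>) t b\<bar> \<le> \<gamma> * \<epsilon>"
    by (intro qval_diff_le[OF K(1,3) t]) auto
  also have "\<dots> \<le> \<epsilon>" using K e by (simp add: mult_left_le_one_le)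
  finally show ?thesis unfolding qval_frozen[OF t] using False by (simp only: if_False)
qed

section \<open>Stability of the greedy policy and sensitivity of action gaps\<close>

definition greedy :: "nat \<Rightarrow> nat \<Rightarrow> (nat \<Rightarrow> nat \<Rightarrow> real) \<Rightarrow> (nat \<Rightarrow> nat) \<Rightarrow> bool" where
  "greedy S A Q d \<longleftrightarrow> (\<forall>t<S. \<forall>b<A. b \<noteq> d t \<longrightarrow> Q t b < Q t (d t))"

text \<open>Strict domination makes the greedy events of different policies exclusive, which is what
  permits a union over policies free of charge.\<close>

lemma greedy_unique:
  assumes "greedy S A Q d" "greedy S A Q d'" "\<And>s. s < S \<Longrightarrow> d s < A" "\<And>s. s < S \<Longrightarrow> d' s < A" "s < S"
  shows "d s = d' s"
  using assms unfolding greedy_def by (metis less_asym)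

text \<open>Each one-step value moves by at most \<open>\<eta> / 4\<close>, so a difference moves by
  at most \<open>\<eta> / 2\<close>, too little to reverse a gap of \<open>\<eta>\<close>.\<close>

lemma greedy_stable:
  assumes K: "substoch S A K" "0 < A" "0 \<le> \<gamma>" "\<gamma> < 1"
    and Q: "Q = qval S K c \<gamma> (Vopt S A K c \<gamma>)"
    and gap: "\<And>t b b'. t < S \<Longrightarrow> b < A \<Longrightarrow> b' < A \<Longrightarrow> b \<noteq> b' \<Longrightarrow> \<eta> \<le> \<bar>Q t b - Q t b'\<bar>" and eta: "0 < \<eta>"
    and d: "\<And>t. t < S \<Longrightarrow> d t < A" "\<And>t. t < S \<Longrightarrow> Vopt S A K c \<gamma> t = Q t (d t)"
    and q: "\<bar>q - Q s a\<bar> \<le> \<eta> / 4"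
  shows "greedy S A Q d" "greedy S A (frozen_qval S A s a q K c \<gamma>) d"
proof -
  have strict: "Q t b + \<eta> \<le> Q t (d t)" if "t < S" "b < A" "b \<noteq> d t" for t b
    using gap[OF that(1,2) d(1)[OF that(1)] that(3)] Vopt_ge[OF K that(1,2), of c] d(2)[OF that(1)] Q by simp
  then show "greedy S A Q d" using eta unfolding greedy_def by fastforce
  have near: "\<bar>frozen_qval S A s a q K c \<gamma> t b - Q t b\<bar> \<le> \<eta> / 4" if "t < S" "b < A" for t b
    unfolding Q using q Q by (intro frozen_qval_near[OF K that]) auto
  show "greedy S A (frozen_qval S A s a q K c \<gamma>) d"
    unfolding greedy_def
  proof (intro allI impI)
    fix t b assume t: "t < S" "b < A" "b \<noteq> d t"
    show "frozen_qval S A s a q K c \<gamma> t b < frozen_qval S A s a q K c \<gamma> t (d t)"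
      using strict[OF t] near[OF t(1,2)] near[OF t(1) d(1)[OF t(1)]] eta by argo
  qed
qed

text \<open>Raising the reward at \<open>(s,a)\<close> moves the optimal value most at \<open>s\<close>, and there at most as much
  as the one-step value of \<open>a\<close>; the other one-step values at \<open>s\<close> see this only through a
  discounted step.\<close>

lemma qval_gap_slope:
  assumes K: "substoch S A K" "0 < A" "0 \<le> \<gamma>" "\<gamma> < 1" and s: "s < S" "a < A" "b < A" "b \<noteq> a"
    and x: "0 \<le> x"
    and c: "\<And>t u. t < S \<Longrightarrow> u < A \<Longrightarrow> c' t u = c t u + (if (t, u) = (s, a) then x else 0)"
  defines "Q \<equiv> qval S K c \<gamma> (Vopt S A K c \<gamma>)" and "Q' \<equiv> qval S K c' \<gamma> (Vopt S A K c' \<gamma>)"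
  shows "(1 - \<gamma>) * x \<le> (Q' s a - Q' s b) - (Q s a - Q s b)"
proof -
  let ?V = "Vopt S A K c \<gamma>" and ?W = "Vopt S A K c' \<gamma>"
  have qd: "Q' t u - Q t u = (if (t, u) = (s, a) then x else 0) + \<gamma> * (\<Sum>s'<S. K t u s' * (?W s' - ?V s'))"
    if "t < S" "u < A" for t u
    unfolding Q_def Q'_def qval_diff using c[OF that] by simp
  have kp: "0 \<le> (\<Sum>s'<S. K t u s' * f s')" if "t < S" "u < A" "\<And>s'. s' < S \<Longrightarrow> 0 \<le> f s'" for t u f
    using K(1) that unfolding substoch_def by (intro sum_nonneg mult_nonneg_nonneg) auto
  have up: "0 \<le> ?W t - ?V t" if "t < S" for t
  proof -
    have "?V t - ?W t \<le> 0"
    proof (rule max_principle[where d="\<lambda>t. ?V t - ?W t", OF K(3,4) _ _ that])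
      fix t assume t: "t < S"
      obtain u where u: "u < A" "?V t = Q t u" using Vopt_attained[OF K t, of c] by (auto simp: Q_def)
      have "Q' t u \<le> ?W t" using Vopt_ge[OF K t u(1), of c'] by (simp add: Q'_def)
      moreover have "(\<Sum>s'<S. K t u s' * (?V s' - ?W s')) = - (\<Sum>s'<S. K t u s' * (?W s' - ?V s'))"
        by (simp add: right_diff_distrib sum_subtractf)
      ultimately have "?V t - ?W t \<le> \<gamma> * (\<Sum>s'<S. K t u s' * (?V s' - ?W s')) + (1 - \<gamma>) * 0"
        using qd[OF t u(1)] u x by (simp split: if_splits)
      then show "?V t - ?W t \<le> 0 \<or> (\<exists>w. (\<forall>s'<S. 0 \<le> w s') \<and> (\<Sum>s'<S. w s') \<le> 1
          \<and> ?V t - ?W t \<le> \<gamma> * (\<Sum>s'<S. w s' * (?V s' - ?W s')) + (1 - \<gamma>) * 0)"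
        using K(1) t u(1) unfolding substoch_def by (intro disjI2 exI[of _ "K t u"]) auto
    qed auto
    then show ?thesis by simp
  qed
  define D where "D = Q' s a - Q s a"
  have D: "x \<le> D" using qd[OF s(1,2)] kp[OF s(1,2) up] K(3) by (simp add: D_def)
  have mx: "?W t - ?V t \<le> D" if "t < S" for t
  proof (rule max_principle[where d="\<lambda>t. ?W t - ?V t", OF K(3,4) _ _ that])
    fix t assume t: "t < S"
    obtain u where u: "u < A" "?W t = Q' t u" using Vopt_attained[OF K t, of c'] by (auto simp: Q'_def)
    have "Q t u \<le> ?V t" using Vopt_ge[OF K t u(1), of c] by (simp add: Q_def)
    then have le: "?W t - ?V t \<le> Q' t u - Q t u" using u by simp
    show "?W t - ?V t \<le> D \<or> (\<exists>w. (\<forall>s'<S. 0 \<le> w s') \<and> (\<Sum>s'<S. w s') \<le> 1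
          \<and> ?W t - ?V t \<le> \<gamma> * (\<Sum>s'<S. w s' * (?W s' - ?V s')) + (1 - \<gamma>) * D)"
    proof (cases "(t, u) = (s, a)")
      case True
      then show ?thesis using le by (simp add: D_def)
    next
      case False
      have "0 \<le> (1 - \<gamma>) * D" using K(4) D x by simp
      then have "?W t - ?V t \<le> \<gamma> * (\<Sum>s'<S. K t u s' * (?W s' - ?V s')) + (1 - \<gamma>) * D"
        using le qd[OF t u(1)] False by (simp split: if_splits)
      then show ?thesis
        using K(1) t u(1) unfolding substoch_def by (intro disjI2 exI[of _ "K t u"]) auto
    qed
  qed (use D x in auto)
  \<comment> \<open>The competitor \<open>b\<close> gains at most \<open>\<gamma> * D\<close> while
    \<open>a\<close> gains \<open>D\<close>, which is at least \<open>x\<close>; the remaining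
    \<open>(1 - \<gamma>) * D\<close> gives the slope.\<close>
  have "(\<Sum>s'<S. K s b s' * (?W s' - ?V s')) \<le> (\<Sum>s'<S. K s b s' * D)"
    using K(1) s mx unfolding substoch_def by (intro sum_mono mult_left_mono) auto
  also have "\<dots> = (\<Sum>s'<S. K s b s') * D" by (simp add: sum_distrib_right)
  also have "\<dots> \<le> 1 * D" using K(1) s D x unfolding substoch_def by (intro mult_right_mono) auto
  finally have "Q' s b - Q s b \<le> \<gamma> * D" using qd[OF s(1,3)] s(4) K(3) by (simp add: mult_left_mono)
  moreover have "(1 - \<gamma>) * x \<le> (1 - \<gamma>) * D" using D K(4) by (intro mult_left_mono) auto
  ultimately show ?thesis by (simp add: D_def algebra_simps)
qed

section \<open>Concentration\<close>

lemma borel_measurable_qval: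
  assumes "(\<lambda>\<omega>. c \<omega> s a) \<in> borel_measurable M"
    and "\<And>s'. s' < S \<Longrightarrow> (\<lambda>\<omega>. K \<omega> s a s') \<in> borel_measurable M"
    and "\<And>s'. s' < S \<Longrightarrow> (\<lambda>\<omega>. V \<omega> s') \<in> borel_measurable M"
  shows "(\<lambda>\<omega>. qval S (K \<omega>) (c \<omega>) \<gamma> (V \<omega>) s a) \<in> borel_measurable M"
  unfolding qval_def using assms
  by (intro borel_measurable_add borel_measurable_times borel_measurable_sum borel_measurable_const) auto

lemma borel_measurable_Vopt:
  assumes c: "\<And>s a. s < S \<Longrightarrow> a < A \<Longrightarrow> (\<lambda>\<omega>. c \<omega> s a) \<in> borel_measurable M"
    and K: "\<And>s a s'. s < S \<Longrightarrow> a < A \<Longrightarrow> s' < S \<Longrightarrow> (\<lambda>\<omega>. K \<omega> s a s') \<in> borel_measurable M"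
    and s: "s < S"
  shows "(\<lambda>\<omega>. Vopt S A (K \<omega>) (c \<omega>) \<gamma> s) \<in> borel_measurable M"
proof -
  have "s < S \<Longrightarrow> (\<lambda>\<omega>. viter S A (K \<omega>) (c \<omega>) \<gamma> k s) \<in> borel_measurable M" for k s
  proof (induction k arbitrary: s)
    case (Suc k)
    then show ?case unfolding viter.simps
      using c K by (intro borel_measurable_Max borel_measurable_qval) auto
  qed simp
  then show ?thesis unfolding Vopt_def using s by (intro borel_measurable_lim_metric) auto
qed

context product_prob_space
begin

text \<open>Independence as Fubini: the coordinates split into \<open>I - J\<close>, seen by
  \<open>f\<close>, and \<open>J\<close>, seen by the factors. The hypothesis \<open>dep\<close>
  concerns arbitrary functions, so the same \<open>f\<close> can be evaluated on either product
  space.\<close>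

lemma nn_integral_PiM_indep:
  fixes f :: "('i \<Rightarrow> 'a) \<Rightarrow> ennreal" and g :: "'i \<Rightarrow> 'a \<Rightarrow> ennreal"
  assumes I: "finite I" "J \<subseteq> I" and f: "f \<in> borel_measurable (PiM I M)"
    and dep: "\<And>X X'. (\<And>i. i \<in> I - J \<Longrightarrow> X i = X' i) \<Longrightarrow> f X = f X'"
    and g[measurable]: "\<And>i. i \<in> J \<Longrightarrow> g i \<in> borel_measurable (M i)"
  shows "(\<integral>\<^sup>+X. f X * (\<Prod>i\<in>J. g i (X i)) \<partial>PiM I M)
       = (\<integral>\<^sup>+X. f X \<partial>PiM I M) * (\<Prod>i\<in>J. \<integral>\<^sup>+x. g i x \<partial>M i)"
proof -
  let ?I = "I - J"
  have fin: "finite ?I" "finite J" "?I \<inter> J = {}" and un: "?I \<union> J = I"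
    using I finite_subset by auto
  have probJ: "prob_space (PiM J M)" by (intro prob_space_PiM M.prob_space_axioms)
  \<comment> \<open>\<open>y0\<close> serves to write \<open>f\<close> on the smaller product as a
    section of \<open>f\<close> on the whole, which settles its measurability there.\<close>
  obtain y0 where y0: "y0 \<in> space (PiM J M)" using prob_space.not_empty[OF probJ] by blast
  have fm: "f (merge ?I J (x, y)) = f x" for x y by (rule dep) auto
  have prod_merge: "(\<Prod>i\<in>J. g i (merge ?I J (x, y) i)) = (\<Prod>i\<in>J. g i (y i))" for x y
    by (intro prod.cong) (auto simp: merge_def)
  have "(\<lambda>x. f (merge ?I J (x, y0))) \<in> borel_measurable (PiM ?I M)"
    using y0 f by (intro measurable_compose[OF _ f]
      measurable_compose[OF measurable_Pair2'[OF y0] measurable_merge[of ?I J M, unfolded un]])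
  then have f': "f \<in> borel_measurable (PiM ?I M)" by (simp add: fm)
  have gm: "(\<lambda>y. \<Prod>i\<in>J. g i (y i)) \<in> borel_measurable (PiM J M)" by measurable
  have gI: "(\<lambda>y. \<Prod>i\<in>J. g i (y i)) \<in> borel_measurable (PiM I M)"
    using I g by (intro borel_measurable_prod_ennreal measurable_compose[OF measurable_component_singleton]) auto
  have fold: "integral\<^sup>N (PiM I M) F = (\<integral>\<^sup>+x. (\<integral>\<^sup>+y. F (merge ?I J (x, y)) \<partial>PiM J M) \<partial>PiM ?I M)"
    if "F \<in> borel_measurable (PiM I M)" for F
    using product_nn_integral_fold[of ?I J F] fin that un by simp
  have "(\<integral>\<^sup>+X. f X * (\<Prod>i\<in>J. g i (X i)) \<partial>PiM I M)
      = (\<integral>\<^sup>+x. (\<integral>\<^sup>+y. f x * (\<Prod>i\<in>J. g i (y i)) \<partial>PiM J M) \<partial>PiM ?I M)"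
    using f gI by (subst fold) (simp_all add: fm prod_merge)
  also have "\<dots> = (\<integral>\<^sup>+x. f x * (\<Prod>i\<in>J. \<integral>\<^sup>+x. g i x \<partial>M i) \<partial>PiM ?I M)"
    using g fin by (intro nn_integral_cong) (simp add: nn_integral_cmult[OF gm] product_nn_integral_prod)
  also have "\<dots> = (\<integral>\<^sup>+x. f x \<partial>PiM ?I M) * (\<Prod>i\<in>J. \<integral>\<^sup>+x. g i x \<partial>M i)"
    by (rule nn_integral_multc[OF f'])
  also have "(\<integral>\<^sup>+x. f x \<partial>PiM ?I M) = (\<integral>\<^sup>+X. f X \<partial>PiM I M)"
    by (subst fold[OF f]) (simp add: fm prob_space.emeasure_space_1[OF probJ])
  finally show ?thesis .
qed

text \<open>Since at most one \<open>G t\<close> holds, the union over \<open>T\<close> costs nothing compared with a single \<open>t\<close>.\<close>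

lemma emeasure_exceed_le:
  fixes g :: "'t \<Rightarrow> 'i \<Rightarrow> 'a \<Rightarrow> real" and L :: real
  assumes I: "finite I" "J \<subseteq> I" and T: "finite T"
    and G: "\<And>t. t \<in> T \<Longrightarrow> Measurable.pred (PiM I M) (G t)"
    and dep: "\<And>t X X'. (\<And>i. i \<in> I - J \<Longrightarrow> X i = X' i) \<Longrightarrow> G t X \<longleftrightarrow> G t X'"
    and disj: "\<And>t t' X. t \<in> T \<Longrightarrow> t' \<in> T \<Longrightarrow> G t X \<Longrightarrow> G t' X \<Longrightarrow> t = t'"
    and g[measurable]: "\<And>t i. t \<in> T \<Longrightarrow> i \<in> J \<Longrightarrow> g t i \<in> borel_measurable (M i)"
    and g0: "\<And>t i x. t \<in> T \<Longrightarrow> i \<in> J \<Longrightarrow> 0 \<le> g t i x"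
    and g1: "\<And>t i. t \<in> T \<Longrightarrow> i \<in> J \<Longrightarrow> (\<integral>\<^sup>+x. ennreal (g t i x) \<partial>M i) = 1"
  shows "emeasure (PiM I M) {X \<in> space (PiM I M). \<exists>t\<in>T. G t X \<and> exp L < (\<Prod>i\<in>J. g t i (X i))}
    \<le> ennreal (exp (- L))"
proof -
  let ?B = "{X \<in> space (PiM I M). \<exists>t\<in>T. G t X \<and> exp L < (\<Prod>i\<in>J. g t i (X i))}"
  let ?Z = "\<lambda>t X. \<Prod>i\<in>J. ennreal (g t i (X i))"
  have probI: "prob_space (PiM I M)" by (intro prob_space_PiM M.prob_space_axioms)
  have J: "finite J" using I finite_subset by auto
  note G[measurable]
  have comp[measurable]: "(\<lambda>X. g t i (X i)) \<in> borel_measurable (PiM I M)" if "t \<in> T" "i \<in> J" for t i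
    using that I g by (intro measurable_compose[OF measurable_component_singleton]) auto
  have Zm[measurable]: "(\<lambda>X. \<Prod>i\<in>J. g t i (X i)) \<in> borel_measurable (PiM I M)" if "t \<in> T" for t
    using that by (intro borel_measurable_prod) auto
  have Zm'[measurable]: "?Z t \<in> borel_measurable (PiM I M)" if "t \<in> T" for t
    using comp that by (intro borel_measurable_prod_ennreal) auto
  have Gm[measurable]: "(\<lambda>X. of_bool (G t X) :: ennreal) \<in> borel_measurable (PiM I M)" if "t \<in> T" for t
    using that unfolding of_bool_def by measurable
  have B[measurable]: "?B \<in> sets (PiM I M)"
    using T by (intro sets.sets_Collect_finite_Ex sets.sets_Collect_conj) (auto intro: predE G)
  have "emeasure (PiM I M) ?B = (\<integral>\<^sup>+X. indicator ?B X \<partial>PiM I M)" using B by simp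
  \<comment> \<open>Markov's inequality summed over \<open>t\<close>: on the bad set some summand
    exceeds \<open>exp L\<close>.\<close>
  also have "\<dots> \<le> (\<integral>\<^sup>+X. ennreal (exp (- L)) * (\<Sum>t\<in>T. of_bool (G t X) * ?Z t X) \<partial>PiM I M)"
  proof (intro nn_integral_mono)
    fix X
    show "indicator ?B X \<le> ennreal (exp (- L)) * (\<Sum>t\<in>T. of_bool (G t X) * ?Z t X)"
    proof (cases "X \<in> ?B")
      case True
      then obtain t where t: "t \<in> T" "G t X" "exp L < (\<Prod>i\<in>J. g t i (X i))" by auto
      have "1 = exp (- L) * exp L" by (simp flip: exp_add)
      also have "\<dots> \<le> exp (- L) * (\<Prod>i\<in>J. g t i (X i))" using t by (intro mult_left_mono) auto
      finally have "ennreal 1 \<le> ennreal (exp (- L) * (\<Prod>i\<in>J. g t i (X i)))" by (intro ennreal_leI)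
      also have "\<dots> = ennreal (exp (- L)) * ?Z t X"
        using t g0 by (simp add: ennreal_mult prod_nonneg prod_ennreal)
      also have "?Z t X = of_bool (G t X) * ?Z t X" using t by simp
      also have "\<dots> \<le> (\<Sum>t\<in>T. of_bool (G t X) * ?Z t X)"
        using T t by (intro member_le_sum) auto
      finally show ?thesis using True by (simp add: mult_left_mono)
    qed simp
  qed
  also have "\<dots> = ennreal (exp (- L)) * (\<Sum>t\<in>T. \<integral>\<^sup>+X. of_bool (G t X) * ?Z t X \<partial>PiM I M)"
    by (subst nn_integral_cmult) (auto simp: nn_integral_sum)
  \<comment> \<open>\<open>G t\<close> sees only coordinates outside \<open>J\<close>, so the
    product over \<open>J\<close> integrates out, and each of its factors has integral one.\<close>
  also have "(\<Sum>t\<in>T. \<integral>\<^sup>+X. of_bool (G t X) * ?Z t X \<partial>PiM I M) = (\<Sum>t\<in>T. \<integral>\<^sup>+X. of_bool (G t X) \<partial>PiM I M)"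
  proof (intro sum.cong refl)
    fix t assume t: "t \<in> T"
    have "(\<integral>\<^sup>+X. of_bool (G t X) * ?Z t X \<partial>PiM I M)
        = (\<integral>\<^sup>+X. of_bool (G t X) \<partial>PiM I M) * (\<Prod>i\<in>J. \<integral>\<^sup>+x. ennreal (g t i x) \<partial>M i)"
    proof (rule nn_integral_PiM_indep[OF I Gm[OF t]])
      fix X X' :: "'i \<Rightarrow> 'a" assume "\<And>i. i \<in> I - J \<Longrightarrow> X i = X' i"
      then have "G t X \<longleftrightarrow> G t X'" by (rule dep)
      then show "of_bool (G t X) = (of_bool (G t X') :: ennreal)" by simp
    qed (use g t in simp)
    then show "(\<integral>\<^sup>+X. of_bool (G t X) * ?Z t X \<partial>PiM I M) = (\<integral>\<^sup>+X. of_bool (G t X) \<partial>PiM I M)"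
      using g1[OF t] by simp
  qed
  also have "(\<Sum>t\<in>T. \<integral>\<^sup>+X. of_bool (G t X) \<partial>PiM I M) = (\<integral>\<^sup>+X. (\<Sum>t\<in>T. of_bool (G t X)) \<partial>PiM I M)"
    by (subst nn_integral_sum) auto
  also have "\<dots> \<le> (\<integral>\<^sup>+X. 1 \<partial>PiM I M)"
  proof (intro nn_integral_mono)
    fix X
    show "(\<Sum>t\<in>T. of_bool (G t X)) \<le> (1::ennreal)"
    proof (cases "\<exists>t\<in>T. G t X")
      case True
      then obtain t where "t \<in> T" "G t X" by auto
      then have "(\<Sum>t'\<in>T. of_bool (G t' X)) = (\<Sum>t'\<in>T. if t' = t then 1 else (0::ennreal))"
        using disj by (intro sum.cong) auto
      then show ?thesis using T \<open>t \<in> T\<close> by simp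
    qed (simp add: sum.neutral)
  qed
  also have "\<dots> = 1" by (simp add: prob_space.emeasure_space_1[OF probI])
  finally show ?thesis by (simp add: mult_left_mono)
qed

end

text \<open>Two points of the set have images less than \<open>2 * \<eta>\<close> apart, so by the
  slope bound they lie within \<open>2 * \<eta> / \<kappa>\<close> of each other. The set fits into
  an interval around any of its points, and the density is \<open>1 / \<xi>\<close>.\<close>

lemma emeasure_uniform_slope_le:
  fixes f :: "real \<Rightarrow> real"
  assumes xi: "0 < \<xi>" and k: "0 < \<kappa>" and eta: "0 \<le> \<eta>" and f[measurable]: "f \<in> borel_measurable borel"
    and slope: "\<And>x y. x \<le> y \<Longrightarrow> \<kappa> * (y - x) \<le> f y - f x"
  shows "emeasure (uniform_measure lborel {0..\<xi>}) {x. \<bar>f x\<bar> < \<eta>} \<le> ennreal (4 * \<eta> / (\<kappa> * \<xi>))"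
proof -
  let ?B = "{x. \<bar>f x\<bar> < \<eta>}"
  have B: "?B \<in> sets lborel" by simp
  have "emeasure lborel ({0..\<xi>} \<inter> ?B) \<le> ennreal (4 * \<eta> / \<kappa>)"
  proof (cases "?B = {}")
    case False
    then obtain z where z: "\<bar>f z\<bar> < \<eta>" by auto
    have "?B \<subseteq> {z - 2 * \<eta> / \<kappa>..z + 2 * \<eta> / \<kappa>}"
    proof
      fix x assume x: "x \<in> ?B"
      have "\<kappa> * \<bar>x - z\<bar> \<le> 2 * \<eta>" using slope[of x z] slope[of z x] x z by (cases "x \<le> z") auto
      then have "\<bar>x - z\<bar> \<le> 2 * \<eta> / \<kappa>" using k by (simp add: field_simps)
      then show "x \<in> {z - 2 * \<eta> / \<kappa>..z + 2 * \<eta> / \<kappa>}" by (auto simp: abs_le_iff)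
    qed
    then have "emeasure lborel ({0..\<xi>} \<inter> ?B) \<le> emeasure lborel {z - 2 * \<eta> / \<kappa>..z + 2 * \<eta> / \<kappa>}"
      by (intro emeasure_mono) auto
    also have "\<dots> = ennreal (4 * \<eta> / \<kappa>)" using eta k by (subst emeasure_lborel_Icc) (auto simp: field_simps)
    finally show ?thesis .
  qed simp
  then have "emeasure (uniform_measure lborel {0..\<xi>}) ?B \<le> ennreal (4 * \<eta> / \<kappa>) / ennreal \<xi>"
    using xi B by (simp add: divide_right_mono_ennreal)
  also have "\<dots> = ennreal (4 * \<eta> / (\<kappa> * \<xi>))" using xi k eta by (simp add: divide_ennreal)
  finally show ?thesis .
qed

lemma borel_measurable_P_hat:
  assumes "\<And>i. i < n \<Longrightarrow> (\<lambda>\<omega>. X \<omega> (s, a, i)) \<in> measurable M (count_space UNIV)"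
  shows "(\<lambda>\<omega>. P_hat n (X \<omega>) s a s') \<in> borel_measurable M"
proof -
  have "real (card {i. i < n \<and> X \<omega> (s, a, i) = s'}) = (\<Sum>i<n. indicator {s'} (X \<omega> (s, a, i)))" for \<omega>
  proof -
    have "{i. i < n \<and> X \<omega> (s, a, i) = s'} = {..<n} \<inter> {i. X \<omega> (s, a, i) = s'}" by auto
    then show ?thesis by (simp add: indicator_def sum.If_cases)
  qed
  moreover have "(\<lambda>\<omega>. indicator {s'} (X \<omega> (s, a, i)) :: real) \<in> borel_measurable M" if "i < n" for i
    using that assms by (intro measurable_compose[OF assms]) auto
  ultimately show ?thesis unfolding P_hat_def by (auto intro!: borel_measurable_divide borel_measurable_sum)
qed

section \<open>The error on the good event\<close>

text \<open>Zero beyond the states, so that the function lies between zero and the span on all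
  naturals: the weights built from it must be nonnegative at samples outside the state space
  too.\<close>

definition centered :: "nat \<Rightarrow> (nat \<Rightarrow> real) \<Rightarrow> nat \<Rightarrow> real" where
  "centered S V s = (if s < S then V s - Min (V ` {..<S}) else 0)"

text \<open>The value of \<open>\<lambda>\<close> balancing \<open>L / (\<lambda> n)\<close> against \<open>\<lambda> (H + 1)\<close>.\<close>

definition tilt :: "real \<Rightarrow> nat \<Rightarrow> real \<Rightarrow> real" where
  "tilt L n H = sqrt (L / (real n * (H + 1)))"

text \<open>A deviation counts only when the tilt is small against the span. There the factors are
  nonnegative, as Markov's inequality requires; elsewhere the error bound is trivial. The two signs
  are the two sides of the error.\<close>

definition deviates :: "nat \<Rightarrow> nat \<Rightarrow> real \<Rightarrow> real \<Rightarrow> (nat \<Rightarrow> real) \<Rightarrow> (nat \<Rightarrow> real) \<Rightarrow> (nat \<Rightarrow> nat) \<Rightarrow> bool" where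
  "deviates S n \<gamma> L p V x \<longleftrightarrow> tilt L n (span S V) * span S V \<le> 1 / 64 \<and>
    (\<exists>\<sigma>\<in>{1, - 1}. exp L < (\<Prod>i<n. 1 + \<sigma> * (tilt L n (span S V) * \<gamma> *
      (centered S V (x i) - (\<Sum>s'<S. p s' * centered S V s')))))"

lemma span_bounds:
  assumes "s < S"
  shows "Min (V ` {..<S}) \<le> V s" "V s \<le> Min (V ` {..<S}) + span S V"
    "0 \<le> centered S V s" "centered S V s \<le> span S V" "0 \<le> span S V"
proof -
  have "Min (V ` {..<S}) \<le> V s" "V s \<le> Max (V ` {..<S})" using assms by auto
  moreover from this have "Min (V ` {..<S}) \<le> Max (V ` {..<S})" by (rule order_trans)
  ultimately show "Min (V ` {..<S}) \<le> V s" "V s \<le> Min (V ` {..<S}) + span S V"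
    "0 \<le> centered S V s" "centered S V s \<le> span S V" "0 \<le> span S V"
    using assms by (simp_all add: span_def centered_def)
qed

lemma value_error_span_bound:
  fixes V U :: "nat \<Rightarrow> real" and L :: real
  assumes n: "0 < n" and g: "0 \<le> \<gamma>" "\<gamma> < 1" and L: "0 < L"
    and X: "\<And>s i. s < S \<Longrightarrow> i < n \<Longrightarrow> X (s, d s, i) < S"
    and p0: "\<And>s s'. s < S \<Longrightarrow> s' < S \<Longrightarrow> 0 \<le> p s s'"
    and p1: "\<And>s. s < S \<Longrightarrow> (\<Sum>s'<S. p s s') = 1"
    and V: "\<And>s. s < S \<Longrightarrow> V s = c s + \<gamma> * (\<Sum>s'<S. p s s' * V s')"
    and U: "\<And>s. s < S \<Longrightarrow> U s = c s + \<gamma> * (\<Sum>s'<S. P_hat n X s (d s) s' * U s')"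
    and c: "\<And>s. s < S \<Longrightarrow> 0 \<le> c s \<and> c s \<le> 1"
    and conc: "\<And>s. s < S \<Longrightarrow> \<not> deviates S n \<gamma> L (p s) V (\<lambda>i. X (s, d s, i))"
    and s: "s < S"
  shows "\<bar>V s - U s\<bar> \<le> 64 * sqrt (L * (span S V + 1) / n) / (1 - \<gamma>)"
proof (rule value_error_sqrt_bound[where h="centered S V" and l="tilt L n (span S V)" and
      lo="Min (V ` {..<S})" and H="span S V" and c=c and X=X and d=d and p=p and S=S])
  have "Min (V ` {..<S}) \<in> V ` {..<S}" using s by (intro Min_in) auto
  then obtain t where t: "t < S" "Min (V ` {..<S}) = V t" by auto
  have "0 \<le> V t \<and> V t \<le> 1 / (1 - \<gamma>)" using p1 by (intro fixpoint_range[OF g p0 _ V c t(1)]) auto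
  then show "0 \<le> (1 - \<gamma>) * Min (V ` {..<S})" "(1 - \<gamma>) * Min (V ` {..<S}) \<le> 1"
    using g unfolding t(2) by (simp_all add: pos_le_divide_eq mult.commute)
  show "Min (V ` {..<S}) \<le> V t \<and> V t \<le> Min (V ` {..<S}) + span S V" if "t < S" for t
    using span_bounds[OF that] by simp
  show "0 \<le> p t t'" if "t < S" "t' < S" for t t' using p0 that .
  show "X (t, d t, i) < S" if "t < S" "i < n" for t i using X that .
  fix t assume t: "t < S" "tilt L n (span S V) * span S V \<le> 1 / 64"
  then have "\<sigma> \<in> {1, - 1} \<Longrightarrow> (\<Prod>i<n. 1 + \<sigma> * (tilt L n (span S V) * \<gamma> *
      (centered S V (X (t, d t, i)) - (\<Sum>s'<S. p t s' * centered S V s')))) \<le> exp L" for \<sigma>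
    using conc[OF t(1)] unfolding deviates_def by (auto simp: not_less)
  from this[of 1] this[of "- 1"]
  show "(\<Prod>i<n. 1 + tilt L n (span S V) * \<gamma> *
      (centered S V (X (t, d t, i)) - (\<Sum>s'<S. p t s' * centered S V s'))) \<le> exp L \<and>
    (\<Prod>i<n. 1 - tilt L n (span S V) * \<gamma> *
      (centered S V (X (t, d t, i)) - (\<Sum>s'<S. p t s' * centered S V s'))) \<le> exp L"
    by simp
qed (use n g L p1 U c s in \<open>simp_all add: centered_def tilt_def V[symmetric]\<close>)

lemma Vpol_det_pol_reward_mono:
  assumes K: "substoch S A K" and d: "\<And>s. s < S \<Longrightarrow> d s < A" and g: "0 \<le> \<gamma>" "\<gamma> < 1" and s: "s < S"
    and c: "\<And>s a. s < S \<Longrightarrow> a < A \<Longrightarrow> c s a \<le> c' s a + \<epsilon>" and e: "0 \<le> \<epsilon>"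
  shows "Vpol S A K c \<gamma> (det_pol d) s \<le> Vpol S A K c' \<gamma> (det_pol d) s + \<epsilon> / (1 - \<gamma>)"
proof -
  let ?V = "Vpol S A K c \<gamma> (det_pol d)" and ?W = "Vpol S A K c' \<gamma> (det_pol d)"
  have "?V s - ?W s \<le> \<epsilon> / (1 - \<gamma>)"
  proof (rule max_principle[where d="\<lambda>s. ?V s - ?W s", OF g _ _ s])
    fix t assume t: "t < S"
    have "?V t - ?W t \<le> \<gamma> * (\<Sum>s'<S. K t (d t) s' * (?V s' - ?W s')) + (1 - \<gamma>) * (\<epsilon> / (1 - \<gamma>))"
      using Vpol_det_pol[where d=d and r=c, OF K d g t] Vpol_det_pol[where d=d and r=c', OF K d g t]
        qval_diff[of S K c \<gamma> ?V t "d t" c' ?W] c[OF t d[OF t]] g by simp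
    then show "?V t - ?W t \<le> \<epsilon> / (1 - \<gamma>) \<or> (\<exists>w. (\<forall>s'<S. 0 \<le> w s') \<and> (\<Sum>s'<S. w s') \<le> 1
        \<and> ?V t - ?W t \<le> \<gamma> * (\<Sum>s'<S. w s' * (?V s' - ?W s')) + (1 - \<gamma>) * (\<epsilon> / (1 - \<gamma>)))"
      using K t d[OF t] unfolding substoch_def by (intro disjI2 exI[of _ "K t (d t)"]) auto
  qed (use e g in auto)
  then show ?thesis by simp
qed

lemma exists_grid_point:
  fixes x h :: real
  assumes "0 < h" "0 \<le> x" "x \<le> b" "b / h \<le> real N"
  shows "\<exists>k\<le>N. \<bar>real k * h - x\<bar> \<le> h"
proof (intro exI conjI)
  let ?k = "nat \<lfloor>x / h\<rfloor>"
  have k: "real ?k \<le> x / h" "x / h < real ?k + 1" using assms by (auto simp: of_nat_nat)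
  have "x / h \<le> b / h" using assms by (simp add: divide_right_mono)
  then have "real ?k \<le> real N" using k assms by linarith
  then show "?k \<le> N" by simp
  show "\<bar>real ?k * h - x\<bar> \<le> h" using k assms(1) by (auto simp: field_simps abs_le_iff)
qed

lemma substoch_pmf:
  assumes "\<And>s a. s < S \<Longrightarrow> a < A \<Longrightarrow> set_pmf (P s a) \<subseteq> {..<S}"
  shows "substoch S A (\<lambda>s a s'. pmf (P s a) s')"
    "s < S \<Longrightarrow> a < A \<Longrightarrow> (\<Sum>s'<S. pmf (P s a) s') = 1"
proof -
  show *: "(\<Sum>s'<S. pmf (P s a) s') = 1" if "s < S" "a < A" for s a
    using assms[OF that] by (intro sum_pmf_eq_1) auto
  show "substoch S A (\<lambda>s a s'. pmf (P s a) s')"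
    unfolding substoch_def using * by auto
qed

text \<open>Both sampling comparisons use the unperturbed reward \<open>r\<close>: one for the
  policy \<open>d\<close> selected by the data, one for an optimal policy \<open>e\<close> of the
  true model. In between, \<open>d\<close> beats \<open>e\<close> for the perturbed reward, and
  returning to \<open>r\<close> costs \<open>\<xi> / (1 - \<gamma>)\<close>.\<close>

lemma policy_error_on_good_event:
  fixes P :: "nat \<Rightarrow> nat \<Rightarrow> nat pmf" and r :: "nat \<Rightarrow> nat \<Rightarrow> real" and L \<eta> \<xi> :: real
  defines "K \<equiv> (\<lambda>s a s'. pmf (P s a) s')"
  assumes A: "0 < A" and n: "0 < n" and g: "0 \<le> \<gamma>" "\<gamma> < 1" and L: "0 < L" and eta: "0 < \<eta>"
    and P: "\<And>s a. s < S \<Longrightarrow> a < A \<Longrightarrow> set_pmf (P s a) \<subseteq> {..<S}"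
    and r: "\<And>s a. s < S \<Longrightarrow> a < A \<Longrightarrow> 0 \<le> r s a \<and> r s a \<le> 1"
    and xi: "0 \<le> \<xi>" "\<xi> \<le> 1"
    and X: "\<And>s a i. s < S \<Longrightarrow> a < A \<Longrightarrow> i < n \<Longrightarrow> X (s, a, i) < S"
    and D: "\<And>s a. s < S \<Longrightarrow> a < A \<Longrightarrow> 0 \<le> D (s, a) \<and> D (s, a) \<le> \<xi>"
  defines "Kh \<equiv> P_hat n X" and "rt \<equiv> r_tilde r D"
  assumes N: "8 / (\<eta> * (1 - \<gamma>)) \<le> real N"
    and gap: "\<And>s a b. s < S \<Longrightarrow> a < A \<Longrightarrow> b < A \<Longrightarrow> a \<noteq> b \<Longrightarrow>
      \<eta> \<le> \<bar>qval S Kh rt \<gamma> (Vopt S A Kh rt \<gamma>) s a - qval S Kh rt \<gamma> (Vopt S A Kh rt \<gamma>) s b\<bar>"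
    and rows: "\<And>s a (k::nat) d. s < S \<Longrightarrow> a < A \<Longrightarrow> k \<le> N \<Longrightarrow> d \<in> PiE {..<S} (\<lambda>_. {..<A}) \<Longrightarrow>
      greedy S A (frozen_qval S A s a (real k * (\<eta> / 4)) Kh rt \<gamma>) d \<Longrightarrow>
      \<not> deviates S n \<gamma> L (K s a) (Vpol S A K r \<gamma> (det_pol d)) (\<lambda>i. X (s, a, i))"
    and star: "\<And>s a. s < S \<Longrightarrow> a < A \<Longrightarrow> \<not> deviates S n \<gamma> L (K s a) (Vopt S A K r \<gamma>) (\<lambda>i. X (s, a, i))"
    and opt: "is_optimal_policy S A Kh rt \<gamma> \<pi>"
    and s: "s < S"
  shows "\<bar>Vpol S A K r \<gamma> \<pi> s - Vopt S A K r \<gamma> s\<bar>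
    \<le> (64 * sqrt (L * (span S (Vopt S A K r \<gamma>) + 1) / n)
      + 64 * sqrt (L * (span S (Vpol S A K r \<gamma> \<pi>) + 1) / n) + \<xi>) / (1 - \<gamma>)"
proof -
  have K: "substoch S A K" and K1: "\<And>s a. s < S \<Longrightarrow> a < A \<Longrightarrow> (\<Sum>s'<S. K s a s') = 1"
    using substoch_pmf[OF P] by (auto simp: K_def)
  have Kh: "substoch S A Kh" unfolding Kh_def using n by (rule substoch_P_hat)
  define Q where "Q = qval S Kh rt \<gamma> (Vopt S A Kh rt \<gamma>)"
  have rt: "r s a \<le> rt s a" "rt s a \<le> r s a + \<xi>" if "s < S" "a < A" for s a
    using D[OF that] by (auto simp: rt_def r_tilde_def)
  have "\<forall>s. \<exists>a. s < S \<longrightarrow> a < A \<and> Vopt S A Kh rt \<gamma> s = Q s a"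
    using Vopt_attained[OF Kh A g] unfolding Q_def by blast
  from choice[OF this] obtain d0 where d0: "\<And>s. s < S \<Longrightarrow> d0 s < A \<and> Vopt S A Kh rt \<gamma> s = Q s (d0 s)" by blast
  \<comment> \<open>Restriction makes \<open>d\<close> a member of the finite index set of
    deterministic policies.\<close>
  define d where "d = restrict d0 {..<S}"
  have d: "\<And>s. s < S \<Longrightarrow> d s < A" "\<And>s. s < S \<Longrightarrow> Vopt S A Kh rt \<gamma> s = Q s (d s)"
    "d \<in> PiE {..<S} (\<lambda>_. {..<A})" using d0 by (auto simp: d_def)
  have stable: "greedy S A Q d" "greedy S A (frozen_qval S A t a q Kh rt \<gamma>) d"
    if "\<bar>q - Q t a\<bar> \<le> \<eta> / 4" for t a q
    by (intro greedy_stable[OF Kh A g Q_def _ eta d(1,2) that] gap[folded Q_def]; assumption)+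
  let ?V = "Vpol S A K r \<gamma> (det_pol d)"
  \<comment> \<open>Each state uses its own grid point near \<open>Q t (d t)\<close>. Perturbed
    rewards are at most 2, so these values lie in \<open>[0, 2 / (1 - \<gamma>)]\<close>, and the
    spacing \<open>\<eta> / 4\<close> gives the requirement on \<open>N\<close>.\<close>
  have dev: "\<not> deviates S n \<gamma> L (K t (d t)) ?V (\<lambda>i. X (t, d t, i))" if t: "t < S" for t
  proof -
    have "0 \<le> rt s a \<and> rt s a \<le> 2" if "s < S" "a < A" for s a
      using r[OF that] rt[OF that] xi by linarith
    then have "0 \<le> Q t (d t)" "Q t (d t) \<le> 2 / (1 - \<gamma>)"
      using Vopt_range[OF Kh A g _ t, of rt 2] d(2)[OF t] by auto
    moreover have "2 / (1 - \<gamma>) / (\<eta> / 4) \<le> real N" using N by (simp add: mult.commute)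
    ultimately obtain k where k: "k \<le> N" "\<bar>k * (\<eta> / 4) - Q t (d t)\<bar> \<le> \<eta> / 4"
      using exists_grid_point[of "\<eta> / 4" "Q t (d t)" "2 / (1 - \<gamma>)" N] eta by auto
    show ?thesis using rows[OF t d(1)[OF t] k(1) d(3) stable(2)[OF k(2)]] .
  qed
  \<comment> \<open>An arbitrary instance: \<open>q\<close> is taken equal to \<open>Q 0 0\<close>,
    and the conclusion mentions neither \<open>q\<close> nor the pair.\<close>
  have "greedy S A Q d" using stable(1)[where q="Q 0 0" and t=0 and a=0] eta by simp
  then have strict: "qval S Kh rt \<gamma> (Vopt S A Kh rt \<gamma>) t a < Vopt S A Kh rt \<gamma> t"
    if "t < S" "a < A" "a \<noteq> d t" for t a
    using that d(2)[OF that(1)] unfolding greedy_def Q_def by simp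
  have \<pi>: "Vpol S A K r \<gamma> \<pi> = ?V"
  proof (rule Vpol_cong)
    fix t a assume t: "t < S" "a < A"
    show "\<pi> t a = det_pol d t a"
      by (rule optimal_policy_unique[OF Kh A g opt _ _ t]) (fact d(1) strict)+
  qed
  obtain e where e: "\<And>s. s < S \<Longrightarrow> e s < A" "\<And>s. s < S \<Longrightarrow> Vpol S A K r \<gamma> (det_pol e) s = Vopt S A K r \<gamma> s"
    using optimal_det_pol_exists[OF K A g] by metis
  let ?W = "Vopt S A K r \<gamma>"
  have "\<bar>?V s - Vpol S A Kh r \<gamma> (det_pol d) s\<bar> \<le> 64 * sqrt (L * (span S ?V + 1) / n) / (1 - \<gamma>)"
  proof (rule value_error_span_bound[where c="\<lambda>s. r s (d s)" and p="\<lambda>s. K s (d s)" and X=X and d=d, OF n g L])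
    show "?V t = r t (d t) + \<gamma> * (\<Sum>s'<S. K t (d t) s' * ?V s')" if "t < S" for t
      using Vpol_det_pol[where d=d and r=r, OF K d(1) g that] by (simp add: qval_def)
    show "Vpol S A Kh r \<gamma> (det_pol d) t = r t (d t)
        + \<gamma> * (\<Sum>s'<S. P_hat n X t (d t) s' * Vpol S A Kh r \<gamma> (det_pol d) s')" if "t < S" for t
      using Vpol_det_pol[where d=d and r=r, OF Kh d(1) g that] by (simp add: qval_def Kh_def)
  qed (use X d K1 r dev s in \<open>auto simp: K_def\<close>)
  moreover have "\<bar>?W s - Vpol S A Kh r \<gamma> (det_pol e) s\<bar> \<le> 64 * sqrt (L * (span S ?W + 1) / n) / (1 - \<gamma>)"
  proof (rule value_error_span_bound[where c="\<lambda>s. r s (e s)" and p="\<lambda>s. K s (e s)" and X=X and d=e, OF n g L])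
    show "?W t = r t (e t) + \<gamma> * (\<Sum>s'<S. K t (e t) s' * ?W s')" if "t < S" for t
      using Vpol_det_pol[where d=e and r=r, OF K e(1) g that] e(2) that by (simp add: qval_def)
    show "Vpol S A Kh r \<gamma> (det_pol e) t = r t (e t)
        + \<gamma> * (\<Sum>s'<S. P_hat n X t (e t) s' * Vpol S A Kh r \<gamma> (det_pol e) s')" if "t < S" for t
      using Vpol_det_pol[where d=e and r=r, OF Kh e(1) g that] by (simp add: qval_def Kh_def)
  qed (use X e K1 r star s in \<open>auto simp: K_def\<close>)
  \<comment> \<open>The chain inside the empirical model: \<open>e\<close> under \<open>r\<close>,
    \<open>e\<close> under \<open>rt\<close>, the optimum under \<open>rt\<close>, \<open>d\<close>
    under \<open>rt\<close>, \<open>d\<close> under \<open>r\<close>.\<close>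
  moreover have "Vpol S A Kh r \<gamma> (det_pol e) s \<le> Vpol S A Kh rt \<gamma> (det_pol e) s"
    using Vpol_det_pol_reward_mono[where d=e and c=r and c'=rt and \<epsilon>=0, OF Kh e(1) g s] rt by simp
  moreover have "Vpol S A Kh rt \<gamma> (det_pol e) s \<le> Vopt S A Kh rt \<gamma> s"
    using is_policy_det_pol[where d=e, OF e(1)] by (intro Vpol_le_Vopt[OF Kh A g _ s]) auto
  moreover have "Vopt S A Kh rt \<gamma> s = Vpol S A Kh rt \<gamma> (det_pol d) s"
    using Vpol_greedy[where d=d and r=rt, OF Kh A g d(1) _ s] d(2) unfolding Q_def by simp
  moreover have "Vpol S A Kh rt \<gamma> (det_pol d) s \<le> Vpol S A Kh r \<gamma> (det_pol d) s + \<xi> / (1 - \<gamma>)"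
    using Vpol_det_pol_reward_mono[where d=d and c=rt and c'=r and \<epsilon>=\<xi>, OF Kh d(1) g s] rt xi by simp
  moreover have "?V s \<le> ?W s"
    using is_policy_det_pol[where d=d, OF d(1)] by (intro Vpol_le_Vopt[OF K A g _ s]) auto
  ultimately show ?thesis unfolding \<pi> add_divide_distrib by linarith
qed

section \<open>The sampled model\<close>

text \<open>Centring at the mean cancels the linear term, which yields the mean-one factors of the
  exceedance bound.\<close>

lemma nn_integral_pmf_tilt:
  fixes f :: "nat \<Rightarrow> real"
  assumes p: "set_pmf p \<subseteq> {..<S}" and pos: "\<And>x. 0 \<le> 1 + l * (f x - (\<Sum>s'<S. pmf p s' * f s'))"
  shows "(\<integral>\<^sup>+x. ennreal (1 + l * (f x - (\<Sum>s'<S. pmf p s' * f s'))) \<partial>measure_pmf p) = 1"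
proof -
  define m where "m = (\<Sum>s'<S. pmf p s' * f s')"
  have fin: "finite (set_pmf p)" using p finite_subset by blast
  have p1: "(\<Sum>s'<S. pmf p s') = 1" using p by (intro sum_pmf_eq_1) auto
  have "(\<integral>\<^sup>+x. ennreal (1 + l * (f x - m)) \<partial>measure_pmf p) = ennreal (\<integral>x. 1 + l * (f x - m) \<partial>measure_pmf p)"
    using pos integrable_measure_pmf_finite[OF fin] by (intro nn_integral_eq_integral) (auto simp: m_def)
  also have "(\<integral>x. 1 + l * (f x - m) \<partial>measure_pmf p) = (\<Sum>x<S. (1 + l * (f x - m)) * pmf p x)"
    using p by (intro integral_measure_pmf_real) auto
  also have "\<dots> = (\<Sum>x<S. (1 - l * m) * pmf p x + l * (pmf p x * f x))"
    by (intro sum.cong) (auto simp: algebra_simps)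
  also have "\<dots> = 1" by (simp add: sum.distrib p1 m_def flip: sum_distrib_left)
  finally show ?thesis by (simp add: m_def)
qed

lemma pred_deviates:
  assumes "\<And>i. i < n \<Longrightarrow> (\<lambda>\<omega>. x \<omega> i) \<in> measurable N (count_space UNIV)"
  shows "Measurable.pred N (\<lambda>\<omega>. deviates S n \<gamma> L p V (x \<omega>))"
proof -
  have [measurable]: "(\<lambda>\<omega>. \<Prod>i<n. 1 + \<sigma> * (c * (centered S V (x \<omega> i) - m))) \<in> borel_measurable N" for \<sigma> c m
  proof (rule borel_measurable_prod)
    fix i assume "i \<in> {..<n}"
    then show "(\<lambda>\<omega>. 1 + \<sigma> * (c * (centered S V (x \<omega> i) - m))) \<in> borel_measurable N"
      using assms by (intro measurable_compose[where f="\<lambda>\<omega>. x \<omega> i" and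
        g="\<lambda>y. 1 + \<sigma> * (c * (centered S V y - m))" and N="count_space UNIV"]) auto
  qed
  show ?thesis unfolding deviates_def bex_simps by measurable
qed

lemma pred_greedy:
  assumes "\<And>t b. t < S \<Longrightarrow> b < A \<Longrightarrow> (\<lambda>\<omega>. Q \<omega> t b) \<in> borel_measurable N"
    and "\<And>t. t < S \<Longrightarrow> d t < A"
  shows "Measurable.pred N (\<lambda>\<omega>. greedy S A (Q \<omega>) d)"
proof -
  have "Measurable.pred N (\<lambda>\<omega>. \<forall>t\<in>{..<S}. \<forall>b\<in>{..<A}. b \<noteq> d t \<longrightarrow> Q \<omega> t b < Q \<omega> t (d t))"
  proof (intro pred_intros_finite finite_lessThan pred_intros_imp' )
    fix t b assume "t \<in> {..<S}" "b \<in> {..<A}"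
    then show "Measurable.pred N (\<lambda>\<omega>. Q \<omega> t b < Q \<omega> t (d t))"
      using assms by (intro borel_measurable_pred_less) auto
  qed
  then show ?thesis by (simp only: greedy_def Ball_def lessThan_iff)
qed

text \<open>The two halves serve opposite conditionings: samples fixed and perturbation random for
  the action gaps, perturbation fixed and samples random for the row deviations.\<close>

lemma emeasure_pair_le:
  assumes "prob_space M1" "prob_space M2" and B: "B \<in> sets (M1 \<Otimes>\<^sub>M M2)"
  shows "(\<And>x. x \<in> space M1 \<Longrightarrow> emeasure M2 (Pair x -` B) \<le> c) \<Longrightarrow> emeasure (M1 \<Otimes>\<^sub>M M2) B \<le> c"
    and "(\<And>y. y \<in> space M2 \<Longrightarrow> emeasure M1 ((\<lambda>x. (x, y)) -` B) \<le> c) \<Longrightarrow> emeasure (M1 \<Otimes>\<^sub>M M2) B \<le> c"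
proof -
  interpret M1: prob_space M1 by fact
  interpret M2: prob_space M2 by fact
  interpret P: pair_sigma_finite M1 M2 ..
  show "emeasure (M1 \<Otimes>\<^sub>M M2) B \<le> c" if "\<And>x. x \<in> space M1 \<Longrightarrow> emeasure M2 (Pair x -` B) \<le> c"
  proof -
    have "emeasure (M1 \<Otimes>\<^sub>M M2) B = (\<integral>\<^sup>+x. emeasure M2 (Pair x -` B) \<partial>M1)"
      by (rule M2.emeasure_pair_measure_alt[OF B])
    also have "\<dots> \<le> (\<integral>\<^sup>+x. c \<partial>M1)" using that by (intro nn_integral_mono)
    finally show ?thesis by (simp add: M1.emeasure_space_1)
  qed
  show "emeasure (M1 \<Otimes>\<^sub>M M2) B \<le> c" if "\<And>y. y \<in> space M2 \<Longrightarrow> emeasure M1 ((\<lambda>x. (x, y)) -` B) \<le> c"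
  proof -
    have "emeasure (M1 \<Otimes>\<^sub>M M2) B = (\<integral>\<^sup>+y. emeasure M1 ((\<lambda>x. (x, y)) -` B) \<partial>M2)"
      by (rule P.emeasure_pair_measure_alt2[OF B])
    also have "\<dots> \<le> (\<integral>\<^sup>+y. c \<partial>M2)" using that by (intro nn_integral_mono)
    finally show ?thesis by (simp add: M2.emeasure_space_1)
  qed
qed

locale sampled_mdp =
  fixes S A n :: nat and P :: "nat \<Rightarrow> nat \<Rightarrow> nat pmf" and r :: "nat \<Rightarrow> nat \<Rightarrow> real" and \<gamma> \<xi> :: real
  assumes SA: "0 < S" "0 < A" and n_pos: "0 < n"
    and P_support: "\<And>s a. s < S \<Longrightarrow> a < A \<Longrightarrow> set_pmf (P s a) \<subseteq> {..<S}"
    and reward: "\<And>s a. s < S \<Longrightarrow> a < A \<Longrightarrow> 0 \<le> r s a \<and> r s a \<le> 1"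
    and discount: "0 < \<gamma>" "\<gamma> < 1" and noise: "0 < \<xi>" "\<xi> \<le> 1"
begin

abbreviation "MI \<equiv> {(s, a, i). s < S \<and> a < A \<and> i < n}"
abbreviation "MP \<equiv> (\<lambda>(s, a, i). measure_pmf (P s a))"
abbreviation "MX \<equiv> PiM MI MP"
abbreviation "MD \<equiv> PiM ({..<S} \<times> {..<A}) (\<lambda>_. uniform_measure lborel {0..\<xi>})"
abbreviation "K \<equiv> (\<lambda>s a s'. pmf (P s a) s')"

lemma finite_MI: "finite MI"
proof -
  have "MI = {..<S} \<times> {..<A} \<times> {..<n}" by auto
  then show ?thesis by simp
qed

lemma prob_uniform: "prob_space (uniform_measure lborel {0..\<xi>})"
  using noise by (intro prob_space_uniform_measure) auto

lemma prob_MP: "prob_space (MP j)"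
  by (cases j) (simp add: measure_pmf.prob_space_axioms)

lemma product_X: "product_prob_space MP"
  by (intro product_prob_spaceI prob_MP)

lemma product_D: "product_prob_space (\<lambda>_::nat \<times> nat. uniform_measure lborel {0..\<xi>})"
  by (intro product_prob_spaceI prob_uniform)

lemma prob_MX: "prob_space MX"
  by (intro prob_space_PiM prob_MP)

lemma prob_MD: "prob_space MD"
  by (intro prob_space_PiM prob_uniform)

lemma measurable_X:
  assumes "s < S" "a < A" "i < n"
  shows "(\<lambda>X. X (s, a, i)) \<in> measurable MX (count_space UNIV)"
proof -
  have "(\<lambda>X. X (s, a, i)) \<in> measurable MX (MP (s, a, i))"
    using assms by (intro measurable_component_singleton) auto
  also have "measurable MX (MP (s, a, i)) = measurable MX (count_space UNIV)"
    by (intro measurable_cong_sets) auto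
  finally show ?thesis .
qed

lemma measurable_D:
  assumes "s < S" "a < A"
  shows "(\<lambda>D. D (s, a)) \<in> borel_measurable MD"
proof -
  have "(\<lambda>D. D (s, a)) \<in> measurable MD (uniform_measure lborel {0..\<xi>})"
    using assms by (intro measurable_component_singleton) auto
  also have "measurable MD (uniform_measure lborel {0..\<xi>}) = borel_measurable MD"
    by (intro measurable_cong_sets) auto
  finally show ?thesis .
qed

text \<open>Each sign is one exceedance bound, hence the factor 2. The value function and its tilt
  may vary with \<open>t\<close>, because the exceedance bound allows different factors for
  different \<open>t\<close>.\<close>

lemma row_deviation_prob:
  fixes V :: "'d \<Rightarrow> nat \<Rightarrow> real" and L :: real
  assumes sa: "s < S" "a < A" and T: "finite T" and L: "0 < L"
    and G: "\<And>t. t \<in> T \<Longrightarrow> Measurable.pred MX (G t)"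
    and dep: "\<And>t X X'. (\<And>t' b i. t' < S \<Longrightarrow> b < A \<Longrightarrow> i < n \<Longrightarrow> (t', b) \<noteq> (s, a) \<Longrightarrow>
        X (t', b, i) = X' (t', b, i)) \<Longrightarrow> G t X \<longleftrightarrow> G t X'"
    and disj: "\<And>t t' X. t \<in> T \<Longrightarrow> t' \<in> T \<Longrightarrow> G t X \<Longrightarrow> G t' X \<Longrightarrow> t = t'"
  shows "emeasure MX {X \<in> space MX. \<exists>t\<in>T. G t X \<and> deviates S n \<gamma> L (K s a) (V t) (\<lambda>i. X (s, a, i))}
    \<le> ennreal (2 * exp (- L))"
proof -
  interpret product_prob_space MP MI by (rule product_X)
  define l where "l t = tilt L n (span S (V t))" for t
  \<comment> \<open>The other indices never satisfy \<open>deviates\<close>, and for them the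
    factors could be negative.\<close>
  define T' where "T' = {t \<in> T. l t * span S (V t) \<le> 1 / 64}"
  define u where "u \<sigma> t x = 1 + \<sigma> * (l t * \<gamma>) * (centered S (V t) x - (\<Sum>s'<S. K s a s' * centered S (V t) s'))"
    for \<sigma> t x
  let ?J = "(\<lambda>i. (s, a, i)) ` {..<n}"
  let ?B = "\<lambda>\<sigma>. {X \<in> space MX. \<exists>t\<in>T'. G t X \<and> exp L < (\<Prod>j\<in>?J. u \<sigma> t (X j))}"
  have prodJ: "(\<Prod>j\<in>?J. u \<sigma> t (X j)) = (\<Prod>i<n. u \<sigma> t (X (s, a, i)))" for \<sigma> t X
    by (subst prod.reindex) (auto simp: inj_on_def)
  have u0: "0 \<le> u \<sigma> t x" if "\<sigma> \<in> {1, - 1}" "t \<in> T'" for \<sigma> t x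
  proof -
    let ?H = "span S (V t)"
    have H0: "0 \<le> ?H" using span_bounds(5)[OF sa(1)] .
    have l0: "0 \<le> l t" using L H0 by (simp add: l_def tilt_def)
    have c: "0 \<le> centered S (V t) y" "centered S (V t) y \<le> ?H" for y
      using span_bounds(3,4)[of y S "V t"] H0 by (cases "y < S"; simp add: centered_def)+
    define m where "m = (\<Sum>s'<S. K s a s' * centered S (V t) s')"
    have "0 \<le> m" unfolding m_def using c by (intro sum_nonneg) auto
    moreover have "m \<le> (\<Sum>s'<S. K s a s' * ?H)"
      unfolding m_def using c by (intro sum_mono mult_left_mono) auto
    then have "m \<le> ?H" using substoch_pmf(2)[where P=P and S=S and A=A, OF P_support sa] by (simp flip: sum_distrib_right)
    ultimately have "\<bar>centered S (V t) x - m\<bar> \<le> ?H" using c[of x] unfolding abs_le_iff by linarith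
    moreover have "l t * \<gamma> \<le> l t * 1" using l0 discount by (intro mult_left_mono) auto
    ultimately have "(l t * \<gamma>) * \<bar>centered S (V t) x - m\<bar> \<le> l t * ?H"
      using l0 discount by (intro mult_mono) auto
    also have "\<dots> \<le> 1" using that(2) by (simp add: T'_def)
    finally have "\<bar>(l t * \<gamma>) * (centered S (V t) x - m)\<bar> \<le> 1" using l0 discount by (simp add: abs_mult)
    then show ?thesis using that(1) by (auto simp: u_def m_def[symmetric] abs_le_iff)
  qed
  have B: "emeasure MX (?B \<sigma>) \<le> ennreal (exp (- L))" if s: "\<sigma> \<in> {1, - 1}" for \<sigma>
  proof (rule emeasure_exceed_le[where g="\<lambda>t j. u \<sigma> t"])
    show "G t X \<longleftrightarrow> G t X'" if "\<And>i. i \<in> MI - ?J \<Longrightarrow> X i = X' i" for t X X'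
      using that by (intro dep) auto
    show "(\<integral>\<^sup>+x. ennreal (u \<sigma> t x) \<partial>MP j) = 1" if "t \<in> T'" "j \<in> ?J" for t j
      using that nn_integral_pmf_tilt[OF P_support[OF sa], of "\<sigma> * (l t * \<gamma>)" "centered S (V t)"] u0[OF s that(1)]
      by (auto simp: u_def)
    show "u \<sigma> t \<in> borel_measurable (MP j)" if "t \<in> T'" "j \<in> ?J" for t j using that by auto
    show "finite MI" by (rule finite_MI)
    show "?J \<subseteq> MI" using sa by auto
    show "finite T'" using T by (simp add: T'_def)
    show "Measurable.pred MX (G t)" if "t \<in> T'" for t using that G by (simp add: T'_def)
    show "t = t'" if "t \<in> T'" "t' \<in> T'" "G t X" "G t' X" for t t' X
      using that disj unfolding T'_def by blast
    show "0 \<le> u \<sigma> t x" if "t \<in> T'" for t x using u0[OF s that] .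
  qed
  have Bm: "?B \<sigma> \<in> sets MX" for \<sigma>
  proof -
    have "(\<lambda>X. \<Prod>i<n. u \<sigma> t (X (s, a, i))) \<in> borel_measurable MX" for t
      using sa by (intro borel_measurable_prod measurable_compose[OF measurable_X]) auto
    note [measurable] = this
    have "Measurable.pred MX (\<lambda>X. \<exists>t\<in>T'. G t X \<and> exp L < (\<Prod>i<n. u \<sigma> t (X (s, a, i))))"
    proof (rule pred_intros_finite)
      show "finite T'" using T by (simp add: T'_def)
      fix t assume "t \<in> T'"
      then have [measurable]: "Measurable.pred MX (G t)" using G by (simp add: T'_def)
      show "Measurable.pred MX (\<lambda>X. G t X \<and> exp L < (\<Prod>i<n. u \<sigma> t (X (s, a, i))))" by measurable
    qed
    then show ?thesis unfolding prodJ by (simp add: pred_def)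
  qed
  have "{X \<in> space MX. \<exists>t\<in>T. G t X \<and> deviates S n \<gamma> L (K s a) (V t) (\<lambda>i. X (s, a, i))} \<subseteq> ?B 1 \<union> ?B (- 1)"
  proof -
    have "deviates S n \<gamma> L (K s a) (V t) x \<longleftrightarrow>
        l t * span S (V t) \<le> 1 / 64 \<and> (\<exists>\<sigma>\<in>{1, - 1}. exp L < (\<Prod>i<n. u \<sigma> t (x i)))" for t x
      unfolding deviates_def u_def l_def mult.assoc ..
    then show ?thesis unfolding prodJ T'_def by (intro subsetI) (simp, blast)
  qed
  then have "emeasure MX {X \<in> space MX. \<exists>t\<in>T. G t X \<and> deviates S n \<gamma> L (K s a) (V t) (\<lambda>i. X (s, a, i))}
      \<le> emeasure MX (?B 1 \<union> ?B (- 1))" using Bm by (intro emeasure_mono) auto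
  also have "\<dots> \<le> emeasure MX (?B 1) + emeasure MX (?B (- 1))" by (rule emeasure_subadditive[OF Bm Bm])
  also have "\<dots> \<le> ennreal (exp (- L)) + ennreal (exp (- L))" by (intro add_mono B) auto
  also have "\<dots> = ennreal (2 * exp (- L))" by (simp flip: ennreal_plus)
  finally show ?thesis .
qed

text \<open>With all perturbations but the one at \<open>(s,a)\<close> held fixed, the gap is a
  function of one uniform variable with slope at least \<open>1 - \<gamma>\<close>.\<close>

lemma gap_prob_fixed:
  assumes K: "substoch S A K'" and sab: "s < S" "a < A" "b < A" "b \<noteq> a" and eta: "0 \<le> \<eta>"
  defines "Q \<equiv> (\<lambda>D. qval S K' (r_tilde r D) \<gamma> (Vopt S A K' (r_tilde r D) \<gamma>))"
  shows "emeasure MD {D \<in> space MD. \<bar>Q D s a - Q D s b\<bar> < \<eta>} \<le> ennreal (4 * \<eta> / ((1 - \<gamma>) * \<xi>))"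
proof -
  interpret product_prob_space "\<lambda>_::nat \<times> nat. uniform_measure lborel {0..\<xi>}" "{..<S} \<times> {..<A}" by (rule product_D)
  let ?J = "{..<S} \<times> {..<A} - {(s, a)}"
  let ?U = "uniform_measure lborel {0..\<xi>}"
  let ?B = "{D \<in> space MD. \<bar>Q D s a - Q D s b\<bar> < \<eta>}"
  have ins: "insert (s, a) ?J = {..<S} \<times> {..<A}" using sab by auto
  have Qm: "(\<lambda>\<omega>. Q (D \<omega>) t u) \<in> borel_measurable N"
    if "\<And>t u. t < S \<Longrightarrow> u < A \<Longrightarrow> (\<lambda>\<omega>. D \<omega> (t, u)) \<in> borel_measurable N" "t < S" "u < A" for D N t u
  proof -
    have "(\<lambda>\<omega>. r_tilde r (D \<omega>) t u) \<in> borel_measurable N" if "t < S" "u < A" for t u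
      unfolding r_tilde_def using \<open>\<And>t u. t < S \<Longrightarrow> u < A \<Longrightarrow> (\<lambda>\<omega>. D \<omega> (t, u)) \<in> borel_measurable N\<close>[OF that]
      by (intro borel_measurable_add borel_measurable_const)
    then show ?thesis unfolding Q_def using that(2,3)
      by (intro borel_measurable_qval borel_measurable_Vopt borel_measurable_const)
  qed
  have B: "?B \<in> sets MD"
  proof -
    have [measurable]: "(\<lambda>D. Q D s a) \<in> borel_measurable MD" "(\<lambda>D. Q D s b) \<in> borel_measurable MD"
      using sab by - (intro Qm measurable_D; assumption)+
    show ?thesis by measurable
  qed
  have "emeasure MD ?B = (\<integral>\<^sup>+D. indicator ?B D \<partial>MD)" using B by simp
  also have "\<dots> = (\<integral>\<^sup>+x. (\<integral>\<^sup>+y. indicator ?B (x((s, a) := y)) \<partial>?U) \<partial>PiM ?J (\<lambda>_. ?U))"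
    using product_nn_integral_insert[of ?J "(s, a)" "indicator ?B"] B unfolding ins by simp
  also have "\<dots> \<le> (\<integral>\<^sup>+x. ennreal (4 * \<eta> / ((1 - \<gamma>) * \<xi>)) \<partial>PiM ?J (\<lambda>_. ?U))"
  proof (intro nn_integral_mono)
    fix x assume x: "x \<in> space (PiM ?J (\<lambda>_. ?U))"
    define f where "f y = Q (x((s, a) := y)) s a - Q (x((s, a) := y)) s b" for y
    have [measurable]: "f \<in> borel_measurable borel"
      unfolding f_def using sab by (intro borel_measurable_diff Qm) (auto simp: fun_upd_def)
    have "x((s, a) := y) \<in> space MD" for y
      using x sab unfolding space_PiM by (auto simp: PiE_iff extensional_def)
    then have "indicator ?B (x((s, a) := y)) = (indicator {y. \<bar>f y\<bar> < \<eta>} y :: ennreal)" for y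
      by (simp add: f_def indicator_def)
    then have "(\<integral>\<^sup>+y. indicator ?B (x((s, a) := y)) \<partial>?U) = (\<integral>\<^sup>+y. indicator {y. \<bar>f y\<bar> < \<eta>} y \<partial>?U)"
      by simp
    also have "\<dots> = emeasure ?U {y. \<bar>f y\<bar> < \<eta>}" by (intro nn_integral_indicator) simp
    also have "\<dots> \<le> ennreal (4 * \<eta> / ((1 - \<gamma>) * \<xi>))"
    proof (rule emeasure_uniform_slope_le)
      fix y z :: real assume yz: "y \<le> z"
      show "(1 - \<gamma>) * (z - y) \<le> f z - f y"
        unfolding f_def Q_def using yz discount sab
        by (intro qval_gap_slope[OF K SA(2)]) (auto simp: r_tilde_def)
    qed (use noise discount eta in auto)
    finally show "(\<integral>\<^sup>+y. indicator ?B (x((s, a) := y)) \<partial>?U) \<le> ennreal (4 * \<eta> / ((1 - \<gamma>) * \<xi>))" .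
  qed
  also have "\<dots> = ennreal (4 * \<eta> / ((1 - \<gamma>) * \<xi>))"
  proof -
    have "prob_space (PiM ?J (\<lambda>_. ?U))" by (intro prob_space_PiM prob_uniform)
    then show ?thesis by (simp add: prob_space.emeasure_space_1)
  qed
  finally show ?thesis .
qed

end

section \<open>The bad events and their probabilities\<close>

context sampled_mdp
begin

abbreviation "M \<equiv> MX \<Otimes>\<^sub>M MD"

lemma prob_M: "prob_space M"
  by (rule prob_space_pair[OF prob_MX prob_MD])

lemma measurable_fst_X:
  assumes "s < S" "a < A" "i < n"
  shows "(\<lambda>\<omega>. fst \<omega> (s, a, i)) \<in> measurable M (count_space UNIV)"
  by (rule measurable_compose[OF measurable_fst measurable_X[OF assms]])

lemma measurable_snd_D:
  assumes "s < S" "a < A"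
  shows "(\<lambda>\<omega>. snd \<omega> (s, a)) \<in> borel_measurable M"
  by (rule measurable_compose[OF measurable_snd measurable_D[OF assms]])

lemma measurable_fst_P_hat: "s < S \<Longrightarrow> a < A \<Longrightarrow> (\<lambda>\<omega>. P_hat n (fst \<omega>) s a s') \<in> borel_measurable M"
  by (intro borel_measurable_P_hat measurable_fst_X)

lemma measurable_snd_r_tilde: "s < S \<Longrightarrow> a < A \<Longrightarrow> (\<lambda>\<omega>. r_tilde r (snd \<omega>) s a) \<in> borel_measurable M"
  unfolding r_tilde_def by (intro borel_measurable_add borel_measurable_const measurable_snd_D)

definition "gap_bad \<eta> s a b = {\<omega> \<in> space M.
  \<bar>qval S (P_hat n (fst \<omega>)) (r_tilde r (snd \<omega>)) \<gamma> (Vopt S A (P_hat n (fst \<omega>)) (r_tilde r (snd \<omega>)) \<gamma>) s a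
   - qval S (P_hat n (fst \<omega>)) (r_tilde r (snd \<omega>)) \<gamma> (Vopt S A (P_hat n (fst \<omega>)) (r_tilde r (snd \<omega>)) \<gamma>) s b\<bar> < \<eta>}"

text \<open>The existential over policies sits inside the event: exclusiveness bounds it as a whole,
  whereas adding up one event per policy would multiply the bound by the number of policies.\<close>

definition "row_bad L q s a = {\<omega> \<in> space M. \<exists>d\<in>PiE {..<S} (\<lambda>_. {..<A}).
  greedy S A (frozen_qval S A s a q (P_hat n (fst \<omega>)) (r_tilde r (snd \<omega>)) \<gamma>) d \<and>
  deviates S n \<gamma> L (K s a) (Vpol S A K r \<gamma> (det_pol d)) (\<lambda>i. fst \<omega> (s, a, i))}"

definition "star_bad L s a = {\<omega> \<in> space M.
  deviates S n \<gamma> L (K s a) (Vopt S A K r \<gamma>) (\<lambda>i. fst \<omega> (s, a, i))}"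

definition "samples_bad = {\<omega> \<in> space M. \<not> (\<forall>j\<in>MI. fst \<omega> j < S)}"

definition "noise_bad = {\<omega> \<in> space M. \<not> (\<forall>j\<in>{..<S} \<times> {..<A}. 0 \<le> snd \<omega> j \<and> snd \<omega> j \<le> \<xi>)}"

lemma gap_bad:
  assumes "s < S" "a < A" "b < A" "b \<noteq> a" "0 \<le> \<eta>"
  shows "gap_bad \<eta> s a b \<in> sets M" "emeasure M (gap_bad \<eta> s a b) \<le> ennreal (4 * \<eta> / ((1 - \<gamma>) * \<xi>))"
proof -
  have [measurable]: "(\<lambda>\<omega>. qval S (P_hat n (fst \<omega>)) (r_tilde r (snd \<omega>)) \<gamma>
      (Vopt S A (P_hat n (fst \<omega>)) (r_tilde r (snd \<omega>)) \<gamma>) s u) \<in> borel_measurable M" if "u < A" for u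
    using assms that
    by (intro borel_measurable_qval borel_measurable_Vopt measurable_fst_P_hat measurable_snd_r_tilde)
  note [simp] = assms(2,3)
  show *: "gap_bad \<eta> s a b \<in> sets M" unfolding gap_bad_def by measurable
  show "emeasure M (gap_bad \<eta> s a b) \<le> ennreal (4 * \<eta> / ((1 - \<gamma>) * \<xi>))"
  proof (rule emeasure_pair_le(1)[OF prob_MX prob_MD *])
    fix X assume X: "X \<in> space MX"
    have "Pair X -` gap_bad \<eta> s a b = {D \<in> space MD. \<bar>qval S (P_hat n X) (r_tilde r D) \<gamma> (Vopt S A (P_hat n X) (r_tilde r D) \<gamma>) s a
       - qval S (P_hat n X) (r_tilde r D) \<gamma> (Vopt S A (P_hat n X) (r_tilde r D) \<gamma>) s b\<bar> < \<eta>}"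
      using X by (auto simp: gap_bad_def space_pair_measure)
    then show "emeasure MD (Pair X -` gap_bad \<eta> s a b) \<le> ennreal (4 * \<eta> / ((1 - \<gamma>) * \<xi>))"
      using gap_prob_fixed[OF substoch_P_hat[OF n_pos] assms] by simp
  qed
qed

lemma borel_measurable_frozen_qval:
  assumes "t < S" "b < A"
    and K: "\<And>t b s'. t < S \<Longrightarrow> b < A \<Longrightarrow> (\<lambda>\<omega>. K' \<omega> t b s') \<in> borel_measurable N"
    and c: "\<And>t b. t < S \<Longrightarrow> b < A \<Longrightarrow> (\<lambda>\<omega>. c \<omega> t b) \<in> borel_measurable N"
  shows "(\<lambda>\<omega>. frozen_qval S A s a q (K' \<omega>) (c \<omega>) \<gamma> t b) \<in> borel_measurable N"
proof -
  have "(\<lambda>\<omega>. frozen_kernel S A s a (K' \<omega>) t b s') \<in> borel_measurable N" if "t < S" "b < A" for t b s'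
    using K[OF that] that by (cases "(t, b) = (s, a)") (auto simp: frozen_kernel_def)
  moreover have "(\<lambda>\<omega>. frozen_reward s a q (c \<omega>) t b) \<in> borel_measurable N" if "t < S" "b < A" for t b
    using c[OF that] that by (cases "(t, b) = (s, a)") (auto simp: frozen_reward_def)
  ultimately show ?thesis using assms(1,2)
    by (intro borel_measurable_qval borel_measurable_Vopt)
qed

lemma row_bad:
  assumes sa: "s < S" "a < A" and L: "0 < L"
  shows "row_bad L q s a \<in> sets M" "emeasure M (row_bad L q s a) \<le> ennreal (2 * exp (- L))"
proof -
  let ?T = "PiE {..<S} (\<lambda>_. {..<A})"
  have T: "finite ?T" by (intro finite_PiE) auto
  have Td: "d t < A" if "d \<in> ?T" "t < S" for d t using that by (auto dest: PiE_mem)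
  have "Measurable.pred M (\<lambda>\<omega>. \<exists>d\<in>?T. greedy S A (frozen_qval S A s a q (P_hat n (fst \<omega>)) (r_tilde r (snd \<omega>)) \<gamma>) d \<and>
    deviates S n \<gamma> L (K s a) (Vpol S A K r \<gamma> (det_pol d)) (\<lambda>i. fst \<omega> (s, a, i)))"
  proof (rule pred_intros_finite[OF T])
    fix d assume d: "d \<in> ?T"
    have [measurable]: "Measurable.pred M (\<lambda>\<omega>. greedy S A (frozen_qval S A s a q (P_hat n (fst \<omega>)) (r_tilde r (snd \<omega>)) \<gamma>) d)"
      using Td[OF d]
      by (intro pred_greedy borel_measurable_frozen_qval measurable_fst_P_hat measurable_snd_r_tilde)
    have [measurable]: "Measurable.pred M (\<lambda>\<omega>. deviates S n \<gamma> L (K s a) (Vpol S A K r \<gamma> (det_pol d)) (\<lambda>i. fst \<omega> (s, a, i)))"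
      by (intro pred_deviates measurable_fst_X sa)
    show "Measurable.pred M (\<lambda>\<omega>. greedy S A (frozen_qval S A s a q (P_hat n (fst \<omega>)) (r_tilde r (snd \<omega>)) \<gamma>) d \<and>
      deviates S n \<gamma> L (K s a) (Vpol S A K r \<gamma> (det_pol d)) (\<lambda>i. fst \<omega> (s, a, i)))" by measurable
  qed
  then show *: "row_bad L q s a \<in> sets M" unfolding row_bad_def by (simp only: pred_def)
  show "emeasure M (row_bad L q s a) \<le> ennreal (2 * exp (- L))"
  proof (rule emeasure_pair_le(2)[OF prob_MX prob_MD *])
    fix D assume D: "D \<in> space MD"
    define G where "G d X = greedy S A (frozen_qval S A s a q (P_hat n X) (r_tilde r D) \<gamma>) d" for d X
    have "(\<lambda>X. (X, D)) -` row_bad L q s a = {X \<in> space MX. \<exists>d\<in>?T. G d X \<and>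
        deviates S n \<gamma> L (K s a) (Vpol S A K r \<gamma> (det_pol d)) (\<lambda>i. X (s, a, i))}"
      using D by (auto simp: row_bad_def G_def space_pair_measure)
    also have "emeasure MX \<dots> \<le> ennreal (2 * exp (- L))"
    proof (rule row_deviation_prob[OF sa T L])
      show "Measurable.pred MX (G d)" if "d \<in> ?T" for d
        unfolding G_def using Td[OF that]
        by (intro pred_greedy borel_measurable_frozen_qval borel_measurable_const borel_measurable_P_hat measurable_X)
      show "G d X \<longleftrightarrow> G d X'" if *: "\<And>t' b i. t' < S \<Longrightarrow> b < A \<Longrightarrow> i < n \<Longrightarrow> (t', b) \<noteq> (s, a) \<Longrightarrow>
          X (t', b, i) = X' (t', b, i)" for d X X'
      proof -
        have eq: "P_hat n X t b s' = P_hat n X' t b s'" if "t < S" "b < A" "(t, b) \<noteq> (s, a)" for t b s'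
        proof -
          have "{i. i < n \<and> X (t, b, i) = s'} = {i. i < n \<and> X' (t, b, i) = s'}"
            using *[OF that(1,2) _ that(3)] by auto
          then show ?thesis by (simp only: P_hat_def)
        qed
        \<comment> \<open>The kernels agree as functions because \<open>frozen_kernel\<close>
          vanishes outside the states and actions as well as in the erased row.\<close>
        have "frozen_kernel S A s a (P_hat n X) = frozen_kernel S A s a (P_hat n X')"
          unfolding frozen_kernel_def by (intro ext if_cong refl) (elim conjE, rule eq)
        then show ?thesis by (simp only: G_def)
      qed
      show "d = d'" if "d \<in> ?T" "d' \<in> ?T" "G d X" "G d' X" for d d' X
        using greedy_unique[OF that(3,4)[unfolded G_def]] Td that(1,2) by (intro PiE_ext[OF that(1,2)]) simp
    qed
    finally show "emeasure MX ((\<lambda>X. (X, D)) -` row_bad L q s a) \<le> ennreal (2 * exp (- L))" .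
  qed
qed

lemma star_bad:
  assumes sa: "s < S" "a < A" and L: "0 < L"
  shows "star_bad L s a \<in> sets M" "emeasure M (star_bad L s a) \<le> ennreal (2 * exp (- L))"
proof -
  have "Measurable.pred M (\<lambda>\<omega>. deviates S n \<gamma> L (K s a) (Vopt S A K r \<gamma>) (\<lambda>i. fst \<omega> (s, a, i)))"
    by (intro pred_deviates measurable_fst_X sa)
  then show *: "star_bad L s a \<in> sets M" unfolding star_bad_def by (simp only: pred_def)
  show "emeasure M (star_bad L s a) \<le> ennreal (2 * exp (- L))"
  proof (rule emeasure_pair_le(2)[OF prob_MX prob_MD *])
    fix D assume D: "D \<in> space MD"
    \<comment> \<open>The optimal value does not depend on the data, so the row bound is applied
      with a single index and a trivial event.\<close>
    have "(\<lambda>X. (X, D)) -` star_bad L s a = {X \<in> space MX. \<exists>t\<in>{()}. True \<and>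
        deviates S n \<gamma> L (K s a) (Vopt S A K r \<gamma>) (\<lambda>i. X (s, a, i))}"
      using D by (auto simp: star_bad_def space_pair_measure)
    also have "emeasure MX \<dots> \<le> ennreal (2 * exp (- L))"
      using row_deviation_prob[OF sa _ L, of "{()}" "\<lambda>_ _. True" "\<lambda>_. Vopt S A K r \<gamma>"] by simp
    finally show "emeasure MX ((\<lambda>X. (X, D)) -` star_bad L s a) \<le> ennreal (2 * exp (- L))" .
  qed
qed

text \<open>The product space contains outcomes outside the supports. They form a null set,
  discarded so that sums against the empirical kernel become averages over samples.\<close>

lemma samples_bad: "samples_bad \<in> sets M" "emeasure M samples_bad \<le> 0"
proof -
  have pred: "Measurable.pred N (\<lambda>\<omega>. \<not> (\<forall>j\<in>MI. f \<omega> j < S))"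
    if f: "\<And>j. j \<in> MI \<Longrightarrow> (\<lambda>\<omega>. f \<omega> j) \<in> measurable N (count_space UNIV)"
    for N and f :: "'z \<Rightarrow> nat \<times> nat \<times> nat \<Rightarrow> nat"
  proof (rule pred_intros_logic, rule pred_intros_finite[OF finite_MI])
    fix j assume "j \<in> MI"
    from measurable_compose[OF f[OF this], of "\<lambda>x. x < S" "count_space UNIV"]
    show "Measurable.pred N (\<lambda>\<omega>. f \<omega> j < S)" by simp
  qed
  have "(\<lambda>\<omega>. fst \<omega> j) \<in> measurable M (count_space UNIV)" if "j \<in> MI" for j
    using that measurable_fst_X by auto
  from pred[of fst M, OF this]
  show *: "samples_bad \<in> sets M" unfolding samples_bad_def by (simp only: pred_def)
  have ae: "AE X in MX. \<forall>j\<in>MI. X j < S"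
  proof (intro AE_finite_allI finite_MI AE_PiM_component prob_MP)
    fix j assume "j \<in> MI"
    then obtain s a i where j: "j = (s, a, i)" "s < S" "a < A" by auto
    then show "AE x in MP j. x < S" using P_support[OF j(2,3)] by (auto simp: AE_measure_pmf_iff)
  qed
  have "(\<lambda>X. X j) \<in> measurable MX (count_space UNIV)" if "j \<in> MI" for j
    using that measurable_X by auto
  from pred[of "\<lambda>X. X" MX, OF this]
  have "{X \<in> space MX. \<not> (\<forall>j\<in>MI. X j < S)} \<in> sets MX" by (simp only: pred_def)
  then have "emeasure MX {X \<in> space MX. \<not> (\<forall>j\<in>MI. X j < S)} = 0"
    by (rule iffD1[OF AE_iff_measurable[OF _ refl] ae])
  moreover have "(\<lambda>X. (X, D)) -` samples_bad = {X \<in> space MX. \<not> (\<forall>j\<in>MI. X j < S)}" if "D \<in> space MD" for D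
    using that by (auto simp: samples_bad_def space_pair_measure)
  ultimately show "emeasure M samples_bad \<le> 0"
    by (intro emeasure_pair_le(2)[OF prob_MX prob_MD *]) simp
qed

lemma noise_bad: "noise_bad \<in> sets M" "emeasure M noise_bad \<le> 0"
proof -
  let ?J = "{..<S} \<times> {..<A}"
  let ?Q = "\<lambda>D. \<forall>j\<in>?J. 0 \<le> D j \<and> D j \<le> \<xi>"
  have pred: "Measurable.pred N (\<lambda>\<omega>. \<not> ?Q (f \<omega>))" if "\<And>j. j \<in> ?J \<Longrightarrow> (\<lambda>\<omega>. f \<omega> j) \<in> borel_measurable N"
    for N and f :: "'z \<Rightarrow> nat \<times> nat \<Rightarrow> real"
  proof (rule pred_intros_logic, rule pred_intros_finite)
    fix j assume "j \<in> ?J"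
    note [measurable] = that[OF this]
    show "Measurable.pred N (\<lambda>\<omega>. 0 \<le> f \<omega> j \<and> f \<omega> j \<le> \<xi>)" by measurable
  qed auto
  show *: "noise_bad \<in> sets M"
    unfolding noise_bad_def using pred[of snd M] measurable_snd_D by (auto simp: pred_def)
  have ae: "AE D in MD. ?Q D"
  proof (intro AE_finite_allI AE_PiM_component prob_uniform)
    fix j assume "j \<in> ?J"
    show "AE x in uniform_measure lborel {0..\<xi>}. 0 \<le> x \<and> x \<le> \<xi>"
      by (intro AE_uniform_measureI) auto
  qed auto
  have "{D \<in> space MD. \<not> ?Q D} \<in> sets MD"
    using pred[of "\<lambda>D. D" MD] measurable_D by (auto simp: pred_def)
  then have "emeasure MD {D \<in> space MD. \<not> ?Q D} = 0"
    by (rule iffD1[OF AE_iff_measurable[OF _ refl] ae])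
  moreover have "Pair X -` noise_bad = {D \<in> space MD. \<not> ?Q D}" if "X \<in> space MX" for X
    using that by (auto simp: noise_bad_def space_pair_measure)
  ultimately show "emeasure M noise_bad \<le> 0"
    by (intro emeasure_pair_le(1)[OF prob_MX prob_MD *]) simp
qed

end

section \<open>The union bound and the choice of constants\<close>

context sampled_mdp
begin

lemma high_probability_policy_error:
  fixes \<delta> L \<eta> :: real and N :: nat
  assumes L: "0 < L" and eta: "0 < \<eta>" and N: "8 / (\<eta> * (1 - \<gamma>)) \<le> real N"
    and \<delta>: "real (S * A * A) * (4 * \<eta> / ((1 - \<gamma>) * \<xi>)) + real (S * A * (N + 2)) * (2 * exp (- L)) \<le> \<delta>"
  shows "\<exists>E\<in>sets M. 1 - \<delta> \<le> measure M E \<and>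
    (\<forall>\<omega>\<in>E. \<forall>\<pi>. is_optimal_policy S A (P_hat n (fst \<omega>)) (r_tilde r (snd \<omega>)) \<gamma> \<pi> \<longrightarrow>
      (\<forall>s<S. \<bar>Vpol S A K r \<gamma> \<pi> s - Vopt S A K r \<gamma> s\<bar>
        \<le> (64 * sqrt (L * (span S (Vopt S A K r \<gamma>) + 1) / n)
          + 64 * sqrt (L * (span S (Vpol S A K r \<gamma> \<pi>) + 1) / n) + \<xi>) / (1 - \<gamma>)))"
proof -
  interpret M: prob_space M by (rule prob_M)
  \<comment> \<open>Equal actions have gap zero and must be left out.\<close>
  define IG where "IG = {j \<in> {..<S} \<times> {..<A} \<times> {..<A}. snd (snd j) \<noteq> fst (snd j)}"
  define IR where "IR = {..<S} \<times> {..<A} \<times> {..N}"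
  define IS where "IS = {..<S} \<times> {..<A}"
  define BG where "BG = (\<Union>(s, a, b)\<in>IG. gap_bad \<eta> s a b)"
  define BR where "BR = (\<Union>(s, a, k)\<in>IR. row_bad L (real k * (\<eta> / 4)) s a)"
  define BS where "BS = (\<Union>(s, a)\<in>IS. star_bad L s a)"
  have fin: "finite IG" "finite IR" "finite IS" by (auto simp: IG_def IR_def IS_def)
  have union_le: "(\<Union>j\<in>F. B j) \<in> sets M \<and> measure M (\<Union>j\<in>F. B j) \<le> real m * c"
    if F: "finite F" "card F \<le> m" and c: "0 \<le> c"
      and B: "\<And>j. j \<in> F \<Longrightarrow> B j \<in> sets M" "\<And>j. j \<in> F \<Longrightarrow> emeasure M (B j) \<le> ennreal c"
    for F :: "'j set" and B m c
  proof
    show "(\<Union>j\<in>F. B j) \<in> sets M" using F B by auto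
    have "measure M (\<Union>j\<in>F. B j) \<le> (\<Sum>j\<in>F. measure M (B j))"
      using F B by (intro M.finite_measure_subadditive_finite) auto
    also have "\<dots> \<le> (\<Sum>j\<in>F. c)"
      using B(2) by (intro sum_mono) (simp only: M.emeasure_eq_measure ennreal_le_iff[OF c])
    also have "\<dots> = real (card F) * c" by simp
    also have "\<dots> \<le> real m * c" using F c by (intro mult_right_mono) auto
    finally show "measure M (\<Union>j\<in>F. B j) \<le> real m * c" .
  qed
  let ?cg = "4 * \<eta> / ((1 - \<gamma>) * \<xi>)" and ?cr = "2 * exp (- L)"
  have cg: "0 \<le> ?cg" using eta discount noise by simp
  have "card IG \<le> card ({..<S} \<times> {..<A} \<times> {..<A})" by (intro card_mono) (auto simp: IG_def)
  also have "\<dots> = S * A * A" by (simp add: card_cartesian_product)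
  finally have cardG: "card IG \<le> S * A * A" .
  have cardR: "card IR \<le> S * A * (N + 1)" and cardS: "card IS \<le> S * A"
    by (simp_all add: IR_def IS_def card_cartesian_product algebra_simps)
  have G: "BG \<in> sets M \<and> measure M BG \<le> real (S * A * A) * ?cg" unfolding BG_def
  proof (rule union_le[OF fin(1) cardG cg])
    fix j assume "j \<in> IG"
    then obtain s a b where j: "j = (s, a, b)" "s < S" "a < A" "b < A" "b \<noteq> a" by (auto simp: IG_def)
    show "(case j of (s, a, b) \<Rightarrow> gap_bad \<eta> s a b) \<in> sets M"
      "emeasure M (case j of (s, a, b) \<Rightarrow> gap_bad \<eta> s a b) \<le> ennreal ?cg"
      using gap_bad[OF j(2-5), of \<eta>] eta unfolding j(1) by simp_all
  qed
  have R: "BR \<in> sets M \<and> measure M BR \<le> real (S * A * (N + 1)) * ?cr" unfolding BR_def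
  proof (rule union_le[OF fin(2) cardR])
    fix j assume "j \<in> IR"
    then obtain s a k where j: "j = (s, a, k)" "s < S" "a < A" by (auto simp: IR_def)
    show "(case j of (s, a, k) \<Rightarrow> row_bad L (real k * (\<eta> / 4)) s a) \<in> sets M"
      "emeasure M (case j of (s, a, k) \<Rightarrow> row_bad L (real k * (\<eta> / 4)) s a) \<le> ennreal ?cr"
      using row_bad[OF j(2,3) L] unfolding j(1) by simp_all
  qed simp
  have St: "BS \<in> sets M \<and> measure M BS \<le> real (S * A) * ?cr" unfolding BS_def
  proof (rule union_le[OF fin(3) cardS])
    fix j assume "j \<in> IS"
    then obtain s a where j: "j = (s, a)" "s < S" "a < A" by (auto simp: IS_def)
    show "(case j of (s, a) \<Rightarrow> star_bad L s a) \<in> sets M"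
      "emeasure M (case j of (s, a) \<Rightarrow> star_bad L s a) \<le> ennreal ?cr"
      using star_bad[OF j(2,3) L] unfolding j(1) by simp_all
  qed simp
  have O: "measure M samples_bad = 0" "measure M noise_bad = 0"
    using samples_bad(2) noise_bad(2) by (simp_all add: measure_def)
  define B where "B = BG \<union> (BR \<union> (BS \<union> (samples_bad \<union> noise_bad)))"
  have Bm: "B \<in> sets M" unfolding B_def using G R St samples_bad(1) noise_bad(1) by (intro sets.Un) auto
  have sub: "measure M (U \<union> V) \<le> measure M U + measure M V" if "U \<in> sets M" "V \<in> sets M" for U V
    using that by (rule measure_Un_le)
  have "measure M B \<le> measure M BG + (measure M BR + (measure M BS + (measure M samples_bad + measure M noise_bad)))"
    unfolding B_def using G R St samples_bad(1) noise_bad(1)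
    by (intro order_trans[OF sub] add_left_mono sets.Un) auto
  also have "\<dots> \<le> real (S * A * A) * ?cg + (real (S * A * (N + 1)) * ?cr + (real (S * A) * ?cr + (0 + 0)))"
    using G R St O by (intro add_mono) auto
  \<comment> \<open>For each pair, \<open>N + 2\<close> counts the \<open>N + 1\<close> grid points
    \<open>0, ..., N\<close> and one event for the optimal value.\<close>
  also have "\<dots> = real (S * A * A) * ?cg + real (S * A * (N + 2)) * ?cr" by (simp add: algebra_simps)
  also have "\<dots> \<le> \<delta>" by (rule \<delta>)
  finally have mB: "measure M B \<le> \<delta>" .
  show ?thesis
  proof (intro bexI[of _ "space M - B"] conjI ballI allI impI)
    show "space M - B \<in> sets M" using Bm by auto
    show "1 - \<delta> \<le> measure M (space M - B)" using M.prob_compl[OF Bm] mB by simp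
    fix \<omega> \<pi> s
    assume \<omega>: "\<omega> \<in> space M - B" and opt: "is_optimal_policy S A (P_hat n (fst \<omega>)) (r_tilde r (snd \<omega>)) \<gamma> \<pi>" and s: "s < S"
    have sp: "\<omega> \<in> space M" and nG: "\<omega> \<notin> BG" and nR: "\<omega> \<notin> BR" and nS: "\<omega> \<notin> BS"
      and nX: "\<omega> \<notin> samples_bad" and nD: "\<omega> \<notin> noise_bad" using \<omega> by (auto simp: B_def)
    show "\<bar>Vpol S A K r \<gamma> \<pi> s - Vopt S A K r \<gamma> s\<bar>
        \<le> (64 * sqrt (L * (span S (Vopt S A K r \<gamma>) + 1) / n)
          + 64 * sqrt (L * (span S (Vpol S A K r \<gamma> \<pi>) + 1) / n) + \<xi>) / (1 - \<gamma>)"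
    proof (rule policy_error_on_good_event[where X="fst \<omega>" and D="snd \<omega>" and \<eta>=\<eta> and N=N])
      fix t a i assume "t < S" "a < A" "i < n"
      then show "fst \<omega> (t, a, i) < S" using nX sp by (auto simp: samples_bad_def)
    next
      fix t a assume "t < S" "a < A"
      then show "0 \<le> snd \<omega> (t, a) \<and> snd \<omega> (t, a) \<le> \<xi>" using nD sp by (auto simp: noise_bad_def)
    next
      fix t a b assume t: "t < S" "a < A" "b < A" "a \<noteq> b"
      then have "(t, a, b) \<in> IG" by (auto simp: IG_def)
      then have "\<omega> \<notin> gap_bad \<eta> t a b" using nG unfolding BG_def by blast
      then show "\<eta> \<le> \<bar>qval S (P_hat n (fst \<omega>)) (r_tilde r (snd \<omega>)) \<gamma> (Vopt S A (P_hat n (fst \<omega>)) (r_tilde r (snd \<omega>)) \<gamma>) t a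
        - qval S (P_hat n (fst \<omega>)) (r_tilde r (snd \<omega>)) \<gamma> (Vopt S A (P_hat n (fst \<omega>)) (r_tilde r (snd \<omega>)) \<gamma>) t b\<bar>"
        using sp by (simp add: gap_bad_def)
    next
      fix t a d and k :: nat
      assume t: "t < S" "a < A" "k \<le> N" "d \<in> PiE {..<S} (\<lambda>_. {..<A})"
        "greedy S A (frozen_qval S A t a (real k * (\<eta> / 4)) (P_hat n (fst \<omega>)) (r_tilde r (snd \<omega>)) \<gamma>) d"
      then have "(t, a, k) \<in> IR" by (auto simp: IR_def)
      then have "\<omega> \<notin> row_bad L (real k * (\<eta> / 4)) t a" using nR unfolding BR_def by blast
      then show "\<not> deviates S n \<gamma> L (K t a) (Vpol S A K r \<gamma> (det_pol d)) (\<lambda>i. fst \<omega> (t, a, i))"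
        using sp t(4,5) unfolding row_bad_def by blast
    next
      fix t a assume t: "t < S" "a < A"
      then have "(t, a) \<in> IS" by (auto simp: IS_def)
      then have "\<omega> \<notin> star_bad L t a" using nS unfolding BS_def by blast
      then show "\<not> deviates S n \<gamma> L (K t a) (Vopt S A K r \<gamma>) (\<lambda>i. fst \<omega> (t, a, i))"
        using sp unfolding star_bad_def by blast
    qed (use SA n_pos discount L eta P_support reward noise N opt s in simp_all)
  qed
qed

end

text \<open>Everything inside the logarithm is polynomial in
  \<open>x = S A n / ((1 - \<gamma>) \<delta> \<xi>)\<close>, which gives
  \<open>12 * \<Lambda>\<close>. The cube is reached because \<open>\<Lambda> \<ge> 1 / 2\<close>;
  this rests on \<open>x \<ge> 2\<close>, hence on having at least two actions.\<close>

lemma log_union_bound: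
  fixes \<gamma> \<xi> \<delta> \<eta> :: real
  assumes S: "0 < S" and A: "2 \<le> A" and n: "0 < n" and g: "0 < \<gamma>" "\<gamma> < 1"
    and xi: "0 < \<xi>" "\<xi> \<le> 1 / real n" and \<delta>: "0 < \<delta>" "\<delta> < 1"
    and \<eta>: "\<eta> = \<delta> * (1 - \<gamma>) * \<xi> / (8 * real (S * A * A))"
    and N: "N = nat \<lceil>8 / (\<eta> * (1 - \<gamma>))\<rceil>"
  defines "\<Lambda> \<equiv> ln (real (S * A * n) / ((1 - \<gamma>) * \<delta> * \<xi>))"
  shows "ln (4 * real (S * A * (N + 2)) / \<delta>) \<le> 48 * \<Lambda> ^ 3" "1 \<le> ln (4 * real (S * A * (N + 2)) / \<delta>)"
proof -
  define q where "q = (1 - \<gamma>) * \<delta> * \<xi>"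
  define x where "x = real (S * A * n) / q"
  have "1 / real n \<le> 1" using n by simp
  then have xi1: "\<xi> \<le> 1" using xi by linarith
  have q: "0 < q" "q \<le> \<xi>" "q \<le> 1"
  proof -
    show "0 < q" using g \<delta> xi by (simp add: q_def)
    have "(1 - \<gamma>) * \<delta> \<le> 1 * 1" using g \<delta> by (intro mult_mono) auto
    then have "(1 - \<gamma>) * \<delta> * \<xi> \<le> 1 * \<xi>" using xi by (intro mult_right_mono) auto
    then show "q \<le> \<xi>" "q \<le> 1" using xi1 by (auto simp: q_def)
  qed
  have SA: "1 \<le> real S" "2 \<le> real A" "1 \<le> real n" using S A n by auto
  have SAq: "real S * real A / q \<le> x"
    using SA q unfolding x_def by (intro divide_right_mono) (auto simp: mult_left_le)
  have "2 \<le> real S * real A" using mult_mono[of 1 "real S" 2 "real A"] SA by simp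
  moreover have "real S * real A \<le> real S * real A / q" using q SA by (simp add: pos_le_divide_eq mult_left_le)
  ultimately have x2: "2 \<le> x" using SAq by linarith
  have e0: "0 < \<eta>" using \<eta> g \<delta> xi SA by simp
  have "\<eta> * (1 - \<gamma>) = q * (1 - \<gamma>) / (8 * real (S * A * A))" by (simp add: \<eta> q_def)
  then have "8 / (\<eta> * (1 - \<gamma>)) = 64 * real (S * A * A) / (q * (1 - \<gamma>))" by simp
  \<comment> \<open>The extra horizon factor is absorbed into a second \<open>1 / q\<close>, since
    \<open>q \<le> 1 - \<gamma>\<close>.\<close>
  also have "\<dots> \<le> 64 * real (S * A * A) / (q * q)"
  proof -
    have "q \<le> 1 - \<gamma>"
    proof -
      have "\<delta> * \<xi> \<le> 1 * 1" using xi1 xi \<delta> by (intro mult_mono) auto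
      then have "(1 - \<gamma>) * (\<delta> * \<xi>) \<le> (1 - \<gamma>) * 1" using g by (intro mult_left_mono) auto
      then show ?thesis by (simp add: q_def mult.assoc)
    qed
    then show ?thesis using q by (intro divide_left_mono mult_left_mono) auto
  qed
  also have "\<dots> \<le> 64 * x\<^sup>2"
  proof -
    have "real (S * A * A) / (q * q) \<le> (real S * real A / q) * (real S * real A / q)"
      using SA q by (simp add: divide_right_mono field_simps)
    also have "\<dots> \<le> x * x" using SAq q x2 by (intro mult_mono) auto
    finally show ?thesis by (simp add: power2_eq_square)
  qed
  finally have N1: "8 / (\<eta> * (1 - \<gamma>)) \<le> 64 * x\<^sup>2" .
  have "0 \<le> 8 / (\<eta> * (1 - \<gamma>))" using e0 g by simp
  then have "real N \<le> 8 / (\<eta> * (1 - \<gamma>)) + 1" unfolding N by linarith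
  then have "real (N + 2) \<le> 64 * x\<^sup>2 + 3" using N1 by simp
  also have "\<dots> \<le> 128 * x\<^sup>2" using power_mono[OF x2, of 2] by simp
  finally have N2: "real (N + 2) \<le> 128 * x\<^sup>2" .
  have "real (S * A) / \<delta> \<le> x"
  proof -
    have "q \<le> \<delta>"
    proof -
      have "(1 - \<gamma>) * \<xi> \<le> 1 * 1" using xi1 xi g by (intro mult_mono) auto
      then have "((1 - \<gamma>) * \<xi>) * \<delta> \<le> 1 * \<delta>" using \<delta> by (intro mult_right_mono) auto
      then show ?thesis by (simp add: q_def mult_ac)
    qed
    then have "real (S * A) / \<delta> \<le> real (S * A) / q" using q \<delta> by (intro divide_left_mono) auto
    then show ?thesis using SAq by simp
  qed
  then have "4 * (real (S * A) / \<delta> * real (N + 2)) \<le> 4 * (x * (128 * x\<^sup>2))"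
    using N2 x2 \<delta> by (intro mult_left_mono mult_mono) auto
  \<comment> \<open>The numerical factor is \<open>4 * 128 = 2 ^ 9\<close>, and
    \<open>x \<ge> 2\<close> absorbs it into \<open>x ^ 9\<close>.\<close>
  also have "4 * (x * (128 * x\<^sup>2)) = 2 ^ 9 * x ^ 3" by (simp add: power2_eq_square power3_eq_cube)
  also have "\<dots> \<le> x ^ 9 * x ^ 3" using x2 by (intro mult_right_mono power_mono) auto
  also have "\<dots> = x ^ 12" by (simp flip: power_add)
  also have "4 * (real (S * A) / \<delta> * real (N + 2)) = 4 * real (S * A * (N + 2)) / \<delta>"
    unfolding of_nat_mult[of "S * A"] by (simp only: times_divide_eq_left times_divide_eq_right)
  finally have le: "4 * real (S * A * (N + 2)) / \<delta> \<le> x ^ 12" .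
  have "0 < S * A * (N + 2)" using S A by simp
  then have "0 < real (S * A * (N + 2))" by (simp only: of_nat_0_less_iff)
  then have pos: "0 < 4 * real (S * A * (N + 2)) / \<delta>"
    using \<delta> by (intro divide_pos_pos mult_pos_pos) simp_all
  have L: "\<Lambda> = ln x" by (simp add: \<Lambda>_def x_def q_def)
  have "ln (4 * real (S * A * (N + 2)) / \<delta>) \<le> ln (x ^ 12)" using le pos x2 by (subst ln_le_cancel_iff) auto
  also have "\<dots> = 12 * \<Lambda>" using x2 by (simp add: L ln_realpow)
  also have "\<dots> \<le> 48 * \<Lambda> ^ 3"
  proof -
    have "1 / 2 \<le> ln (2::real)"
      using exp_half_le2 ln_le_cancel_iff[of "exp (1 / 2)" "2::real"] by simp
    also have "\<dots> \<le> \<Lambda>" unfolding L using x2 by (subst ln_le_cancel_iff) auto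
    finally have l: "1 / 2 \<le> \<Lambda>" .
    have "(1 / 2)\<^sup>2 \<le> \<Lambda>\<^sup>2" using l by (intro power_mono) auto
    then have "1 \<le> 4 * \<Lambda>\<^sup>2" by (simp add: power2_eq_square)
    then have "\<Lambda> * 1 \<le> \<Lambda> * (4 * \<Lambda>\<^sup>2)" using l by (intro mult_left_mono) auto
    then show ?thesis by (simp add: power2_eq_square power3_eq_cube)
  qed
  finally show "ln (4 * real (S * A * (N + 2)) / \<delta>) \<le> 48 * \<Lambda> ^ 3" .
  \<comment> \<open>The lower bound on the logarithm serves later to hide the perturbation term
    \<open>\<xi> \<le> 1 / n\<close> under the square root.\<close>
  have "exp 1 \<le> (3::real)" using exp_le .
  also have "3 \<le> 4 * real (S * A * (N + 2))"
  proof -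
    have "1 \<le> S * A * (N + 2)" using \<open>0 < S * A * (N + 2)\<close> by linarith
    then have "real 1 \<le> real (S * A * (N + 2))" by (rule of_nat_mono)
    then have "4 * real 1 \<le> 4 * real (S * A * (N + 2))" by (intro mult_left_mono) auto
    then show ?thesis by (rule order_trans[rotated]) simp
  qed
  also have "\<dots> \<le> 4 * real (S * A * (N + 2)) / \<delta>" using \<delta> by (simp add: pos_le_divide_eq mult_left_le)
  finally have "ln (exp 1) \<le> ln (4 * real (S * A * (N + 2)) / \<delta>)" using pos by (subst ln_le_cancel_iff) auto
  then show "1 \<le> ln (4 * real (S * A * (N + 2)) / \<delta>)" by simp
qed

lemma sup_norm_le:
  assumes "0 < S" "\<And>s. s < S \<Longrightarrow> \<bar>f s\<bar> \<le> b"
  shows "sup_norm S f \<le> b"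
  unfolding sup_norm_def using assms by (intro Max.boundedI) auto

text \<open>Since \<open>1 \<le> L\<close>, the perturbation term is at most
  \<open>1 / n \<le> \<rho>\<close>, so the numerator is at most
  \<open>(64 + 64 + 1) * \<rho>\<close>. The final constant is
  \<open>129\<^sup>2 * 48 = 798768\<close>, rounded up to \<open>1000000\<close>.\<close>

lemma three_term_error_le:
  fixes L T b :: real
  assumes n: "0 < n" and g: "\<gamma> < 1" and L: "1 \<le> L" "L \<le> 48 * b" and u: "0 \<le> u" "0 \<le> v"
    and xi: "\<xi> \<le> 1 / real n"
  shows "(64 * sqrt (L * (u + 1) / n) + 64 * sqrt (L * (v + 1) / n) + \<xi>) / (1 - \<gamma>)
    \<le> 1 / (1 - \<gamma>) * sqrt (1000000 * b / n * (u + v + 1))"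
proof -
  define \<rho> where "\<rho> = sqrt (L * (u + v + 1) / n)"
  have "sqrt (L * (u + 1) / n) \<le> \<rho>" "sqrt (L * (v + 1) / n) \<le> \<rho>"
    unfolding \<rho>_def using L u by (auto intro!: divide_right_mono mult_left_mono)
  moreover have "1 / real n \<le> \<rho>"
  proof -
    have "1 * 1 \<le> L * (u + v + 1)" using L u by (intro mult_mono) auto
    then have "1 / real n \<le> L * (u + v + 1) / n" by (intro divide_right_mono) auto
    moreover have "(1 / real n)\<^sup>2 \<le> 1 / real n" using n by (simp add: power2_eq_square field_simps)
    ultimately show ?thesis unfolding \<rho>_def by (intro real_le_rsqrt) linarith
  qed
  ultimately have "64 * sqrt (L * (u + 1) / n) + 64 * sqrt (L * (v + 1) / n) + \<xi> \<le> 129 * \<rho>"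
    using xi by linarith
  also have "\<dots> = sqrt (129\<^sup>2 * (L * (u + v + 1) / n))"
    unfolding \<rho>_def real_sqrt_mult by simp
  also have "\<dots> \<le> sqrt (1000000 * b / n * (u + v + 1))"
  proof -
    have "129\<^sup>2 * L \<le> 1000000 * b" using L by simp
    then have "129\<^sup>2 * L * ((u + v + 1) / n) \<le> 1000000 * b * ((u + v + 1) / n)"
      using u by (intro mult_right_mono) auto
    then show ?thesis by simp
  qed
  finally show ?thesis using g by (simp add: divide_right_mono)
qed

theorem mainTheorem9:
  shows "\<exists>C>0. \<forall>S A n (P :: nat \<Rightarrow> nat \<Rightarrow> nat pmf) (r :: nat \<Rightarrow> nat \<Rightarrow> real) (\<gamma>::real) (\<xi>::real) (\<delta>::real).
    0 < S \<and> 0 < A \<and> 0 < n \<and>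
    (\<forall>s<S. \<forall>a<A. set_pmf (P s a) \<subseteq> {..<S}) \<and>
    (\<forall>s<S. \<forall>a<A. 0 \<le> r s a \<and> r s a \<le> 1) \<and>
    0 < \<gamma> \<and> \<gamma> < 1 \<and> 0 < \<xi> \<and> \<xi> \<le> 1 / real n \<and> 0 < \<delta> \<and> \<delta> < 1
    \<longrightarrow>
    (\<exists>E \<in> sets (sample_space S A n P \<xi>).
       1 - \<delta> \<le> measure (sample_space S A n P \<xi>) E \<and>
       (\<forall>\<omega>\<in>E. \<forall>\<pi>. is_optimal_policy S A (P_hat n (fst \<omega>)) (r_tilde r (snd \<omega>)) \<gamma> \<pi> \<longrightarrow>
          sup_norm S (\<lambda>s. Vpol S A (\<lambda>s a s'. pmf (P s a) s') r \<gamma> \<pi> s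
                          - Vstar S A (\<lambda>s a s'. pmf (P s a) s') r \<gamma> s)
          \<le> 1 / (1 - \<gamma>) * sqrt (C * ln (real (S * A * n) / ((1 - \<gamma>) * \<delta> * \<xi>)) ^ 3 / real n
               * (span S (Vstar S A (\<lambda>s a s'. pmf (P s a) s') r \<gamma>)
                  + span S (Vpol S A (\<lambda>s a s'. pmf (P s a) s') r \<gamma> \<pi>) + 1))))"
proof (intro exI[of _ "1000000::real"] conjI allI impI, goal_cases)
  case 1
  show ?case by simp
next
  case (2 S A n P r \<gamma> \<xi> \<delta>)
  then have S: "0 < S" and A: "0 < A" and n: "0 < n" and g: "0 < \<gamma>" "\<gamma> < 1" and \<delta>: "0 < \<delta>" "\<delta> < 1"
    and xi: "0 < \<xi>" "\<xi> \<le> 1 / real n" by auto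
  have "1 / real n \<le> 1" using n by simp
  then have xi1: "\<xi> \<le> 1" using xi by linarith
  interpret sampled_mdp S A n P r \<gamma> \<xi>
    using 2 xi1 by unfold_locales auto
  have M: "sample_space S A n P \<xi> = M" by (simp only: sample_space_def)
  have K: "substoch S A K" by (rule substoch_pmf(1)[OF P_support])
  have g0: "0 \<le> \<gamma>" using g by simp
  have Vs: "Vstar S A K r \<gamma> s = Vopt S A K r \<gamma> s" if "s < S" for s
    by (rule Vstar_eq_Vopt[OF K A g0 g(2) that])
  then have sp: "span S (Vstar S A K r \<gamma>) = span S (Vopt S A K r \<gamma>)"
    unfolding span_def by (metis (mono_tags, lifting) image_cong lessThan_iff)
  let ?\<Lambda> = "ln (real (S * A * n) / ((1 - \<gamma>) * \<delta> * \<xi>))"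
  show ?case
  proof (cases "A = 1")
    case True
    interpret M: prob_space M by (rule prob_M)
    obtain d where d: "\<And>s. s < S \<Longrightarrow> d s < A"
      "\<And>s. s < S \<Longrightarrow> Vpol S A K r \<gamma> (det_pol d) s = Vopt S A K r \<gamma> s"
      using optimal_det_pol_exists[OF K A g0 g(2)] by metis
    have eq: "Vpol S A K r \<gamma> \<pi> s - Vstar S A K r \<gamma> s = 0" if "is_policy S A \<pi>" "s < S" for \<pi> s
    proof -
      have "\<pi> t a = det_pol d t a" if "t < S" "a < A" for t a
        using \<open>is_policy S A \<pi>\<close> that d(1)[OF that(1)] True by (simp add: is_policy_def det_pol_def)
      then have "Vpol S A K r \<gamma> \<pi> = Vpol S A K r \<gamma> (det_pol d)" by (rule Vpol_cong)
      then show ?thesis using d(2) Vs that by simp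
    qed
    have "(1 - \<gamma>) * \<delta> * \<xi> \<le> 1 * 1 * 1" using g \<delta> xi xi1 by (intro mult_mono) auto
    also have "1 * 1 * 1 \<le> real (S * A * n)"
    proof -
      have "1 \<le> S * A * n" using S A n by simp
      then show ?thesis by linarith
    qed
    finally have \<Lambda>: "0 \<le> ?\<Lambda>" using g \<delta> xi by (intro ln_ge_zero) simp
    show ?thesis unfolding M sp
    proof (intro bexI[of _ "space M"] conjI ballI allI impI)
      fix \<omega> \<pi> assume "is_optimal_policy S A (P_hat n (fst \<omega>)) (r_tilde r (snd \<omega>)) \<gamma> \<pi>"
      then have p: "is_policy S A \<pi>" by (simp add: is_optimal_policy_def)
      have "0 \<le> 1 / (1 - \<gamma>) * sqrt (1000000 * ?\<Lambda> ^ 3 / real n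
          * (span S (Vopt S A K r \<gamma>) + span S (Vpol S A K r \<gamma> \<pi>) + 1))"
        using g \<Lambda> span_bounds(5)[OF S] by (intro mult_nonneg_nonneg real_sqrt_ge_zero) (auto intro!: add_nonneg_nonneg)
      then show "sup_norm S (\<lambda>s. Vpol S A K r \<gamma> \<pi> s - Vstar S A K r \<gamma> s)
          \<le> 1 / (1 - \<gamma>) * sqrt (1000000 * ?\<Lambda> ^ 3 / real n
          * (span S (Vopt S A K r \<gamma>) + span S (Vpol S A K r \<gamma> \<pi>) + 1))"
        using eq[OF p] S by (intro sup_norm_le) auto
    qed (use \<delta> M.prob_space in auto)
  next
    case False
    \<comment> \<open>Chosen so that the gap events cost \<open>\<delta> / 2\<close> in total: at
      most \<open>S * A * A\<close> of them, each bounded by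
      \<open>4 * \<eta> / ((1 - \<gamma>) * \<xi>)\<close>.\<close>
    define \<eta> where "\<eta> = \<delta> * (1 - \<gamma>) * \<xi> / (8 * real (S * A * A))"
    define N where "N = nat \<lceil>8 / (\<eta> * (1 - \<gamma>))\<rceil>"
    \<comment> \<open>The other \<open>\<delta> / 2\<close> is spent on
      \<open>S * A * (N + 2)\<close> deviation events, each of probability at most
      \<open>2 * exp (- L)\<close>.\<close>
    define L where "L = ln (4 * real (S * A * (N + 2)) / \<delta>)"
    have L: "L \<le> 48 * ?\<Lambda> ^ 3" "1 \<le> L"
      using log_union_bound[OF S _ n g xi \<delta> \<eta>_def N_def] A False by (auto simp: L_def)
    have eta: "0 < \<eta>" using S A g \<delta> xi by (simp add: \<eta>_def)
    have N: "8 / (\<eta> * (1 - \<gamma>)) \<le> real N" unfolding N_def by linarith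
    have bad: "real (S * A * A) * (4 * \<eta> / ((1 - \<gamma>) * \<xi>)) + real (S * A * (N + 2)) * (2 * exp (- L)) \<le> \<delta>"
    proof -
      have "real (S * A * A) * (4 * \<eta> / ((1 - \<gamma>) * \<xi>)) = \<delta> / 2"
        using S A g xi by (simp add: \<eta>_def)
      moreover have "real (S * A * (N + 2)) * (2 * exp (- L)) = \<delta> / 2"
      proof -
        define m where "m = real (S * A * (N + 2))"
        have "0 < S * A * (N + 2)" using S A by simp
        then have m: "0 < m" unfolding m_def by (simp only: of_nat_0_less_iff)
        then have "0 < 4 * m / \<delta>" using \<delta> by simp
        moreover have "L = ln (4 * m / \<delta>)" by (simp only: L_def m_def)
        ultimately have "exp (- L) = \<delta> / (4 * m)" by (simp add: exp_minus)
        then show ?thesis unfolding m_def[symmetric] using m by simp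
      qed
      ultimately show ?thesis by (simp only: field_sum_of_halves order_refl)
    qed
    have "0 < L" using L by simp
    from high_probability_policy_error[OF this eta N bad] obtain E where E: "E \<in> sets M" "1 - \<delta> \<le> measure M E"
      "\<And>\<omega> \<pi> s. \<omega> \<in> E \<Longrightarrow> is_optimal_policy S A (P_hat n (fst \<omega>)) (r_tilde r (snd \<omega>)) \<gamma> \<pi> \<Longrightarrow> s < S \<Longrightarrow>
        \<bar>Vpol S A K r \<gamma> \<pi> s - Vopt S A K r \<gamma> s\<bar>
        \<le> (64 * sqrt (L * (span S (Vopt S A K r \<gamma>) + 1) / n)
          + 64 * sqrt (L * (span S (Vpol S A K r \<gamma> \<pi>) + 1) / n) + \<xi>) / (1 - \<gamma>)"
      by blast
    show ?thesis unfolding M sp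
    proof (intro bexI[OF _ E(1)] conjI ballI allI impI E(2))
      fix \<omega> \<pi> assume \<omega>: "\<omega> \<in> E" "is_optimal_policy S A (P_hat n (fst \<omega>)) (r_tilde r (snd \<omega>)) \<gamma> \<pi>"
      show "sup_norm S (\<lambda>s. Vpol S A K r \<gamma> \<pi> s - Vstar S A K r \<gamma> s)
          \<le> 1 / (1 - \<gamma>) * sqrt (1000000 * ?\<Lambda> ^ 3 / real n
          * (span S (Vopt S A K r \<gamma>) + span S (Vpol S A K r \<gamma> \<pi>) + 1))"
      proof (rule sup_norm_le[OF S])
        fix s assume s: "s < S"
        have "\<bar>Vpol S A K r \<gamma> \<pi> s - Vopt S A K r \<gamma> s\<bar>
          \<le> 1 / (1 - \<gamma>) * sqrt (1000000 * ?\<Lambda> ^ 3 / real n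
          * (span S (Vopt S A K r \<gamma>) + span S (Vpol S A K r \<gamma> \<pi>) + 1))"
          by (rule order_trans[OF E(3)[OF \<omega> s] three_term_error_le[OF n g(2) L(2,1)
              span_bounds(5)[OF S] span_bounds(5)[OF S] xi(2)]])
        then show "\<bar>Vpol S A K r \<gamma> \<pi> s - Vstar S A K r \<gamma> s\<bar>
          \<le> 1 / (1 - \<gamma>) * sqrt (1000000 * ?\<Lambda> ^ 3 / real n
          * (span S (Vopt S A K r \<gamma>) + span S (Vpol S A K r \<gamma> \<pi>) + 1))"
          by (simp only: Vs[OF s])
      qed
    qed
  qed
qed

end
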